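(* Assume that $(G\rightrightarrows P,\mathsf D_G)$ is a Dirac groupoid such that $TP\cap\mathsf{G_0}$ is smooth. Define the subspace $\mathsf D_P$ of $\mathsf P_P=TP\oplus T^*P$ by $$\mathsf D_P(p)=\left\{(v_p,\alpha_p)\in\mathsf P_P(p)\ \middle|\ \exists\,(w_p,(T_p\mathsf t)^*\alpha_p)\in\mathsf D_G(p)\cap(T_pG\times(A_pG)^\circ)\text{ such that }v_p=T_p\mathsf t\,w_p\right\}$$ for all $p\in P$. Then $\mathsf D_P$ is a Dirac structure on $P$. Furthermore, if for all $g\in G$ the restriction of the target map $T_g\mathsf t:\mathsf{G_0}(g)\to\mathsf{G_0}(\mathsf t(g))\cap T_{\mathsf t(g)}P$ is surjective, then the maps $\mathsf t:(G,\mathsf D_G)\to(P,\mathsf D_P)$ and $\mathsf s:(G,\mathsf D_G)\to(P,-\mathsf D_P)$ are forward Dirac maps, where $-\mathsf D_P$ is the Dirac structure on $P$ defined by $(-\mathsf D_P)(p)=\{(-v_p,\alpha_p)\in\mathsf P_P(p)\mid(v_p,\alpha_p)\in\mathsf D_P(p)\}$.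
   Context: Lie groupoids. $G\rightrightarrows P$ is a Lie groupoid with source $\mathsf s$, target $\mathsf t$, product $g\star h$ defined when $\mathsf s(g)=\mathsf t(h)$; $P\subseteq G$ via the units. $L_g:\mathsf t^{-1}(\mathsf s(g))\to\mathsf t^{-1}(\mathsf t(g))$ and $R_g:\mathsf s^{-1}(\mathsf t(g))\to\mathsf s^{-1}(\mathsf s(g))$ are the translations. $AG=\ker(T\mathsf t)|_P$; $A^*G$ is identified with $(TP)^\circ\subseteq T_P^*G$ using $T_PG=TP\oplus AG$; $(A_pG)^\circ\subseteq T_p^*G$ denotes the annihilator of $A_pG$. Pontryagin groupoid. $TG\rightrightarrows TP$ is the tangent groupoid. $T^*G\rightrightarrows A^*G$: $\hat{\mathsf s}(\alpha_g)(u)=\alpha_g(T_{\mathsf s(g)}L_g u)$ for $u\in A_{\mathsf s(g)}G$, $\hat{\mathsf t}(\alpha_g)(u)=\alpha_g\big(T_{\mathsf t(g)}R_g(u-T_{\mathsf t(g)}\mathsf s\,u)\big)$ for $u\in A_{\mathsf t(g)}G$, $(\alpha_g\star\alpha_h)(v_g\star v_h)=\alpha_g(v_g)+\alpha_h(v_h)$. Together: $\mathsf P_G=TG\oplus T^*G\rightrightarrows TP\oplus A^*G$. Dirac structures. On $\mathsf P_M=TM\oplus T^*M$: $\langle(v,\alpha),(w,\beta)\rangle=\alpha(w)+\beta(v)$. A Dirac structure on $M$ means a smooth subbundle $\mathsf D\subseteq\mathsf P_M$ with $\mathsf D=\mathsf D^\perp$ (no integrability required). A Dirac groupoid is a Lie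 groupoid with a Dirac structure $\mathsf D_G$ that is a Lie subgroupoid of $\mathsf P_G\rightrightarrows TP\oplus A^*G$. $\mathsf{G_0}(g)=\{v_g\in T_gG\mid(v_g,0)\in\mathsf D_G(g)\}$. That $TP\cap\mathsf{G_0}$ is smooth means that each of its vectors is the value of a smooth local section of $TP$ taking values in $TP\cap\mathsf{G_0}$. A smooth map $F:(M,\mathsf D_M)\to(N,\mathsf D_N)$ is a forward Dirac map if for all $n\in N$, $m\in F^{-1}(n)$ and $(v_n,\alpha_n)\in\mathsf D_N(n)$ there is $(v_m,\alpha_m)\in\mathsf D_M(m)$ with $T_mFv_m=v_n$ and $\alpha_m=(T_mF)^*\alpha_n$. *)

theory Defs
  imports "HOL-Analysis.Analysis"
begin

section \<open>Smooth maps between subsets of Euclidean spaces\<close>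

text \<open>\<open>times_diff_on n N f\<close>: on the open set \<open>N\<close>, \<open>f\<close> is of class \<open>C^n\<close>.\<close>

primrec times_diff_on ::
  "nat \<Rightarrow> 'a::real_normed_vector set \<Rightarrow> ('a \<Rightarrow> 'b::real_normed_vector) \<Rightarrow> bool" where
  "times_diff_on 0 N f \<longleftrightarrow> continuous_on N f"
| "times_diff_on (Suc n) N f \<longleftrightarrow>
     (\<forall>x\<in>N. f differentiable (at x)) \<and>
     (\<forall>v. times_diff_on n N (\<lambda>x. frechet_derivative f (at x) v))"

text \<open>Smoothness on an arbitrary set: locally there are smooth extensions to open sets.\<close>

definition smooth_on ::
  "'a::real_normed_vector set \<Rightarrow> ('a \<Rightarrow> 'b::real_normed_vector) \<Rightarrow> bool" where
  "smooth_on S f \<longleftrightarrow>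
     (\<forall>x\<in>S. \<exists>N f'. open N \<and> x \<in> N \<and> (\<forall>n. times_diff_on n N f') \<and> (\<forall>y\<in>S \<inter> N. f y = f' y))"


section \<open>Smooth manifolds\<close>

text \<open>
  A chart \<open>(U, \<phi>)\<close> takes values in an open subset of a linear subspace of a Euclidean space;
  that subspace is recovered as \<open>span (\<phi> ` U)\<close>, since a nonempty open subset of a vector space
  spans it. In this way manifolds of every dimension, including 0, are covered (a
  \<open>euclidean_space\<close> type has dimension at least 1), and different components may have different
  dimensions. The point set and the topology are those induced by the atlas. The field
  \<open>chart_at\<close> selects a preferred chart around each point; it is only used to represent tangent
  vectors by their coordinates.
\<close>

type_synonym ('a, 'e) chart = "'a set \<times> ('a \<Rightarrow> 'e)"

record ('a, 'e) manifold =
  atlas :: "('a, 'e) chart set"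
  chart_at :: "'a \<Rightarrow> ('a, 'e) chart"

definition points :: "('a, 'e) manifold \<Rightarrow> 'a set" where
  "points M = (\<Union>c\<in>atlas M. fst c)"

definition manifold_topology :: "('a, 'e::euclidean_space) manifold \<Rightarrow> 'a topology" where
  "manifold_topology M =
     topology_generated_by {fst c \<inter> snd c -` W | c W. c \<in> atlas M \<and> open W}"

definition chart_inv :: "('a, 'e) chart \<Rightarrow> 'e \<Rightarrow> 'a" where
  "chart_inv c = inv_into (fst c) (snd c)"

definition chart_space :: "('a, 'e::euclidean_space) chart \<Rightarrow> 'e set" where
  "chart_space c = span (snd c ` fst c)"

definition compatible :: "('a, 'e::euclidean_space) chart \<Rightarrow> ('a, 'e) chart \<Rightarrow> bool" where
  "compatible c d \<longleftrightarrow>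
     openin (top_of_set (chart_space c)) (snd c ` (fst c \<inter> fst d)) \<and>
     openin (top_of_set (chart_space d)) (snd d ` (fst c \<inter> fst d)) \<and>
     smooth_on (snd c ` (fst c \<inter> fst d)) (snd d \<circ> chart_inv c) \<and>
     smooth_on (snd d ` (fst c \<inter> fst d)) (snd c \<circ> chart_inv d)"

text \<open>Compatibility of a chart with itself says that its image is open in its \<open>chart_space\<close>.\<close>

definition smooth_manifold :: "('a, 'e::euclidean_space) manifold \<Rightarrow> bool" where
  "smooth_manifold M \<longleftrightarrow>
     (\<forall>c\<in>atlas M. inj_on (snd c) (fst c)) \<and>
     (\<forall>c\<in>atlas M. \<forall>d\<in>atlas M. compatible c d) \<and>
     (\<forall>p\<in>points M. chart_at M p \<in> atlas M \<and> p \<in> fst (chart_at M p)) \<and>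
     Hausdorff_space (manifold_topology M) \<and>
     second_countable (manifold_topology M)"

definition maximal_atlas :: "('a, 'e::euclidean_space) manifold \<Rightarrow> ('a, 'e) chart set" where
  "maximal_atlas M =
     {c. fst c \<subseteq> points M \<and> inj_on (snd c) (fst c) \<and> compatible c c \<and>
         (\<forall>d\<in>atlas M. compatible c d)}"

definition prod_chart ::
  "('a, 'e) chart \<Rightarrow> ('b, 'f) chart \<Rightarrow> ('a \<times> 'b, 'e \<times> 'f) chart" where
  "prod_chart c d = (fst c \<times> fst d, map_prod (snd c) (snd d))"

definition prod_manifold ::
  "('a, 'e) manifold \<Rightarrow> ('b, 'f) manifold \<Rightarrow> ('a \<times> 'b, 'e \<times> 'f) manifold" where
  "prod_manifold M N =
     \<lparr>atlas = {prod_chart c d | c d. c \<in> atlas M \<and> d \<in> atlas N},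
      chart_at = (\<lambda>(p, q). prod_chart (chart_at M p) (chart_at N q))\<rparr>"

subsection \<open>Embedded submanifolds\<close>

definition slice_charts ::
  "('a, 'e::euclidean_space) manifold \<Rightarrow> 'a set \<Rightarrow> ('a, 'e) chart set" where
  "slice_charts M S =
     {c \<in> maximal_atlas M. \<exists>L. subspace L \<and> snd c ` (S \<inter> fst c) = snd c ` fst c \<inter> L}"

definition embedded_submanifold :: "('a, 'e::euclidean_space) manifold \<Rightarrow> 'a set \<Rightarrow> bool" where
  "embedded_submanifold M S \<longleftrightarrow>
     S \<subseteq> points M \<and> (\<forall>p\<in>S. \<exists>c\<in>slice_charts M S. p \<in> fst c)"

definition submanifold ::
  "('a, 'e::euclidean_space) manifold \<Rightarrow> 'a set \<Rightarrow> ('a, 'e) manifold" where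
  "submanifold M S =
     \<lparr>atlas = {(S \<inter> fst c, snd c) | c. c \<in> slice_charts M S},
      chart_at = (\<lambda>p. SOME c. c \<in> {(S \<inter> fst c, snd c) | c. c \<in> slice_charts M S} \<and> p \<in> fst c)\<rparr>"

subsection \<open>Smooth maps\<close>

text \<open>
  \<open>F\<close> is smooth on the subset \<open>S\<close> of \<open>M\<close> (used for \<open>S\<close> open or embedded); the value of \<open>F\<close>
  outside \<open>S\<close> is irrelevant.
\<close>

definition smooth_map_on ::
  "('a, 'e::euclidean_space) manifold \<Rightarrow> 'a set \<Rightarrow> ('b, 'f::euclidean_space) manifold \<Rightarrow>
   ('a \<Rightarrow> 'b) \<Rightarrow> bool" where
  "smooth_map_on M S N F \<longleftrightarrow>
     S \<subseteq> points M \<and> F ` S \<subseteq> points N \<and>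
     continuous_map (subtopology (manifold_topology M) S) (manifold_topology N) F \<and>
     (\<forall>c\<in>atlas M. \<forall>d\<in>atlas N.
        smooth_on (snd c ` (S \<inter> fst c \<inter> F -` fst d)) (snd d \<circ> F \<circ> chart_inv c))"

abbreviation smooth_map ::
  "('a, 'e::euclidean_space) manifold \<Rightarrow> ('b, 'f::euclidean_space) manifold \<Rightarrow>
   ('a \<Rightarrow> 'b) \<Rightarrow> bool" where
  "smooth_map M N F \<equiv> smooth_map_on M (points M) N F"


section \<open>Tangent and cotangent vectors\<close>

text \<open>
  A tangent vector at \<open>p\<close> is represented by its coordinate vector in the preferred chart at \<open>p\<close>,
  and a covector by its component vector: the covector \<open>\<alpha>\<close> takes the value \<open>\<alpha> \<bullet> v\<close> on \<open>v\<close>.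
\<close>

definition tangent_space :: "('a, 'e::euclidean_space) manifold \<Rightarrow> 'a \<Rightarrow> 'e set" where
  "tangent_space M p = chart_space (chart_at M p)"

abbreviation cotangent_space :: "('a, 'e::euclidean_space) manifold \<Rightarrow> 'a \<Rightarrow> 'e set" where
  "cotangent_space M p \<equiv> tangent_space M p"

text \<open>
  The tangent map at \<open>p\<close> of a map that is smooth on \<open>S\<close>. The derivative within the coordinate
  image of \<open>S\<close> is a linear map which is uniquely determined on the vectors tangent to \<open>S\<close>, and
  it is only applied to such vectors.
\<close>

definition tangent_map_on ::
  "('a, 'e::euclidean_space) manifold \<Rightarrow> 'a set \<Rightarrow> ('b, 'f::euclidean_space) manifold \<Rightarrow>
   ('a \<Rightarrow> 'b) \<Rightarrow> 'a \<Rightarrow> 'e \<Rightarrow> 'f" where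
  "tangent_map_on M S N F p =
     (let c = chart_at M p; d = chart_at N (F p)
      in frechet_derivative (snd d \<circ> F \<circ> chart_inv c) (at (snd c p) within snd c ` (S \<inter> fst c)))"

abbreviation tangent_map ::
  "('a, 'e::euclidean_space) manifold \<Rightarrow> ('b, 'f::euclidean_space) manifold \<Rightarrow>
   ('a \<Rightarrow> 'b) \<Rightarrow> 'a \<Rightarrow> 'e \<Rightarrow> 'f" where
  "tangent_map M N F p \<equiv> tangent_map_on M (points M) N F p"

text \<open>The pullback \<open>A\<^sup>* \<beta>\<close>, as a covector on \<open>V\<close>, for a map \<open>A\<close> that is linear on the subspace \<open>V\<close>.\<close>

definition pullback_covector ::
  "'e::euclidean_space set \<Rightarrow> ('e \<Rightarrow> 'f::euclidean_space) \<Rightarrow> 'f \<Rightarrow> 'e" where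
  "pullback_covector V A \<beta> = (THE \<alpha>. \<alpha> \<in> V \<and> (\<forall>v\<in>V. \<alpha> \<bullet> v = \<beta> \<bullet> A v))"

definition cotangent_map ::
  "('a, 'e::euclidean_space) manifold \<Rightarrow> ('b, 'f::euclidean_space) manifold \<Rightarrow>
   ('a \<Rightarrow> 'b) \<Rightarrow> 'a \<Rightarrow> 'f \<Rightarrow> 'e" where
  "cotangent_map M N F p \<beta> = pullback_covector (tangent_space M p) (tangent_map M N F p) \<beta>"

definition submersion ::
  "('a, 'e::euclidean_space) manifold \<Rightarrow> ('b, 'f::euclidean_space) manifold \<Rightarrow>
   ('a \<Rightarrow> 'b) \<Rightarrow> bool" where
  "submersion M N F \<longleftrightarrow> smooth_map M N F \<and>
     (\<forall>p\<in>points M. tangent_map M N F p ` tangent_space M p = tangent_space N (F p))"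

subsection \<open>The bundles \<open>TM\<close> and \<open>TM \<oplus> T\<^sup>*M\<close>\<close>

text \<open>The derivative at \<open>p\<close> of the change of coordinates from \<open>c\<close> to \<open>d\<close>.\<close>

definition coord_change ::
  "('a, 'e::euclidean_space) chart \<Rightarrow> ('a, 'e) chart \<Rightarrow> 'a \<Rightarrow> 'e \<Rightarrow> 'e" where
  "coord_change c d p =
     frechet_derivative (snd d \<circ> chart_inv c) (at (snd c p) within snd c ` (fst c \<inter> fst d))"

definition tangent_chart ::
  "('a, 'e::euclidean_space) manifold \<Rightarrow> ('a, 'e) chart \<Rightarrow> ('a \<times> 'e, 'e \<times> 'e) chart" where
  "tangent_chart M c =
     ({(p, v). p \<in> fst c \<and> v \<in> tangent_space M p},
      \<lambda>(p, v). (snd c p, coord_change (chart_at M p) c p v))"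

definition tangent_bundle ::
  "('a, 'e::euclidean_space) manifold \<Rightarrow> ('a \<times> 'e, 'e \<times> 'e) manifold" where
  "tangent_bundle M =
     \<lparr>atlas = tangent_chart M ` atlas M,
      chart_at = (\<lambda>(p, v). tangent_chart M (chart_at M p))\<rparr>"

definition pontryagin_chart ::
  "('a, 'e::euclidean_space) manifold \<Rightarrow> ('a, 'e) chart \<Rightarrow>
   ('a \<times> 'e \<times> 'e, 'e \<times> 'e \<times> 'e) chart" where
  "pontryagin_chart M c =
     ({(p, v, \<alpha>). p \<in> fst c \<and> v \<in> tangent_space M p \<and> \<alpha> \<in> cotangent_space M p},
      \<lambda>(p, v, \<alpha>). (snd c p, coord_change (chart_at M p) c p v,
        pullback_covector (chart_space c) (coord_change c (chart_at M p) p) \<alpha>))"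

definition pontryagin_bundle ::
  "('a, 'e::euclidean_space) manifold \<Rightarrow> ('a \<times> 'e \<times> 'e, 'e \<times> 'e \<times> 'e) manifold" where
  "pontryagin_bundle M =
     \<lparr>atlas = pontryagin_chart M ` atlas M,
      chart_at = (\<lambda>(p, v, \<alpha>). pontryagin_chart M (chart_at M p))\<rparr>"


section \<open>Dirac structures\<close>

text \<open>A subset of \<open>TM \<oplus> T\<^sup>*M\<close> over \<open>M\<close> is given by its fibres \<open>D p\<close>.\<close>

definition pontryagin_fibre ::
  "('a, 'e::euclidean_space) manifold \<Rightarrow> 'a \<Rightarrow> ('e \<times> 'e) set" where
  "pontryagin_fibre M p = tangent_space M p \<times> cotangent_space M p"

definition pairing :: "'e::euclidean_space \<times> 'e \<Rightarrow> 'e \<times> 'e \<Rightarrow> real" where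
  "pairing = (\<lambda>(v, \<alpha>) (w, \<beta>). \<alpha> \<bullet> w + \<beta> \<bullet> v)"

definition pairing_orth ::
  "('a, 'e::euclidean_space) manifold \<Rightarrow> ('a \<Rightarrow> ('e \<times> 'e) set) \<Rightarrow> 'a \<Rightarrow> ('e \<times> 'e) set" where
  "pairing_orth M D p = {x \<in> pontryagin_fibre M p. \<forall>y\<in>D p. pairing x y = 0}"

text \<open>Smooth subbundles are given by smooth local frames \<open>\<sigma> 0, \<dots>, \<sigma> (r - 1)\<close>.\<close>

definition smooth_subbundle ::
  "('a, 'e::euclidean_space) manifold \<Rightarrow> ('a \<Rightarrow> ('e \<times> 'e) set) \<Rightarrow> bool" where
  "smooth_subbundle M D \<longleftrightarrow>
     (\<forall>p\<in>points M. subspace (D p) \<and> D p \<subseteq> pontryagin_fibre M p) \<and>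
     (\<forall>p\<in>points M. \<exists>U r (\<sigma> :: nat \<Rightarrow> 'a \<Rightarrow> 'e \<times> 'e).
        openin (manifold_topology M) U \<and> p \<in> U \<and>
        (\<forall>i<r. smooth_map_on M U (pontryagin_bundle M) (\<lambda>q. (q, \<sigma> i q))) \<and>
        (\<forall>q\<in>U. inj_on (\<lambda>i. \<sigma> i q) {..<r} \<and> independent ((\<lambda>i. \<sigma> i q) ` {..<r}) \<and>
               D q = span ((\<lambda>i. \<sigma> i q) ` {..<r})))"

definition dirac_structure ::
  "('a, 'e::euclidean_space) manifold \<Rightarrow> ('a \<Rightarrow> ('e \<times> 'e) set) \<Rightarrow> bool" where
  "dirac_structure M D \<longleftrightarrow>
     smooth_subbundle M D \<and> (\<forall>p\<in>points M. D p = pairing_orth M D p)"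

definition opposite_dirac ::
  "('a \<Rightarrow> ('e::euclidean_space \<times> 'e) set) \<Rightarrow> 'a \<Rightarrow> ('e \<times> 'e) set" where
  "opposite_dirac D p = {(- v, \<alpha>) | v \<alpha>. (v, \<alpha>) \<in> D p}"

definition forward_dirac_map ::
  "('a, 'e::euclidean_space) manifold \<Rightarrow> ('a \<Rightarrow> ('e \<times> 'e) set) \<Rightarrow>
   ('b, 'f::euclidean_space) manifold \<Rightarrow> ('b \<Rightarrow> ('f \<times> 'f) set) \<Rightarrow> ('a \<Rightarrow> 'b) \<Rightarrow> bool" where
  "forward_dirac_map M D\<^sub>M N D\<^sub>N F \<longleftrightarrow>
     dirac_structure M D\<^sub>M \<and> dirac_structure N D\<^sub>N \<and> smooth_map M N F \<and>
     (\<forall>n\<in>points N. \<forall>m\<in>points M. F m = n \<longrightarrow>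
        (\<forall>(v\<^sub>n, \<alpha>\<^sub>n)\<in>D\<^sub>N n. \<exists>(v\<^sub>m, \<alpha>\<^sub>m)\<in>D\<^sub>M m.
           tangent_map M N F m v\<^sub>m = v\<^sub>n \<and> \<alpha>\<^sub>m = cotangent_map M N F m \<alpha>\<^sub>n))"


section \<open>Lie groupoids\<close>

text \<open>The product \<open>mult \<Gamma> g h\<close> is meaningful when \<open>src \<Gamma> g = tgt \<Gamma> h\<close>.\<close>

record ('g, 'e, 'p, 'f) groupoid =
  arrows :: "('g, 'e) manifold"
  objects :: "('p, 'f) manifold"
  src :: "'g \<Rightarrow> 'p"
  tgt :: "'g \<Rightarrow> 'p"
  unit_at :: "'p \<Rightarrow> 'g"
  mult :: "'g \<Rightarrow> 'g \<Rightarrow> 'g"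

definition composable :: "('g, 'e, 'p, 'f) groupoid \<Rightarrow> ('g \<times> 'g) set" where
  "composable \<Gamma> =
     {(g, h). g \<in> points (arrows \<Gamma>) \<and> h \<in> points (arrows \<Gamma>) \<and> src \<Gamma> g = tgt \<Gamma> h}"

definition inverses :: "('g, 'e, 'p, 'f) groupoid \<Rightarrow> 'g \<Rightarrow> 'g \<Rightarrow> bool" where
  "inverses \<Gamma> g h \<longleftrightarrow>
     h \<in> points (arrows \<Gamma>) \<and> src \<Gamma> h = tgt \<Gamma> g \<and> tgt \<Gamma> h = src \<Gamma> g \<and>
     mult \<Gamma> g h = unit_at \<Gamma> (tgt \<Gamma> g) \<and> mult \<Gamma> h g = unit_at \<Gamma> (src \<Gamma> g)"

definition inverse_of :: "('g, 'e, 'p, 'f) groupoid \<Rightarrow> 'g \<Rightarrow> 'g" where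
  "inverse_of \<Gamma> g = (THE h. inverses \<Gamma> g h)"

definition algebraic_groupoid :: "('g, 'e, 'p, 'f) groupoid \<Rightarrow> bool" where
  "algebraic_groupoid \<Gamma> \<longleftrightarrow>
     (\<forall>g\<in>points (arrows \<Gamma>). src \<Gamma> g \<in> points (objects \<Gamma>) \<and> tgt \<Gamma> g \<in> points (objects \<Gamma>)) \<and>
     (\<forall>p\<in>points (objects \<Gamma>). unit_at \<Gamma> p \<in> points (arrows \<Gamma>) \<and>
        src \<Gamma> (unit_at \<Gamma> p) = p \<and> tgt \<Gamma> (unit_at \<Gamma> p) = p) \<and>
     (\<forall>(g, h)\<in>composable \<Gamma>. mult \<Gamma> g h \<in> points (arrows \<Gamma>) \<and>
        src \<Gamma> (mult \<Gamma> g h) = src \<Gamma> h \<and> tgt \<Gamma> (mult \<Gamma> g h) = tgt \<Gamma> g) \<and>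
     (\<forall>g h k. (g, h) \<in> composable \<Gamma> \<longrightarrow> (h, k) \<in> composable \<Gamma> \<longrightarrow>
        mult \<Gamma> (mult \<Gamma> g h) k = mult \<Gamma> g (mult \<Gamma> h k)) \<and>
     (\<forall>g\<in>points (arrows \<Gamma>).
        mult \<Gamma> g (unit_at \<Gamma> (src \<Gamma> g)) = g \<and> mult \<Gamma> (unit_at \<Gamma> (tgt \<Gamma> g)) g = g \<and>
        (\<exists>h. inverses \<Gamma> g h))"

definition lie_groupoid ::
  "('g, 'e::euclidean_space, 'p, 'f::euclidean_space) groupoid \<Rightarrow> bool" where
  "lie_groupoid \<Gamma> \<longleftrightarrow>
     algebraic_groupoid \<Gamma> \<and>
     smooth_manifold (arrows \<Gamma>) \<and> smooth_manifold (objects \<Gamma>) \<and>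
     submersion (arrows \<Gamma>) (objects \<Gamma>) (src \<Gamma>) \<and>
     submersion (arrows \<Gamma>) (objects \<Gamma>) (tgt \<Gamma>) \<and>
     smooth_map (objects \<Gamma>) (arrows \<Gamma>) (unit_at \<Gamma>) \<and>
     smooth_map (arrows \<Gamma>) (arrows \<Gamma>) (inverse_of \<Gamma>) \<and>
     smooth_map_on (prod_manifold (arrows \<Gamma>) (arrows \<Gamma>)) (composable \<Gamma>) (arrows \<Gamma>)
       (\<lambda>(g, h). mult \<Gamma> g h)"

text \<open>The Lie subgroupoid of \<open>\<Gamma>\<close> with arrows \<open>H\<close> and objects \<open>Q\<close>.\<close>

definition lie_subgroupoid ::
  "('g, 'e::euclidean_space, 'p, 'f::euclidean_space) groupoid \<Rightarrow> 'g set \<Rightarrow> 'p set \<Rightarrow> bool" where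
  "lie_subgroupoid \<Gamma> H Q \<longleftrightarrow>
     embedded_submanifold (arrows \<Gamma>) H \<and> embedded_submanifold (objects \<Gamma>) Q \<and>
     lie_groupoid (\<Gamma>\<lparr>arrows := submanifold (arrows \<Gamma>) H, objects := submanifold (objects \<Gamma>) Q\<rparr>)"

subsection \<open>Tangent and cotangent groupoids\<close>

text \<open>The tangent maps of \<open>src\<close>, \<open>tgt\<close>, of the unit embedding and of the product.\<close>

definition tsrc ::
  "('g, 'e::euclidean_space, 'p, 'f::euclidean_space) groupoid \<Rightarrow> 'g \<Rightarrow> 'e \<Rightarrow> 'f" where
  "tsrc \<Gamma> = tangent_map (arrows \<Gamma>) (objects \<Gamma>) (src \<Gamma>)"

definition ttgt ::
  "('g, 'e::euclidean_space, 'p, 'f::euclidean_space) groupoid \<Rightarrow> 'g \<Rightarrow> 'e \<Rightarrow> 'f" where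
  "ttgt \<Gamma> = tangent_map (arrows \<Gamma>) (objects \<Gamma>) (tgt \<Gamma>)"

definition tunit ::
  "('g, 'e::euclidean_space, 'p, 'f::euclidean_space) groupoid \<Rightarrow> 'p \<Rightarrow> 'f \<Rightarrow> 'e" where
  "tunit \<Gamma> = tangent_map (objects \<Gamma>) (arrows \<Gamma>) (unit_at \<Gamma>)"

definition tmult ::
  "('g, 'e::euclidean_space, 'p, 'f::euclidean_space) groupoid \<Rightarrow>
   'g \<Rightarrow> 'g \<Rightarrow> 'e \<Rightarrow> 'e \<Rightarrow> 'e" where
  "tmult \<Gamma> g h v w =
     tangent_map_on (prod_manifold (arrows \<Gamma>) (arrows \<Gamma>)) (composable \<Gamma>) (arrows \<Gamma>)
       (\<lambda>(g, h). mult \<Gamma> g h) (g, h) (v, w)"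

text \<open>
  \<open>tleft \<Gamma> g\<close> and \<open>tright \<Gamma> g\<close> are the tangent maps of the translations \<open>L\<^sub>g\<close> and \<open>R\<^sub>g\<close>, defined on a
  target and on a source fibre, at the units \<open>src \<Gamma> g\<close> and \<open>tgt \<Gamma> g\<close>.
\<close>

definition tleft ::
  "('g, 'e::euclidean_space, 'p, 'f::euclidean_space) groupoid \<Rightarrow> 'g \<Rightarrow> 'e \<Rightarrow> 'e" where
  "tleft \<Gamma> g =
     tangent_map_on (arrows \<Gamma>) {h \<in> points (arrows \<Gamma>). tgt \<Gamma> h = src \<Gamma> g} (arrows \<Gamma>)
       (\<lambda>h. mult \<Gamma> g h) (unit_at \<Gamma> (src \<Gamma> g))"

definition tright ::
  "('g, 'e::euclidean_space, 'p, 'f::euclidean_space) groupoid \<Rightarrow> 'g \<Rightarrow> 'e \<Rightarrow> 'e" where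
  "tright \<Gamma> g =
     tangent_map_on (arrows \<Gamma>) {h \<in> points (arrows \<Gamma>). src \<Gamma> h = tgt \<Gamma> g} (arrows \<Gamma>)
       (\<lambda>h. mult \<Gamma> h g) (unit_at \<Gamma> (tgt \<Gamma> g))"

definition algebroid_fibre ::
  "('g, 'e::euclidean_space, 'p, 'f::euclidean_space) groupoid \<Rightarrow> 'p \<Rightarrow> 'e set" where
  "algebroid_fibre \<Gamma> p =
     {u \<in> tangent_space (arrows \<Gamma>) (unit_at \<Gamma> p). ttgt \<Gamma> (unit_at \<Gamma> p) u = 0}"

definition algebroid_annihilator ::
  "('g, 'e::euclidean_space, 'p, 'f::euclidean_space) groupoid \<Rightarrow> 'p \<Rightarrow> 'e set" where
  "algebroid_annihilator \<Gamma> p =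
     {\<alpha> \<in> cotangent_space (arrows \<Gamma>) (unit_at \<Gamma> p). \<forall>u\<in>algebroid_fibre \<Gamma> p. \<alpha> \<bullet> u = 0}"

text \<open>The fibre of \<open>A\<^sup>*G\<close>, identified with the annihilator of \<open>TP\<close> in \<open>T\<^sup>*G\<close> along the units.\<close>

definition dual_algebroid_fibre ::
  "('g, 'e::euclidean_space, 'p, 'f::euclidean_space) groupoid \<Rightarrow> 'p \<Rightarrow> 'e set" where
  "dual_algebroid_fibre \<Gamma> p =
     {\<alpha> \<in> cotangent_space (arrows \<Gamma>) (unit_at \<Gamma> p).
        \<forall>w\<in>tangent_space (objects \<Gamma>) p. \<alpha> \<bullet> tunit \<Gamma> p w = 0}"

definition cosrc ::
  "('g, 'e::euclidean_space, 'p, 'f::euclidean_space) groupoid \<Rightarrow> 'g \<Rightarrow> 'e \<Rightarrow> 'e" where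
  "cosrc \<Gamma> g \<alpha> =
     (THE \<xi>. \<xi> \<in> dual_algebroid_fibre \<Gamma> (src \<Gamma> g) \<and>
        (\<forall>u\<in>algebroid_fibre \<Gamma> (src \<Gamma> g). \<xi> \<bullet> u = \<alpha> \<bullet> tleft \<Gamma> g u))"

definition cotgt ::
  "('g, 'e::euclidean_space, 'p, 'f::euclidean_space) groupoid \<Rightarrow> 'g \<Rightarrow> 'e \<Rightarrow> 'e" where
  "cotgt \<Gamma> g \<alpha> =
     (THE \<xi>. \<xi> \<in> dual_algebroid_fibre \<Gamma> (tgt \<Gamma> g) \<and>
        (\<forall>u\<in>algebroid_fibre \<Gamma> (tgt \<Gamma> g).
           \<xi> \<bullet> u = \<alpha> \<bullet> tright \<Gamma> g (u - tunit \<Gamma> (tgt \<Gamma> g) (tsrc \<Gamma> (unit_at \<Gamma> (tgt \<Gamma> g)) u))))"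

definition comult ::
  "('g, 'e::euclidean_space, 'p, 'f::euclidean_space) groupoid \<Rightarrow>
   'g \<Rightarrow> 'g \<Rightarrow> 'e \<Rightarrow> 'e \<Rightarrow> 'e" where
  "comult \<Gamma> g h \<alpha> \<beta> =
     (THE \<gamma>. \<gamma> \<in> cotangent_space (arrows \<Gamma>) (mult \<Gamma> g h) \<and>
        (\<forall>v\<in>tangent_space (arrows \<Gamma>) g. \<forall>w\<in>tangent_space (arrows \<Gamma>) h.
           tsrc \<Gamma> g v = ttgt \<Gamma> h w \<longrightarrow> \<gamma> \<bullet> tmult \<Gamma> g h v w = \<alpha> \<bullet> v + \<beta> \<bullet> w))"

text \<open>
  The groupoid \<open>TG \<oplus> T\<^sup>*G\<close> over \<open>TP \<oplus> A\<^sup>*G\<close>. Its object manifold is realised as the submanifold of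
  units of \<open>TG \<oplus> T\<^sup>*G\<close>, so that its unit map is the inclusion.
\<close>

definition pontryagin_units ::
  "('g, 'e::euclidean_space, 'p, 'f::euclidean_space) groupoid \<Rightarrow> ('g \<times> 'e \<times> 'e) set" where
  "pontryagin_units \<Gamma> =
     {(unit_at \<Gamma> p, tunit \<Gamma> p w, \<xi>) | p w \<xi>.
        p \<in> points (objects \<Gamma>) \<and> w \<in> tangent_space (objects \<Gamma>) p \<and>
        \<xi> \<in> dual_algebroid_fibre \<Gamma> p}"

definition pontryagin_groupoid ::
  "('g, 'e::euclidean_space, 'p, 'f::euclidean_space) groupoid \<Rightarrow>
   ('g \<times> 'e \<times> 'e, 'e \<times> 'e \<times> 'e, 'g \<times> 'e \<times> 'e, 'e \<times> 'e \<times> 'e) groupoid" where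
  "pontryagin_groupoid \<Gamma> =
     \<lparr>arrows = pontryagin_bundle (arrows \<Gamma>),
      objects = submanifold (pontryagin_bundle (arrows \<Gamma>)) (pontryagin_units \<Gamma>),
      src = (\<lambda>(g, v, \<alpha>). (unit_at \<Gamma> (src \<Gamma> g), tunit \<Gamma> (src \<Gamma> g) (tsrc \<Gamma> g v), cosrc \<Gamma> g \<alpha>)),
      tgt = (\<lambda>(g, v, \<alpha>). (unit_at \<Gamma> (tgt \<Gamma> g), tunit \<Gamma> (tgt \<Gamma> g) (ttgt \<Gamma> g v), cotgt \<Gamma> g \<alpha>)),
      unit_at = (\<lambda>x. x),
      mult = (\<lambda>(g, v, \<alpha>) (h, w, \<beta>). (mult \<Gamma> g h, tmult \<Gamma> g h v w, comult \<Gamma> g h \<alpha> \<beta>))\<rparr>"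


section \<open>Dirac groupoids\<close>

definition dirac_groupoid ::
  "('g, 'e::euclidean_space, 'p, 'f::euclidean_space) groupoid \<Rightarrow>
   ('g \<Rightarrow> ('e \<times> 'e) set) \<Rightarrow> bool" where
  "dirac_groupoid \<Gamma> D \<longleftrightarrow>
     lie_groupoid \<Gamma> \<and> dirac_structure (arrows \<Gamma>) D \<and>
     (\<exists>Q. lie_subgroupoid (pontryagin_groupoid \<Gamma>)
        {(g, v, \<alpha>). g \<in> points (arrows \<Gamma>) \<and> (v, \<alpha>) \<in> D g} Q)"

text \<open>The distribution \<open>G\<^sub>0\<close>, and \<open>TP \<inter> G\<^sub>0\<close> as a family of subspaces of the tangent spaces of \<open>P\<close>.\<close>

definition G0 ::
  "('g, 'e::euclidean_space, 'p, 'f::euclidean_space) groupoid \<Rightarrow>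
   ('g \<Rightarrow> ('e \<times> 'e) set) \<Rightarrow> 'g \<Rightarrow> 'e set" where
  "G0 \<Gamma> D g = {v \<in> tangent_space (arrows \<Gamma>) g. (v, 0) \<in> D g}"

definition G0_units ::
  "('g, 'e::euclidean_space, 'p, 'f::euclidean_space) groupoid \<Rightarrow>
   ('g \<Rightarrow> ('e \<times> 'e) set) \<Rightarrow> 'p \<Rightarrow> 'f set" where
  "G0_units \<Gamma> D p =
     {w \<in> tangent_space (objects \<Gamma>) p. tunit \<Gamma> p w \<in> G0 \<Gamma> D (unit_at \<Gamma> p)}"

definition smooth_distribution ::
  "('a, 'e::euclidean_space) manifold \<Rightarrow> ('a \<Rightarrow> 'e set) \<Rightarrow> bool" where
  "smooth_distribution M E \<longleftrightarrow>
     (\<forall>p\<in>points M. \<forall>v\<in>E p. \<exists>U X.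
        openin (manifold_topology M) U \<and> p \<in> U \<and>
        smooth_map_on M U (tangent_bundle M) (\<lambda>q. (q, X q)) \<and> (\<forall>q\<in>U. X q \<in> E q) \<and> X p = v)"

definition induced_dirac ::
  "('g, 'e::euclidean_space, 'p, 'f::euclidean_space) groupoid \<Rightarrow>
   ('g \<Rightarrow> ('e \<times> 'e) set) \<Rightarrow> 'p \<Rightarrow> ('f \<times> 'f) set" where
  "induced_dirac \<Gamma> D p =
     {(v, \<alpha>) \<in> pontryagin_fibre (objects \<Gamma>) p.
        \<exists>w. (w, cotangent_map (arrows \<Gamma>) (objects \<Gamma>) (tgt \<Gamma>) (unit_at \<Gamma> p) \<alpha>)
              \<in> D (unit_at \<Gamma> p) \<inter>
                (tangent_space (arrows \<Gamma>) (unit_at \<Gamma> p) \<times> algebroid_annihilator \<Gamma> p) \<and>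
            v = ttgt \<Gamma> (unit_at \<Gamma> p) w}"

end

theory Submission
  imports Defs
begin

text \<open>
  Let \<open>\<epsilon> : P \<rightarrow> G\<close> be the unit map. At a unit \<open>p\<close> the Lagrangian subspace \<open>D(p)\<close> is stable under the source projection
  \<open>(w, \<beta>) \<mapsto> (Ts w, \<beta>|AG)\<close> of the groupoid \<open>TG \<oplus> T\<^sup>*G\<close>. The fibre \<open>D\<^sub>P(p)\<close> is the push-forward of
  \<open>D(p)\<close> along \<open>Tt\<close>, hence Lagrangian by linear algebra. Subtracting the source projection shows
  that it consists of the pairs \<open>(X + Tt w - Ts w, \<epsilon>\<^sup>*\<beta>)\<close> with \<open>(w, \<beta>) \<in> D(p)\<close> and \<open>X \<in> TP \<inter> G\<^sub>0\<close>,
  so smooth local sections of \<open>D\<close> and of \<open>TP \<inter> G\<^sub>0\<close> produce smooth local sections of \<open>D\<^sub>P\<close> through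
  every element; since the rank is constant they span it.

  If \<open>(w, t\<^sup>*\<alpha>) \<in> D(p)\<close> then \<open>Ts w \<in> TP \<inter> G\<^sub>0\<close>, so for \<open>t(g) = p\<close> there is \<open>(x, 0) \<in> D(g)\<close> with
  \<open>Tt x = Ts w\<close>. The product \<open>(w, t\<^sup>*\<alpha>) \<star> (x, 0)\<close> lies over \<open>g\<close> and has covector \<open>t\<^sup>*\<alpha>\<close>, because
  \<open>t\<^sup>*a \<star> s\<^sup>*b = t\<^sup>*a + s\<^sup>*b\<close>; this is the forward Dirac property of \<open>t\<close>. The one of \<open>s\<close> is its mirror
  image. Identities between tangent maps are obtained by differentiating curves, and curves are
  lifted through submersions by the inverse function theorem.
\<close>

section \<open>Smooth functions\<close>

text \<open>The elements of \<open>D(p)\<close> whose covector has the form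
  \<open>t^* \<alpha>\<close> form an intersection of subspaces whose rank may a priori vary with
  \<open>p\<close>, so a local section of \<open>D\<close> through such an element need not consist
  of such elements. Subtracting the source projection moves every \<open>(w, \<beta>)\<close> of
  \<open>D(p)\<close> into this intersection, but from an element already in it the subtraction
  removes \<open>Ts w\<close>, a vector of \<open>TP \<inter> G0\<close>; smoothness of that
  distribution is what allows it to be put back by the summand \<open>X\<close>. Curves are used
  because the preferred charts that encode tangent vectors vary without continuity, and because a
  derivative within a non-open set is a choice, determined only on velocities of curves in that set.
  Relations such as composability must hold along the curves and not only to first order, whence the
  lifting through submersions. The sign in \<open>-D_P\<close>: over a unit, inversion sends
  \<open>(w, t^* \<alpha>)\<close> to \<open>(w', - s^* \<alpha>)\<close> with
  \<open>Ts w' = Tt w\<close>; making the covector positive reverses the vector.\<close>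

lemma frechet_derivative_cong_open:
  assumes "open N" "x \<in> N" "\<And>y. y \<in> N \<Longrightarrow> f y = g y"
  shows "frechet_derivative f (at x) = frechet_derivative g (at x)"
    and "f differentiable (at x) \<longleftrightarrow> g differentiable (at x)"
proof -
  have *: "(f has_derivative D) (at x) \<longleftrightarrow> (g has_derivative D) (at x)" for D
    using assms has_derivative_transform_within_open[of f D x UNIV N g]
      has_derivative_transform_within_open[of g D x UNIV N f] by auto
  show "frechet_derivative f (at x) = frechet_derivative g (at x)"
    by (simp add: frechet_derivative_def *)
  show "f differentiable (at x) \<longleftrightarrow> g differentiable (at x)"
    by (simp add: differentiable_def *)
qed

lemma times_diff_on_cong:
  assumes "open N" "\<And>y. y \<in> N \<Longrightarrow> f y = g y" "times_diff_on n N f"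
  shows "times_diff_on n N g"
  using assms
proof (induction n arbitrary: f g)
  case 0
  then show ?case using continuous_on_cong by (metis times_diff_on.simps(1))
next
  case (Suc n)
  have "times_diff_on n N (\<lambda>x. frechet_derivative g (at x) v)" for v
    using Suc.IH[of "\<lambda>x. frechet_derivative f (at x) v" "\<lambda>x. frechet_derivative g (at x) v"]
      Suc.prems frechet_derivative_cong_open(1)[OF Suc.prems(1) _ Suc.prems(2)] by simp
  moreover have "g differentiable (at x)" if "x \<in> N" for x
    using Suc.prems(3) frechet_derivative_cong_open(2)[of N x f g] Suc.prems(1,2) that by auto
  ultimately show ?case by simp
qed

lemma times_diff_on_subset:
  "times_diff_on n N f \<Longrightarrow> M \<subseteq> N \<Longrightarrow> times_diff_on n M f"
  by (induction n arbitrary: f) (auto intro: continuous_on_subset)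

text \<open>The recursion does not list the lower orders, so passing from \<open>Suc n\<close> to
  \<open>n\<close> is an induction whose base case is that differentiable maps are
  continuous.\<close>

lemma times_diff_on_Suc: "times_diff_on (Suc n) N f \<Longrightarrow> times_diff_on n N f"
proof (induction n arbitrary: f)
  case 0
  then show ?case
    by (simp add: continuous_at_imp_continuous_on differentiable_imp_continuous_within)
next
  case (Suc n)
  have "times_diff_on n N (\<lambda>x. frechet_derivative f (at x) v)" for v
    using Suc.IH[of "\<lambda>x. frechet_derivative f (at x) v"] Suc.prems by (simp only: times_diff_on.simps) auto
  then show ?case using Suc.prems by simp
qed

lemma times_diff_on_const: "times_diff_on n N (\<lambda>x. c)"
  by (induction n arbitrary: c) (auto simp: frechet_derivative_const)

lemma times_diff_on_linear:
  assumes "bounded_linear f"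
  shows "times_diff_on n N f"
proof (cases n)
  case 0
  then show ?thesis using assms linear_continuous_on by auto
next
  case (Suc m)
  have "(f has_derivative f) (at x)" for x
    using assms bounded_linear_imp_has_derivative by blast
  then have "f differentiable (at x)" "frechet_derivative f (at x) = f" for x
    using differentiable_def frechet_derivative_at by (blast, metis)
  then show ?thesis using Suc by (simp add: times_diff_on_const)
qed

lemma times_diff_on_add:
  assumes "open N" "times_diff_on n N f" "times_diff_on n N g"
  shows "times_diff_on n N (\<lambda>x. f x + g x)"
  using assms(2,3)
proof (induction n arbitrary: f g)
  case 0
  then show ?case by (simp add: continuous_on_add)
next
  case (Suc n)
  have hd: "((\<lambda>x. f x + g x) has_derivative
      (\<lambda>v. frechet_derivative f (at x) v + frechet_derivative g (at x) v)) (at x)" if "x \<in> N" for x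
    using Suc.prems that by (intro has_derivative_add) (simp_all add: frechet_derivative_works[symmetric])
  have d: "frechet_derivative (\<lambda>x. f x + g x) (at x) =
      (\<lambda>v. frechet_derivative f (at x) v + frechet_derivative g (at x) v)" if "x \<in> N" for x
    using frechet_derivative_at[OF hd[OF that]] by simp
  have "times_diff_on n N (\<lambda>x. frechet_derivative (\<lambda>x. f x + g x) (at x) v)" for v
  proof (rule times_diff_on_cong[OF assms(1)])
    show "times_diff_on n N (\<lambda>x. frechet_derivative f (at x) v + frechet_derivative g (at x) v)"
      using Suc.IH Suc.prems by simp
  qed (simp add: d)
  then show ?case using hd by (auto simp: differentiable_def)
qed

lemma times_diff_on_sum:
  assumes "open N" "finite I" "\<And>i. i \<in> I \<Longrightarrow> times_diff_on n N (f i)"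
  shows "times_diff_on n N (\<lambda>x. \<Sum>i\<in>I. f i x)"
  using assms(2,3) by (induction I rule: finite_induct) (auto intro: times_diff_on_const times_diff_on_add[OF assms(1)])

lemma times_diff_on_bilinear:
  assumes "bounded_bilinear B" "open N" "times_diff_on n N f" "times_diff_on n N g"
  shows "times_diff_on n N (\<lambda>x. B (f x) (g x))"
  using assms(3,4)
proof (induction n arbitrary: f g)
  case 0
  then show ?case by (simp add: bounded_bilinear.continuous_on[OF assms(1)])
next
  case (Suc n)
  have hd: "((\<lambda>x. B (f x) (g x)) has_derivative
      (\<lambda>v. B (f x) (frechet_derivative g (at x) v) + B (frechet_derivative f (at x) v) (g x))) (at x)" if "x \<in> N" for x
    using Suc.prems that by (intro bounded_bilinear.FDERIV[OF assms(1)])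
      (auto simp: frechet_derivative_works[symmetric])
  have d: "frechet_derivative (\<lambda>x. B (f x) (g x)) (at x) =
      (\<lambda>v. B (f x) (frechet_derivative g (at x) v) + B (frechet_derivative f (at x) v) (g x))" if "x \<in> N" for x
    using frechet_derivative_at[OF hd[OF that]] by simp
  have "times_diff_on n N f" "times_diff_on n N g"
    using times_diff_on_Suc Suc.prems by blast+
  then have n: "times_diff_on n N (\<lambda>x. B (f x) (frechet_derivative g (at x) v))"
      "times_diff_on n N (\<lambda>x. B (frechet_derivative f (at x) v) (g x))" for v
    using Suc.IH Suc.prems by simp_all
  have "times_diff_on n N (\<lambda>x. frechet_derivative (\<lambda>x. B (f x) (g x)) (at x) v)" for v
    by (rule times_diff_on_cong[OF assms(2) _ times_diff_on_add[OF assms(2) n]]) (simp add: d)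
  then show ?case using hd by (auto simp: differentiable_def)
qed

text \<open>\<open>times_diff_on\<close> controls derivatives only in fixed directions. Expanding in
  \<open>Basis\<close> reduces a direction that moves with the point to finitely many fixed ones
  with scalar coefficients.\<close>

lemma frechet_derivative_basis_sum:
  fixes f :: "'a::euclidean_space \<Rightarrow> 'b::real_normed_vector"
  assumes "f differentiable (at x)"
  shows "frechet_derivative f (at x) v = (\<Sum>b\<in>Basis. (v \<bullet> b) *\<^sub>R frechet_derivative f (at x) b)"
proof -
  have "linear (frechet_derivative f (at x))"
    using assms frechet_derivative_works has_derivative_linear by blast
  then have "frechet_derivative f (at x) (\<Sum>b\<in>Basis. (v \<bullet> b) *\<^sub>R b) = (\<Sum>b\<in>Basis. (v \<bullet> b) *\<^sub>R frechet_derivative f (at x) b)"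
    by (simp add: linear_sum linear_scale)
  then show ?thesis by (simp add: euclidean_representation)
qed

text \<open>Chain rule and induction on the order. The inner derivative is a moving direction for
  \<open>f\<close>, hence the expansion over \<open>Basis\<close>; the induction generalises only
  \<open>f\<close>, because the same \<open>g\<close> occurs in every term.\<close>

lemma times_diff_on_compose:
  fixes f :: "'b::euclidean_space \<Rightarrow> 'c::real_normed_vector"
    and g :: "'a::euclidean_space \<Rightarrow> 'b"
  assumes "open N" "open N'" "g ` N \<subseteq> N'" "times_diff_on n N' f" "times_diff_on n N g"
  shows "times_diff_on n N (\<lambda>x. f (g x))"
  using assms(4,5)
proof (induction n arbitrary: f)
  case 0
  then show ?case using assms by (auto intro!: continuous_on_compose2[of N' f])
next
  case (Suc n)
  have hd: "((\<lambda>x. f (g x)) has_derivative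
      (\<lambda>v. frechet_derivative f (at (g x)) (frechet_derivative g (at x) v))) (at x)" if "x \<in> N" for x
    using Suc.prems that assms(3)
    by (intro has_derivative_compose[of g _ x UNIV f]) (auto simp: frechet_derivative_works[symmetric])
  have d: "frechet_derivative (\<lambda>x. f (g x)) (at x) v =
      (\<Sum>b\<in>Basis. (frechet_derivative g (at x) v \<bullet> b) *\<^sub>R frechet_derivative f (at (g x)) b)" if "x \<in> N" for x v
    unfolding frechet_derivative_at[OF hd[OF that], symmetric]
    by (rule frechet_derivative_basis_sum) (use Suc.prems that assms(3) in auto)
  have g: "times_diff_on n N g"  using times_diff_on_Suc Suc.prems by blast
  have "times_diff_on n N (\<lambda>x. frechet_derivative f (at (g x)) b)" for b
    using Suc.IH[of "\<lambda>y. frechet_derivative f (at y) b"] Suc.prems g by simp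
  moreover have "times_diff_on n N (\<lambda>x. frechet_derivative g (at x) v \<bullet> b)" for v b
    using times_diff_on_bilinear[OF bounded_bilinear_inner assms(1) _ times_diff_on_const,
        of n "\<lambda>x. frechet_derivative g (at x) v" b] Suc.prems(2) by simp
  ultimately have n: "times_diff_on n N (\<lambda>x. \<Sum>b\<in>Basis. (frechet_derivative g (at x) v \<bullet> b) *\<^sub>R frechet_derivative f (at (g x)) b)" for v
    by (intro times_diff_on_sum times_diff_on_bilinear[OF bounded_bilinear_scaleR] assms(1) finite_Basis)
  have "times_diff_on n N (\<lambda>x. frechet_derivative (\<lambda>x. f (g x)) (at x) v)" for v
    by (rule times_diff_on_cong[OF assms(1) _ n]) (simp add: d)
  then show ?case using hd by (auto simp: differentiable_def)
qed

section \<open>Smoothness on arbitrary sets through local extensions\<close>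

lemma smooth_on_ex:
  assumes "smooth_on S f" "x \<in> S"
  obtains N f' where "open N" "x \<in> N" "\<And>n. times_diff_on n N f'" "\<And>y. y \<in> S \<Longrightarrow> y \<in> N \<Longrightarrow> f y = f' y"
  using assms unfolding smooth_on_def by (metis IntI)

lemma smooth_onI:
  assumes "\<And>x. x \<in> S \<Longrightarrow> \<exists>N f'. open N \<and> x \<in> N \<and> (\<forall>n. times_diff_on n N f') \<and> (\<forall>y\<in>S \<inter> N. f y = f' y)"
  shows "smooth_on S f"
  using assms unfolding smooth_on_def by blast

lemma smooth_on_local:
  assumes "\<And>x. x \<in> S \<Longrightarrow> \<exists>T. open T \<and> x \<in> T \<and> smooth_on (S \<inter> T) f"
  shows "smooth_on S f"
proof (rule smooth_onI)
  fix x assume x: "x \<in> S"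
  then obtain T where T: "open T" "x \<in> T" "smooth_on (S \<inter> T) f" using assms by blast
  then obtain N f' where N: "open N" "x \<in> N" "\<And>n. times_diff_on n N f'" "\<And>y. y \<in> S \<inter> T \<Longrightarrow> y \<in> N \<Longrightarrow> f y = f' y"
    using smooth_on_ex[OF T(3)] x by (metis IntI)
  show "\<exists>N f'. open N \<and> x \<in> N \<and> (\<forall>n. times_diff_on n N f') \<and> (\<forall>y\<in>S \<inter> N. f y = f' y)"
  proof (intro exI conjI allI ballI)
    show "open (N \<inter> T)" using N T by blast
    show "times_diff_on n (N \<inter> T) f'" for n using times_diff_on_subset[OF N(3)] by blast
  qed (use N T in auto)
qed

lemma smooth_on_cong:
  assumes "smooth_on S f" "T \<subseteq> S" "\<And>x. x \<in> T \<Longrightarrow> f x = g x"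
  shows "smooth_on T g"
proof (rule smooth_onI)
  fix x assume "x \<in> T"
  with assms(2) have "x \<in> S" by blast
  then obtain N f' where N: "open N" "x \<in> N" "\<And>n. times_diff_on n N f'" "\<And>y. y \<in> S \<Longrightarrow> y \<in> N \<Longrightarrow> f y = f' y"
    using smooth_on_ex[OF assms(1)] by metis
  have "\<forall>y\<in>T \<inter> N. g y = f' y" using N(4) assms(2,3) by (metis IntD1 IntD2 subsetD)
  with N(1,2,3) show "\<exists>N f'. open N \<and> x \<in> N \<and> (\<forall>n. times_diff_on n N f') \<and> (\<forall>y\<in>T \<inter> N. g y = f' y)"
    by blast
qed

lemma smooth_on_subset: "smooth_on S f \<Longrightarrow> T \<subseteq> S \<Longrightarrow> smooth_on T f"
  by (rule smooth_on_cong) auto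

lemma smooth_on_open: "open N \<Longrightarrow> (\<And>n. times_diff_on n N f) \<Longrightarrow> smooth_on N f"
  unfolding smooth_on_def by blast

lemma smooth_on_const: "smooth_on S (\<lambda>x. c)"
  by (rule smooth_on_subset[OF smooth_on_open[OF open_UNIV times_diff_on_const] subset_UNIV])

lemma smooth_on_linear: "bounded_linear f \<Longrightarrow> smooth_on S f"
  by (rule smooth_on_subset[OF smooth_on_open[OF open_UNIV times_diff_on_linear] subset_UNIV])

lemma smooth_on_continuous:
  assumes "smooth_on S f" shows "continuous_on S f"
  unfolding continuous_on_eq_continuous_within
proof
  fix x assume x: "x \<in> S"
  obtain N f' where N: "open N" "x \<in> N" "\<And>n. times_diff_on n N f'" "\<And>y. y \<in> S \<Longrightarrow> y \<in> N \<Longrightarrow> f y = f' y"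
    using smooth_on_ex[OF assms x] by metis
  have "continuous_on N f'" using N(3)[of 0] by simp
  then have "continuous (at x within S) f'"
    using N by (meson continuous_at_imp_continuous_at_within continuous_on_eq_continuous_at)
  then show "continuous (at x within S) f"
    by (rule continuous_transform_within_openin[where S = "S \<inter> N" and T = S])
      (use x N in \<open>auto simp: openin_open\<close>)
qed

lemma smooth_on_compose:
  fixes f :: "'b::euclidean_space \<Rightarrow> 'c::real_normed_vector"
    and g :: "'a::euclidean_space \<Rightarrow> 'b"
  assumes f: "smooth_on T f" and g: "smooth_on S g" and ST: "g ` S \<subseteq> T"
  shows "smooth_on S (\<lambda>x. f (g x))"
proof (rule smooth_onI)
  fix x assume x: "x \<in> S"
  obtain N g' where N: "open N" "x \<in> N" "\<And>n. times_diff_on n N g'" "\<And>y. y \<in> S \<Longrightarrow> y \<in> N \<Longrightarrow> g y = g' y"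
    using smooth_on_ex[OF g x] by metis
  obtain M f' where M: "open M" "g x \<in> M" "\<And>n. times_diff_on n M f'" "\<And>y. y \<in> T \<Longrightarrow> y \<in> M \<Longrightarrow> f y = f' y"
    using smooth_on_ex[OF f, of "g x"] ST x by (metis image_subset_iff)
  have "continuous_on N g'" using N(3)[of 0] by simp
  then have o: "open (N \<inter> g' -` M)" using N M by (simp add: continuous_open_preimage)
  have "times_diff_on n (N \<inter> g' -` M) (\<lambda>x. f' (g' x))" for n
    by (rule times_diff_on_compose[OF o M(1) _ M(3) times_diff_on_subset[OF N(3)]]) auto
  then show "\<exists>N f'. open N \<and> x \<in> N \<and> (\<forall>n. times_diff_on n N f') \<and> (\<forall>y\<in>S \<inter> N. f (g y) = f' y)"
    using o N M x ST by (intro exI[of _ "N \<inter> g' -` M"] exI[of _ "\<lambda>x. f' (g' x)"]) auto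
qed

lemma smooth_on_bilinear:
  assumes B: "bounded_bilinear B" and f: "smooth_on S f" and g: "smooth_on S g"
  shows "smooth_on S (\<lambda>x. B (f x) (g x))"
proof (rule smooth_onI)
  fix x assume x: "x \<in> S"
  obtain N g' where N: "open N" "x \<in> N" "\<And>n. times_diff_on n N g'" "\<And>y. y \<in> S \<Longrightarrow> y \<in> N \<Longrightarrow> g y = g' y"
    using smooth_on_ex[OF g x] by metis
  obtain M f' where M: "open M" "x \<in> M" "\<And>n. times_diff_on n M f'" "\<And>y. y \<in> S \<Longrightarrow> y \<in> M \<Longrightarrow> f y = f' y"
    using smooth_on_ex[OF f x] by metis
  have "times_diff_on n (N \<inter> M) (\<lambda>x. B (f' x) (g' x))" for n
    by (rule times_diff_on_bilinear[OF B open_Int[OF N(1) M(1)] times_diff_on_subset[OF M(3)] times_diff_on_subset[OF N(3)]]) auto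
  then show "\<exists>N h. open N \<and> x \<in> N \<and> (\<forall>n. times_diff_on n N h) \<and> (\<forall>y\<in>S \<inter> N. B (f y) (g y) = h y)"
    using N M x by (intro exI[of _ "N \<inter> M"] exI[of _ "\<lambda>x. B (f' x) (g' x)"]) auto
qed

lemma smooth_on_add:
  assumes f: "smooth_on S f" and g: "smooth_on S g"
  shows "smooth_on S (\<lambda>x. f x + g x)"
proof (rule smooth_onI)
  fix x assume x: "x \<in> S"
  obtain N g' where N: "open N" "x \<in> N" "\<And>n. times_diff_on n N g'" "\<And>y. y \<in> S \<Longrightarrow> y \<in> N \<Longrightarrow> g y = g' y"
    using smooth_on_ex[OF g x] by metis
  obtain M f' where M: "open M" "x \<in> M" "\<And>n. times_diff_on n M f'" "\<And>y. y \<in> S \<Longrightarrow> y \<in> M \<Longrightarrow> f y = f' y"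
    using smooth_on_ex[OF f x] by metis
  have "times_diff_on n (N \<inter> M) (\<lambda>x. f' x + g' x)" for n
    by (rule times_diff_on_add[OF open_Int[OF N(1) M(1)] times_diff_on_subset[OF M(3)] times_diff_on_subset[OF N(3)]]) auto
  then show "\<exists>N h. open N \<and> x \<in> N \<and> (\<forall>n. times_diff_on n N h) \<and> (\<forall>y\<in>S \<inter> N. f y + g y = h y)"
    using N M x by (intro exI[of _ "N \<inter> M"] exI[of _ "\<lambda>x. f' x + g' x"]) auto
qed

lemma smooth_on_scaleR:
  fixes f :: "'a::euclidean_space \<Rightarrow> 'b::euclidean_space"
  shows "smooth_on S f \<Longrightarrow> smooth_on S (\<lambda>x. c *\<^sub>R f x)"
  using smooth_on_bilinear[OF bounded_bilinear_scaleR smooth_on_const] by blast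

lemma smooth_on_diff:
  fixes f :: "'a::euclidean_space \<Rightarrow> 'b::euclidean_space"
  shows "smooth_on S f \<Longrightarrow> smooth_on S g \<Longrightarrow> smooth_on S (\<lambda>x. f x - g x)"
  using smooth_on_add[of S f "\<lambda>x. (-1) *\<^sub>R g x"] smooth_on_scaleR[of S g "-1"] by simp

lemma smooth_on_sum:
  assumes "finite I" "\<And>i. i \<in> I \<Longrightarrow> smooth_on S (f i)"
  shows "smooth_on S (\<lambda>x. \<Sum>i\<in>I. f i x)"
  using assms by (induction I rule: finite_induct) (auto intro: smooth_on_const smooth_on_add)

lemma smooth_on_fst: "smooth_on S f \<Longrightarrow> smooth_on S (\<lambda>x. fst (f x))"
  for f :: "'a::euclidean_space \<Rightarrow> 'b::euclidean_space \<times> 'c::euclidean_space"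
  using smooth_on_compose[OF smooth_on_linear[OF bounded_linear_fst, of UNIV]] by auto

lemma smooth_on_snd: "smooth_on S f \<Longrightarrow> smooth_on S (\<lambda>x. snd (f x))"
  for f :: "'a::euclidean_space \<Rightarrow> 'b::euclidean_space \<times> 'c::euclidean_space"
  using smooth_on_compose[OF smooth_on_linear[OF bounded_linear_snd, of UNIV]] by auto

lemma smooth_on_Pair:
  fixes f :: "'a::euclidean_space \<Rightarrow> 'b::euclidean_space" and g :: "'a \<Rightarrow> 'c::euclidean_space"
  assumes "smooth_on S f" "smooth_on S g" shows "smooth_on S (\<lambda>x. (f x, g x))"
proof -
  have "bounded_linear (\<lambda>x::'b. (x, 0::'c))" "bounded_linear (\<lambda>x::'c. (0::'b, x))"
    by (auto intro!: bounded_linear_Pair)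
  then have "smooth_on S (\<lambda>x. (f x, 0::'c))" "smooth_on S (\<lambda>x. (0::'b, g x))"
    using smooth_on_compose[of UNIV "\<lambda>x. (x, 0::'c)" S f] smooth_on_compose[of UNIV "\<lambda>x. (0::'b, x)" S g]
      smooth_on_linear assms by blast+
  then show ?thesis using smooth_on_add by fastforce
qed

lemma smooth_on_frechet_derivative:
  fixes f :: "'a::euclidean_space \<Rightarrow> 'b::euclidean_space"
  assumes N: "open N" "\<And>n. times_diff_on n N f" and S: "S \<subseteq> N" and h: "smooth_on S h"
  shows "smooth_on S (\<lambda>x. frechet_derivative f (at x) (h x))"
proof -
  have "times_diff_on n N (\<lambda>x. frechet_derivative f (at x) b)" for n b
    using N(2)[of "Suc n"] by simp
  then have "smooth_on S (\<lambda>x. frechet_derivative f (at x) b)" for b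
    using smooth_on_subset[OF smooth_on_open[OF N(1)] S] by blast
  then have "smooth_on S (\<lambda>x. \<Sum>b\<in>Basis. (h x \<bullet> b) *\<^sub>R frechet_derivative f (at x) b)"
    by (intro smooth_on_sum smooth_on_bilinear[OF bounded_bilinear_scaleR]
        smooth_on_bilinear[OF bounded_bilinear_inner] h smooth_on_const) auto
  moreover have "f differentiable (at x)" if "x \<in> S" for x
    using N(2)[of 1] that S by auto
  ultimately show ?thesis
    by (elim smooth_on_cong) (simp_all add: frechet_derivative_basis_sum[symmetric])
qed

lemma smooth_times_diff_derivative:
  fixes f :: "'a::euclidean_space \<Rightarrow> 'b::euclidean_space"
  assumes "\<And>n. times_diff_on n N f" "x \<in> N"
  shows "(f has_derivative frechet_derivative f (at x)) (at x)"
  using assms(1)[of 1] assms(2) by (auto simp: frechet_derivative_works[symmetric])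

section \<open>Linear algebra\<close>

lemma subspace_eqI_inner:
  fixes x y :: "'a::euclidean_space"
  assumes "subspace V" "x \<in> V" "y \<in> V" "\<And>v. v \<in> V \<Longrightarrow> x \<bullet> v = y \<bullet> v"
  shows "x = y"
proof -
  have "(x - y) \<bullet> (x - y) = 0"
    using assms(4)[OF subspace_diff[OF assms(1-3)]] by (simp add: inner_diff_left)
  then show ?thesis by simp
qed

text \<open>Coefficients against an orthonormal basis of \<open>V\<close>. The projection serves to
  represent functionals on \<open>V\<close> by vectors of \<open>V\<close>, which is how covectors
  are encoded.\<close>

lemma ex_orthogonal_projection:
  fixes V :: "'a::euclidean_space set"
  assumes V: "subspace V"
  shows "\<exists>P. linear P \<and> (\<forall>x. P x \<in> V) \<and> (\<forall>x. \<forall>v\<in>V. P x \<bullet> v = x \<bullet> v)"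
proof -
  obtain B where B: "B \<subseteq> V" "pairwise orthogonal B" "\<And>x. x \<in> B \<Longrightarrow> norm x = 1"
    "independent B" "card B = dim V" "span B = V"
    using orthonormal_basis_subspace[OF V] by metis
  have fin: "finite B" using B(4) independent_imp_finite by blast
  define P where "P x = (\<Sum>b\<in>B. (x \<bullet> b) *\<^sub>R b)" for x
  have "linear P"
    unfolding P_def by (intro linearI) (simp_all add: inner_add_left scaleR_left_distrib sum.distrib scaleR_sum_right)
  moreover have "P x \<in> V" for x
    unfolding P_def using B(1) V by (auto intro!: subspace_sum subspace_scale)
  moreover have "P x \<bullet> v = x \<bullet> v" if v: "v \<in> V" for x v
  proof -
    have Pb: "P x \<bullet> c = x \<bullet> c" if "c \<in> B" for c
    proof -
      have "P x \<bullet> c = (\<Sum>b\<in>B. if b = c then x \<bullet> c else 0)"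
        unfolding P_def inner_sum_left
      proof (rule sum.cong)
        fix b assume "b \<in> B"
        then show "(x \<bullet> b) *\<^sub>R b \<bullet> c = (if b = c then x \<bullet> c else 0)"
          using B(2,3) that by (auto simp: pairwise_def orthogonal_def dot_square_norm)
      qed simp
      then show ?thesis using fin that by simp
    qed
    have "subspace {v. P x \<bullet> v = x \<bullet> v}"
      by (auto simp: subspace_def inner_add_right)
    then have "span B \<subseteq> {v. P x \<bullet> v = x \<bullet> v}"
      using Pb by (intro span_minimal) auto
    then show ?thesis using v B(6) by blast
  qed
  ultimately show ?thesis by blast
qed

definition orth_proj :: "'a::euclidean_space set \<Rightarrow> 'a \<Rightarrow> 'a" where
  "orth_proj V = (SOME P. linear P \<and> (\<forall>x. P x \<in> V) \<and> (\<forall>x. \<forall>v\<in>V. P x \<bullet> v = x \<bullet> v))"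

lemma orth_proj:
  assumes "subspace V"
  shows linear_orth_proj: "linear (orth_proj V)"
    and orth_proj_in: "orth_proj V x \<in> V"
    and inner_orth_proj: "v \<in> V \<Longrightarrow> orth_proj V x \<bullet> v = x \<bullet> v"
  using someI_ex[OF ex_orthogonal_projection[OF assms]] unfolding orth_proj_def by blast+

lemma orth_proj_id: "subspace V \<Longrightarrow> v \<in> V \<Longrightarrow> orth_proj V v = v"
  by (rule subspace_eqI_inner[of V]) (auto intro: orth_proj)

text \<open>The Riesz representative in \<open>V\<close> of the restriction of \<open>f\<close> to
  \<open>V\<close>. The sum runs over the fixed \<open>Basis\<close> and involves no choice
  depending on \<open>f\<close>, so smooth dependence of \<open>f\<close> on a point passes to the
  representative term by term.\<close>

definition covector_of :: "'a::euclidean_space set \<Rightarrow> ('a \<Rightarrow> real) \<Rightarrow> 'a" where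
  "covector_of V f = (\<Sum>b\<in>Basis. f (orth_proj V b) *\<^sub>R b)"

lemma covector_of:
  assumes V: "subspace V" and f: "linear f"
  shows covector_of_in: "covector_of V f \<in> V"
    and inner_covector_of: "v \<in> V \<Longrightarrow> covector_of V f \<bullet> v = f v"
proof -
  have *: "covector_of V f \<bullet> z = f (orth_proj V z)" for z
  proof -
    have "orth_proj V z = (\<Sum>b\<in>Basis. (z \<bullet> b) *\<^sub>R orth_proj V b)"
      using euclidean_representation[of z] linear_orth_proj[OF V]
      by (metis (no_types, lifting) linear_scale linear_sum sum.cong)
    then have "f (orth_proj V z) = (\<Sum>b\<in>Basis. (z \<bullet> b) * f (orth_proj V b))"
      by (simp add: linear_sum[OF f] linear_scale[OF f])
    moreover have "covector_of V f \<bullet> z = (\<Sum>b\<in>Basis. f (orth_proj V b) * (b \<bullet> z))"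
      by (simp add: covector_of_def inner_sum_left)
    ultimately show ?thesis
      by (simp add: inner_commute mult.commute)
  qed
  show "v \<in> V \<Longrightarrow> covector_of V f \<bullet> v = f v"
    by (simp add: * orth_proj_id[OF V])
  \<comment> \<open>Membership in \<open>V\<close> is invariance under the projection, checked
    against every \<open>z\<close> by self-adjointness of the projection.\<close>
  have "covector_of V f = orth_proj V (covector_of V f)"
  proof (rule vector_eq_rdot[THEN iffD1], rule allI)
    fix z
    let ?P = "orth_proj V" and ?c = "covector_of V f"
    have "?P ?c \<bullet> z = ?P ?c \<bullet> ?P z"
      using orth_proj[OF V] by (metis inner_commute)
    also have "\<dots> = ?c \<bullet> ?P z" using orth_proj[OF V] by blast
    also have "\<dots> = ?c \<bullet> z" by (simp add: * orth_proj_id[OF V] orth_proj_in[OF V])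
    finally show "?c \<bullet> z = ?P ?c \<bullet> z" by simp
  qed
  then show "covector_of V f \<in> V" using orth_proj_in[OF V] by metis
qed

text \<open>Existence and uniqueness behind the definite description, in an explicit form from which
  linearity in \<beta> can be read off.\<close>

lemma pullback_covector_eq:
  assumes "subspace V" "linear A"
  shows "pullback_covector V A \<beta> = covector_of V (\<lambda>v. \<beta> \<bullet> A v)"
proof -
  have lin: "linear (\<lambda>v. \<beta> \<bullet> A v)"
    using linear_compose[OF assms(2), of "\<lambda>w. \<beta> \<bullet> w"] bounded_linear_inner_right bounded_linear.linear
    by (auto simp: o_def)
  show ?thesis
    unfolding pullback_covector_def
    by (rule the_equality) (use covector_of[OF assms(1) lin] in \<open>auto intro: subspace_eqI_inner[OF assms(1)]\<close>)
qed

lemma pullback_covector: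
  assumes "subspace V" "linear A"
  shows pullback_covector_in: "pullback_covector V A \<beta> \<in> V"
    and inner_pullback_covector: "v \<in> V \<Longrightarrow> pullback_covector V A \<beta> \<bullet> v = \<beta> \<bullet> A v"
proof -
  have lin: "linear (\<lambda>v. \<beta> \<bullet> A v)"
    using linear_compose[OF assms(2), of "\<lambda>w. \<beta> \<bullet> w"] bounded_linear_inner_right bounded_linear.linear
    by (auto simp: o_def)
  show "pullback_covector V A \<beta> \<in> V" "v \<in> V \<Longrightarrow> pullback_covector V A \<beta> \<bullet> v = \<beta> \<bullet> A v"
    using covector_of[OF assms(1) lin] by (auto simp: pullback_covector_eq[OF assms])
qed

lemma pullback_covector_unique:
  assumes "subspace V" "linear A" "\<gamma> \<in> V" "\<And>v. v \<in> V \<Longrightarrow> \<gamma> \<bullet> v = \<beta> \<bullet> A v"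
  shows "pullback_covector V A \<beta> = \<gamma>"
  by (rule subspace_eqI_inner[OF assms(1)]) (use assms pullback_covector[OF assms(1,2)] in auto)

text \<open>A linear right inverse \<open>h\<close> of \<open>g\<close> on \<open>S\<close> gives
  the factor \<open>f o h\<close>, because the defect \<open>x - h (g x)\<close> lies in the kernel
  of \<open>g\<close>. In this way a covector that vanishes on a kernel later becomes a
  pullback.\<close>

lemma linear_factor_covector:
  fixes g :: "'a::euclidean_space \<Rightarrow> 'b::euclidean_space"
  assumes S: "subspace S" and f: "linear f" and g: "linear g" and K: "subspace K"
    and gK: "g ` S \<subseteq> K" and ker: "\<And>x. x \<in> S \<Longrightarrow> g x = 0 \<Longrightarrow> f x = 0"
  obtains k where "k \<in> K" "\<And>x. x \<in> S \<Longrightarrow> f x = k \<bullet> g x"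
proof -
  obtain h where h: "range h \<subseteq> S" "linear h" "\<And>v. v \<in> g ` S \<Longrightarrow> g (h v) = v"
    using linear_exists_right_inverse_on[OF g S] by blast
  have fh: "linear (\<lambda>y. f (h y))" using linear_compose[OF h(2) f] by (simp add: o_def)
  show thesis
  proof (rule that[of "covector_of K (\<lambda>y. f (h y))"])
    show "covector_of K (\<lambda>y. f (h y)) \<in> K" by (rule covector_of_in[OF K fh])
    fix x assume x: "x \<in> S"
    then have "f (x - h (g x)) = 0"
      using h by (intro ker subspace_diff[OF S]) (auto simp: linear_diff[OF g])
    then have "f x = f (h (g x))" by (simp add: linear_diff[OF f])
    also have "\<dots> = covector_of K (\<lambda>y. f (h y)) \<bullet> g x"
      using gK x by (subst inner_covector_of[OF K fh]) auto
    finally show "f x = covector_of K (\<lambda>y. f (h y)) \<bullet> g x" .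
  qed
qed

section \<open>Lagrangian subspaces and stability of linear independence\<close>

lemma pairing_inner: "pairing x y = x \<bullet> prod.swap y"
  by (simp add: pairing_def split_beta inner_prod_def inner_commute)

lemma linear_pairing: "linear (pairing x)"
  by (rule linearI) (auto simp: pairing_def split_beta inner_add_right inner_add_left distrib_left)

lemma pairing_sym: "pairing x y = pairing y x"
  by (simp add: pairing_def split_beta inner_commute)

text \<open>Swapping the two components turns the pairing into the inner product, so the swapped
  copy of \<open>L\<close> is the orthogonal complement of \<open>L\<close> in
  \<open>V \<times> V\<close>; now count dimensions.\<close>

lemma dim_lagrangian:
  fixes V :: "'a::euclidean_space set"
  assumes V: "subspace V" and L: "subspace L" "L \<subseteq> V \<times> V"
    and lag: "L = {x \<in> V \<times> V. \<forall>y\<in>L. pairing x y = 0}"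
  shows "dim L = dim V"
proof -
  let ?s = "prod.swap :: 'a \<times> 'a \<Rightarrow> _"
  have lagD: "pairing x y = 0" if "x \<in> L" "y \<in> L" for x y
    using lag that by blast
  have lagI: "x \<in> L" if "x \<in> V \<times> V" "\<And>y. y \<in> L \<Longrightarrow> pairing x y = 0" for x
    using lag that by blast
  have lin: "linear ?s" by (rule linearI) auto
  have "?s ` L = {y \<in> V \<times> V. \<forall>x\<in>L. orthogonal x y}"
  proof (intro set_eqI iffI)
    fix y assume "y \<in> ?s ` L"
    then obtain z where z: "z \<in> L" "y = ?s z" by blast
    then show "y \<in> {y \<in> V \<times> V. \<forall>x\<in>L. orthogonal x y}"
      using L(2) lagD by (auto simp: orthogonal_def pairing_inner)
  next
    fix y assume y: "y \<in> {y \<in> V \<times> V. \<forall>x\<in>L. orthogonal x y}"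
    have p: "pairing (?s y) x = 0" if "x \<in> L" for x
      using y that pairing_inner[of x "?s y"] by (simp add: orthogonal_def pairing_sym)
    have "?s y \<in> V \<times> V" using y by auto
    then have "?s y \<in> L" using p by (rule lagI)
    then have "?s (?s y) \<in> ?s ` L" by (rule imageI)
    then show "y \<in> ?s ` L" by simp
  qed
  moreover have "dim (?s ` L) = dim L"
    by (rule dim_image_eq[OF lin]) simp
  ultimately have "dim L + dim L = dim (V \<times> V)"
    using dim_subspace_orthogonal_to_vectors[OF L(1) subspace_Times[OF V V] L(2)] by simp
  then show ?thesis using dim_Times[OF V V] by simp
qed

text \<open>Isotropy of \<open>M\<close> follows by evaluating the pairing upstairs. For maximality,
  a preimage \<open>v0\<close> of the vector part has to be corrected by some \<open>k\<close> in
  the kernel of \<open>A\<close> before \<open>(v0 - k, A^* \<alpha>)\<close> falls into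
  \<open>L\<close>; the correction is found by duality.\<close>

lemma lagrangian_pushforward:
  fixes A :: "'a::euclidean_space \<Rightarrow> 'b::euclidean_space"
  assumes V: "subspace V" and W: "subspace W" and A: "linear A" "A ` V = W"
    and L: "subspace L" "L \<subseteq> V \<times> V" and lag: "L = {x \<in> V \<times> V. \<forall>y\<in>L. pairing x y = 0}"
    and M: "M = {(v, \<alpha>). v \<in> W \<and> \<alpha> \<in> W \<and> (\<exists>w. (w, pullback_covector V A \<alpha>) \<in> L \<and> v = A w)}"
  shows "subspace M" and "M = {x \<in> W \<times> W. \<forall>y\<in>M. pairing x y = 0}"
proof -
  let ?A = "pullback_covector V A"
  have lagD: "pairing x y = 0" if "x \<in> L" "y \<in> L" for x y
    using lag that by blast
  have lagI: "x \<in> L" if "x \<in> V \<times> V" "\<And>y. y \<in> L \<Longrightarrow> pairing x y = 0" for x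
    using lag that by blast
  have inV: "?A \<alpha> \<in> V" and pb: "v \<in> V \<Longrightarrow> ?A \<alpha> \<bullet> v = \<alpha> \<bullet> A v" for \<alpha> v
    using pullback_covector[OF V A(1)] by auto
  have pb_add: "?A (\<alpha> + \<beta>) = ?A \<alpha> + ?A \<beta>" for \<alpha> \<beta>
    using inV pb by (intro pullback_covector_unique[OF V A(1)]) (auto intro: subspace_add[OF V] simp: inner_add_left)
  have pb_scale: "?A (c *\<^sub>R \<alpha>) = c *\<^sub>R ?A \<alpha>" for c \<alpha>
    using inV pb by (intro pullback_covector_unique[OF V A(1)]) (auto intro: subspace_scale[OF V])
  show M_sub: "subspace M"
  proof (rule subspaceI)
    have "?A 0 = 0" using pb_scale[of 0 0] by simp
    then show "0 \<in> M" using subspace_0[OF L(1)] subspace_0[OF W] linear_0[OF A(1)]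
      unfolding M by (auto simp: zero_prod_def intro!: exI[of _ 0])
  next
    fix x y assume "x \<in> M" "y \<in> M"
    then obtain w w' where w: "(w, ?A (snd x)) \<in> L" "fst x = A w" "(w', ?A (snd y)) \<in> L" "fst y = A w'"
      "snd x \<in> W" "snd y \<in> W" "fst x \<in> W" "fst y \<in> W"
      unfolding M by auto
    then have "(w + w', ?A (snd x + snd y)) \<in> L" "fst x + fst y = A (w + w')"
      using subspace_add[OF L(1) w(1,3)] by (auto simp: pb_add linear_add[OF A(1)])
    then show "x + y \<in> M"
      unfolding M using w subspace_add[OF W, of "fst x" "fst y"] subspace_add[OF W, of "snd x" "snd y"]
      by (auto simp: split_beta)
  next
    fix c x assume "x \<in> M"
    then obtain w where w: "(w, ?A (snd x)) \<in> L" "fst x = A w" "snd x \<in> W" "fst x \<in> W"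
      unfolding M by auto
    then have "(c *\<^sub>R w, ?A (c *\<^sub>R snd x)) \<in> L" "c *\<^sub>R fst x = A (c *\<^sub>R w)"
      using subspace_scale[OF L(1) w(1), of c] by (auto simp: pb_scale linear_scale[OF A(1)])
    then show "c *\<^sub>R x \<in> M"
      unfolding M using w subspace_scale[OF W, of "fst x" c] subspace_scale[OF W, of "snd x" c]
      by (auto simp: split_beta)
  qed
  show "M = {x \<in> W \<times> W. \<forall>y\<in>M. pairing x y = 0}"
  proof (intro set_eqI iffI)
    fix x assume x: "x \<in> M"
    then obtain w where w: "(w, ?A (snd x)) \<in> L" "fst x = A w" "snd x \<in> W" "fst x \<in> W"
      unfolding M by auto
    have "pairing x y = 0" if y: "y \<in> M" for y
    proof -
      obtain w' where w': "(w', ?A (snd y)) \<in> L" "fst y = A w'"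
        using y unfolding M by auto
      have "pairing (w, ?A (snd x)) (w', ?A (snd y)) = 0"
        using w(1) w'(1) lagD by blast
      moreover have "w \<in> V" "w' \<in> V" using w(1) w'(1) L(2) by blast+
      ultimately show ?thesis using w(2) w'(2) by (simp add: pairing_def split_beta pb)
    qed
    then show "x \<in> {x \<in> W \<times> W. \<forall>y\<in>M. pairing x y = 0}"
      using w by (auto simp: mem_Times_iff)
  next
    fix x assume x: "x \<in> {x \<in> W \<times> W. \<forall>y\<in>M. pairing x y = 0}"
    then have xW: "fst x \<in> W" "snd x \<in> W" and xM: "\<And>y. y \<in> M \<Longrightarrow> pairing x y = 0"
      by (auto simp: mem_Times_iff)
    have "fst x \<in> A ` V" using xW(1) A(2) by simp
    then obtain v0 where v0: "v0 \<in> V" "A v0 = fst x" by (elim imageE) simp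
    let ?K = "{u \<in> V. A u = 0}"
    have K: "subspace ?K"
      by (rule subspaceI) (auto simp: linear_add[OF A(1)] linear_scale[OF A(1)] linear_0[OF A(1)]
        intro: subspace_add[OF V] subspace_scale[OF V] subspace_0[OF V])
    let ?f = "pairing (v0, ?A (snd x))"
    \<comment> \<open>\<open>?g\<close> records how the covector part of an element of
      \<open>L\<close> acts on the kernel of \<open>A\<close>. Once \<open>?f\<close> is known to
      vanish wherever \<open>?g\<close> does, it equals \<open>k \<bullet> ?g\<close> for some
      \<open>k\<close> in that kernel, the wanted correction.\<close>
    let ?g = "\<lambda>y. orth_proj ?K (snd y)"
    have g: "linear ?g"
      by (rule linear_compose[OF linear_snd linear_orth_proj[OF K], unfolded o_def])
    have gK: "?g ` L \<subseteq> ?K" using orth_proj_in[OF K] by blast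
    \<comment> \<open>A covector vanishing on the kernel of \<open>A\<close> is a pullback, so
      \<open>y\<close> pushes forward to an element of \<open>M\<close>, to which \<open>x\<close>
      is orthogonal by assumption.\<close>
    have gf: "?f y = 0" if y: "y \<in> L" "?g y = 0" for y
    proof -
      have ker: "snd y \<bullet> u = 0" if "u \<in> V" "A u = 0" for u
        using inner_orth_proj[OF K, of u "snd y"] that y(2) by simp
      obtain \<alpha>0 where \<alpha>0: "\<alpha>0 \<in> W" "\<And>u. u \<in> V \<Longrightarrow> snd y \<bullet> u = \<alpha>0 \<bullet> A u"
      proof (rule linear_factor_covector[OF V bounded_linear.linear[OF bounded_linear_inner_right[of "snd y"]] A(1) W])
        show "A ` V \<subseteq> W" using A(2) by simp
      qed (use ker in blast)+
      have yV: "fst y \<in> V" "snd y \<in> V" using y(1) L(2) by auto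
      have "?A \<alpha>0 = snd y"
        using \<alpha>0 yV by (intro pullback_covector_unique[OF V A(1)]) auto
      moreover have "(fst y, snd y) \<in> L" "A (fst y) \<in> W" using y(1) yV A(2) by auto
      ultimately have "(A (fst y), \<alpha>0) \<in> M"
        unfolding M using \<alpha>0(1) by (metis (mono_tags, lifting) case_prodI mem_Collect_eq)
      then have "pairing x (A (fst y), \<alpha>0) = 0" by (rule xM)
      then show "?f y = 0"
        using pb[OF yV(1), of "snd x"] \<alpha>0(2)[OF v0(1)] v0(2) by (simp add: pairing_def split_beta)
    qed
    obtain k where k: "k \<in> ?K" "\<And>y. y \<in> L \<Longrightarrow> ?f y = k \<bullet> ?g y"
      by (rule linear_factor_covector[OF L(1) linear_pairing g K gK]) (erule (1) gf, rule that)
    have 1: "pairing (v0 - k, ?A (snd x)) y = 0" if y: "y \<in> L" for y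
    proof -
      have "k \<bullet> ?g y = snd y \<bullet> k"
        using inner_orth_proj[OF K k(1), of "snd y"] inner_commute[of k "?g y"] by simp
      then show ?thesis using k(2)[OF y] by (simp add: pairing_def split_beta inner_diff_right)
    qed
    have "(v0 - k, ?A (snd x)) \<in> V \<times> V"
      using v0(1) k(1) inV subspace_diff[OF V, of v0 k] by simp
    then have "(v0 - k, ?A (snd x)) \<in> L" using 1 by (rule lagI)
    moreover have "fst x = A (v0 - k)" using v0(2) k(1) by (simp add: linear_diff[OF A(1)])
    ultimately have "\<exists>w. (w, ?A (snd x)) \<in> L \<and> fst x = A w" by blast
    with xW have "(fst x, snd x) \<in> M" unfolding M mem_Collect_eq prod.case by (intro conjI)
    then show "x \<in> M" by simp
  qed
qed

text \<open>Functionals dual to \<open>y\<close>, with bounds \<open>B i\<close>, read off the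
  coefficients of a relation. A relation among the \<open>z i\<close> is one among the
  \<open>y i\<close> up to an error of at most \<delta> times the sum of the absolute coefficients;
  for small \<delta> that sum is bounded by a proper fraction of itself, hence 0.\<close>

lemma independent_family_perturb:
  fixes y :: "nat \<Rightarrow> 'a::euclidean_space"
  assumes inj: "inj_on y {..<r}" and ind: "independent (y ` {..<r})"
  shows "\<exists>\<delta>>0. \<forall>z. (\<forall>i<r. norm (z i - y i) < \<delta>) \<longrightarrow> inj_on z {..<r} \<and> independent (z ` {..<r})"
proof -
  have "\<exists>f. linear f \<and> (\<forall>x\<in>y ` {..<r}. f x = (if x = y i then 1 else (0::real)))" for i
    using linear_independent_extend[OF ind, of "\<lambda>x. if x = y i then 1 else 0"] .
  then have "\<forall>i. \<exists>f. linear f \<and> (\<forall>x\<in>y ` {..<r}. f x = (if x = y i then 1 else (0::real)))" ..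
  from choice[OF this] obtain f where
      f': "\<forall>i. linear (f i) \<and> (\<forall>x\<in>y ` {..<r}. f i x = (if x = y i then 1 else (0::real)))" ..
  have f: "linear (f i)" "x \<in> y ` {..<r} \<Longrightarrow> f i x = (if x = y i then 1 else (0::real))" for i x
    using f'[rule_format] by blast+
  have fy: "f i (y j) = (if i = j then 1 else 0)" if "i < r" "j < r" for i j
    using f(2)[of "y j" i] that inj by (auto simp: inj_on_def)
  have "\<exists>B>0. \<forall>x. norm (f i x) \<le> B * norm x" for i
    using linear_bounded_pos[OF f(1)[of i]] by blast
  then have "\<forall>i. \<exists>B>0. \<forall>x. norm (f i x) \<le> B * norm x" ..
  from choice[OF this] obtain B where B': "\<forall>i. B i > 0 \<and> (\<forall>x. norm (f i x) \<le> B i * norm x)" ..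
  then have B: "B i > 0" "norm (f i x) \<le> B i * norm x" for i x
    by blast+
  \<comment> \<open>The added 1 keeps \<open>C\<close> positive when \<open>r = 0\<close> and makes
    the sum of the \<open>B i\<close> times \<open>1 / C\<close> strictly less than 1.\<close>
  define C where "C = 1 + (\<Sum>i<r. B i)"
  have C: "C > 0" unfolding C_def using B(1) by (simp add: add_pos_nonneg sum_nonneg less_imp_le)
  define \<delta> where "\<delta> = 1 / C"
  have dpos: "\<delta> > 0" using C \<delta>_def by simp
  have zero: "\<forall>i<r. a i = 0" if z: "\<forall>i<r. norm (z i - y i) < \<delta>" and s: "(\<Sum>i<r. a i *\<^sub>R z i) = 0" for z a
  proof -
    let ?S = "\<Sum>i<r. \<bar>a i\<bar>"
    have eq: "(\<Sum>i<r. a i *\<^sub>R y i) = (\<Sum>i<r. a i *\<^sub>R (y i - z i))"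
      using s by (simp add: scaleR_diff_right sum_subtractf)
    have "norm (\<Sum>i<r. a i *\<^sub>R (y i - z i)) \<le> (\<Sum>i<r. norm (a i *\<^sub>R (y i - z i)))"
      by (rule norm_sum)
    also have "\<dots> \<le> (\<Sum>i<r. \<bar>a i\<bar> * \<delta>)"
      using z by (intro sum_mono) (simp add: norm_minus_commute mult_left_mono less_imp_le)
    finally have n: "norm (\<Sum>i<r. a i *\<^sub>R y i) \<le> ?S * \<delta>" by (simp add: eq sum_distrib_right)
    have ai: "\<bar>a i\<bar> \<le> B i * (?S * \<delta>)" if i: "i < r" for i
    proof -
      have "f i (\<Sum>j<r. a j *\<^sub>R y j) = (\<Sum>j<r. a j * f i (y j))"
        by (simp add: linear_sum[OF f(1)] linear_scale[OF f(1)])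
      also have "\<dots> = (\<Sum>j<r. if j = i then a i else 0)"
        using fy i by (intro sum.cong) auto
      also have "\<dots> = a i" using i by simp
      finally have "\<bar>a i\<bar> \<le> B i * norm (\<Sum>j<r. a j *\<^sub>R y j)" using B(2)[of i] by (metis real_norm_def)
      also have "\<dots> \<le> B i * (?S * \<delta>)" using n B(1)[of i] by (intro mult_left_mono) auto
      finally show ?thesis .
    qed
    have "?S \<le> (\<Sum>i<r. B i * (?S * \<delta>))" using ai by (intro sum_mono) auto
    also have "\<dots> = (\<Sum>i<r. B i) * \<delta> * ?S" by (simp add: sum_distrib_right mult_ac sum_distrib_left)
    finally have le: "?S \<le> (\<Sum>i<r. B i) * \<delta> * ?S" .
    have "(\<Sum>i<r. B i) * \<delta> < 1" using C by (simp add: \<delta>_def C_def)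
    then have "?S \<le> 0"
      using le by (smt (verit) mult_le_cancel_right1 sum_nonneg abs_ge_zero)
    then have "?S = 0" by (simp add: sum_nonneg antisym)
    then show ?thesis by (simp add: sum_nonneg_eq_0_iff)
  qed
  have "inj_on z {..<r} \<and> independent (z ` {..<r})" if z: "\<forall>i<r. norm (z i - y i) < \<delta>" for z
  proof
    show injz: "inj_on z {..<r}"
    proof (rule inj_onI, rule ccontr)
      fix i j assume ij: "i \<in> {..<r}" "j \<in> {..<r}" "z i = z j" "i \<noteq> j"
      \<comment> \<open>If two members coincide, these coefficients form a nontrivial relation, so
        injectivity is a special case of \<open>zero\<close>.\<close>
      define a where "a k = (if k = i then 1 else 0) - (if k = j then 1 else (0::real))" for k
      have "(\<Sum>k<r. a k *\<^sub>R z k) = (\<Sum>k<r. (if k = i then z i else 0)) - (\<Sum>k<r. (if k = j then z j else 0))"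
        unfolding a_def sum_subtractf[symmetric] by (intro sum.cong) auto
      also have "\<dots> = 0" using ij by simp
      finally have "a i = 0" using zero[OF z] ij(1) by blast
      then show False using ij(4) by (simp add: a_def)
    qed
    show "independent (z ` {..<r})"
      unfolding independent_explicit
    proof (intro conjI allI impI ballI)
      fix c v assume c: "(\<Sum>v\<in>z ` {..<r}. c v *\<^sub>R v) = 0" and "v \<in> z ` {..<r}"
      then have "(\<Sum>i<r. c (z i) *\<^sub>R z i) = 0" by (simp add: sum.reindex[OF injz])
      then show "c v = 0" using zero[OF z, of "\<lambda>i. c (z i)"] \<open>v \<in> z ` {..<r}\<close> by auto
    qed simp
  qed
  then show ?thesis using dpos by blast
qed

section \<open>Charts and velocities of curves\<close>

text \<open>
  The part of \<open>smooth_manifold\<close> that is needed for the calculus of curves. It is inherited by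
  products without any discussion of the chart spaces.
\<close>

definition chart_system :: "('a, 'e::euclidean_space) manifold \<Rightarrow> bool" where
  "chart_system M \<longleftrightarrow>
     (\<forall>c\<in>atlas M. inj_on (snd c) (fst c)) \<and>
     (\<forall>c\<in>atlas M. \<forall>d\<in>atlas M.
        openin (top_of_set (snd c ` fst c)) (snd c ` (fst c \<inter> fst d)) \<and>
        continuous_on (snd c ` (fst c \<inter> fst d)) (snd d \<circ> chart_inv c)) \<and>
     (\<forall>p\<in>points M. chart_at M p \<in> atlas M \<and> p \<in> fst (chart_at M p))"

lemma chart_inv_eq: "inj_on (snd c) (fst c) \<Longrightarrow> p \<in> fst c \<Longrightarrow> chart_inv c (snd c p) = p"
  by (simp add: chart_inv_def)

lemma smooth_manifold_imp_chart_system: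
  assumes "smooth_manifold M"
  shows "chart_system M"
  unfolding chart_system_def
proof (intro conjI ballI)
  fix c d assume cd: "c \<in> atlas M" "d \<in> atlas M"
  then have "compatible c d" using assms by (simp add: smooth_manifold_def)
  then have 1: "openin (top_of_set (chart_space c)) (snd c ` (fst c \<inter> fst d))"
    and 2: "smooth_on (snd c ` (fst c \<inter> fst d)) (snd d \<circ> chart_inv c)"
    by (simp_all add: compatible_def)
  have "snd c ` fst c \<subseteq> chart_space c" by (simp add: chart_space_def span_superset)
  then show "openin (top_of_set (snd c ` fst c)) (snd c ` (fst c \<inter> fst d))"
    using openin_subset_trans[OF 1] by blast
  show "continuous_on (snd c ` (fst c \<inter> fst d)) (snd d \<circ> chart_inv c)"
    using smooth_on_continuous[OF 2] .
qed (use assms in \<open>simp_all add: smooth_manifold_def\<close>)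

text \<open>The manifold topology is given by a subbasis, so the proof is an induction on generated
  sets; the subbasic case is continuity of the transition maps on their relatively open
  domains.\<close>

lemma openin_chart_image:
  assumes M: "chart_system M" and c: "c \<in> atlas M" and U: "openin (manifold_topology M) U"
  shows "openin (top_of_set (snd c ` fst c)) (snd c ` (U \<inter> fst c))"
proof -
  have inj: "inj_on (snd c) (fst c)" using M c by (simp add: chart_system_def)
  have "generate_topology_on {fst c \<inter> snd c -` W | c W. c \<in> atlas M \<and> open W} U"
    using U by (simp add: manifold_topology_def openin_topology_generated_by_iff)
  then show ?thesis
  proof (induction rule: generate_topology_on.induct)
    case Empty
    then show ?case by simp
  next
    case (Int a b)
    have "snd c ` (a \<inter> b \<inter> fst c) = snd c ` (a \<inter> fst c) \<inter> snd c ` (b \<inter> fst c)"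
      using inj by (auto simp: inj_on_def)
    then show ?case using openin_Int[OF Int.IH] by simp
  next
    case (UN K)
    have "snd c ` (\<Union>K \<inter> fst c) = \<Union>((\<lambda>k. snd c ` (k \<inter> fst c)) ` K)" by blast
    moreover have "openin (top_of_set (snd c ` fst c)) \<dots>"
      by (rule openin_Union) (use UN.IH in auto)
    ultimately show ?case by simp
  next
    case (Basis s)
    then obtain d W where d: "d \<in> atlas M" "open W" "s = fst d \<inter> snd d -` W"
      unfolding mem_Collect_eq by (elim exE conjE) (rule that)
    have o: "openin (top_of_set (snd c ` fst c)) (snd c ` (fst c \<inter> fst d))"
      "continuous_on (snd c ` (fst c \<inter> fst d)) (snd d \<circ> chart_inv c)"
      using M c d by (simp_all add: chart_system_def)
    have "snd c ` (s \<inter> fst c) = snd c ` (fst c \<inter> fst d) \<inter> (snd d \<circ> chart_inv c) -` W"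
    proof (intro set_eqI iffI)
      fix x assume "x \<in> snd c ` (s \<inter> fst c)"
      then obtain q where "q \<in> fst c" "q \<in> fst d" "snd d q \<in> W" "x = snd c q" using d(3) by auto
      then show "x \<in> snd c ` (fst c \<inter> fst d) \<inter> (snd d \<circ> chart_inv c) -` W"
        using chart_inv_eq[OF inj] by auto
    next
      fix x assume x: "x \<in> snd c ` (fst c \<inter> fst d) \<inter> (snd d \<circ> chart_inv c) -` W"
      then obtain q where "q \<in> fst c" "q \<in> fst d" "x = snd c q" by auto
      then show "x \<in> snd c ` (s \<inter> fst c)" using x d(3) chart_inv_eq[OF inj] by auto
    qed
    moreover have "openin (top_of_set (snd c ` (fst c \<inter> fst d))) \<dots>"
      using continuous_openin_preimage_gen[OF o(2) d(2)] .
    ultimately show ?case using openin_trans[OF _ o(1)] by simp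
  qed
qed

lemma openin_chart_domain: "c \<in> atlas M \<Longrightarrow> open W \<Longrightarrow> openin (manifold_topology M) (fst c \<inter> snd c -` W)"
  unfolding manifold_topology_def by (rule topology_generated_by_Basis) blast

lemma openin_chart: "c \<in> atlas M \<Longrightarrow> openin (manifold_topology M) (fst c)"
  using openin_chart_domain[of c M UNIV] by simp

lemma topspace_manifold_topology: "topspace (manifold_topology M) = points M"
proof
  show "topspace (manifold_topology M) \<subseteq> points M"
    unfolding manifold_topology_def points_def topology_generated_by_topspace by auto
  show "points M \<subseteq> topspace (manifold_topology M)"
    unfolding points_def using openin_subset[OF openin_chart] by (intro UN_least)
qed

lemma openin_points: "openin (manifold_topology M) (points M)"
  using openin_topspace[of "manifold_topology M"] by (simp add: topspace_manifold_topology)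

lemma openin_chart_nhd:
  assumes M: "chart_system M" and c: "c \<in> atlas M" and U: "openin (manifold_topology M) U"
    and p: "p \<in> U" "p \<in> fst c"
  obtains W where "open W" "snd c p \<in> W" "\<And>q. q \<in> fst c \<Longrightarrow> snd c q \<in> W \<Longrightarrow> q \<in> U"
proof -
  obtain W where W: "open W" "snd c ` (U \<inter> fst c) = snd c ` fst c \<inter> W"
    using openin_chart_image[OF M c U] unfolding openin_open by (elim exE conjE) (rule that)
  have inj: "inj_on (snd c) (fst c)" using M c by (simp add: chart_system_def)
  show thesis
  proof (rule that[OF W(1)])
    show "snd c p \<in> W" using W(2) p by blast
    fix q assume q: "q \<in> fst c" "snd c q \<in> W"
    then have "snd c q \<in> snd c ` (U \<inter> fst c)" using W(2) by simp
    then obtain r where "r \<in> U" "r \<in> fst c" "snd c q = snd c r" by auto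
    then show "q \<in> U" using inj_onD[OF inj _ q(1)] by simp
  qed
qed

text \<open>The filter \<open>nhds 0\<close> includes the parameter 0 itself, so eventual statements
  also hold at the base point. Differentiability is asked for at 0 only, which is what the lifts
  through submersions provide.\<close>

definition chart_velocity ::
  "('a, 'e::euclidean_space) chart \<Rightarrow> (real \<Rightarrow> 'a) \<Rightarrow> 'a \<Rightarrow> 'e \<Rightarrow> bool" where
  "chart_velocity c \<gamma> p w \<longleftrightarrow>
     \<gamma> 0 = p \<and> (\<forall>\<^sub>F \<tau> in nhds 0. \<gamma> \<tau> \<in> fst c) \<and>
     ((\<lambda>\<tau>. snd c (\<gamma> \<tau>)) has_vector_derivative w) (at 0)"

abbreviation velocity where "velocity M \<gamma> p v \<equiv> chart_velocity (chart_at M p) \<gamma> p v"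

text \<open>The workhorse for identities between tangent maps: both sides are realised as
  velocities, in one chart, of curves that agree near 0.\<close>

lemma chart_velocity_unique:
  assumes "chart_velocity c \<gamma> p w" "chart_velocity c \<gamma>' p' w'" "\<forall>\<^sub>F \<tau> in nhds 0. \<gamma> \<tau> = \<gamma>' \<tau>"
  shows "w = w'"
proof -
  have e': "\<forall>\<^sub>F \<tau> in nhds 0. snd c (\<gamma>' \<tau>) = snd c (\<gamma> \<tau>)"
    using assms(3) by eventually_elim simp
  have "((\<lambda>\<tau>. snd c (\<gamma>' \<tau>)) has_vector_derivative w) (at 0)"
    using assms(1) e' eventually_nhds_x_imp_x[OF e']
      has_vector_derivative_cong_ev[where x = 0 and S = UNIV and f' = w and
        f = "\<lambda>\<tau>. snd c (\<gamma>' \<tau>)" and g = "\<lambda>\<tau>. snd c (\<gamma> \<tau>)"]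
    by (simp add: chart_velocity_def)
  then show ?thesis
    using assms(2) vector_derivative_unique_at[of "\<lambda>\<tau>. snd c (\<gamma>' \<tau>)" w 0 w'] by (simp add: chart_velocity_def)
qed

lemma chart_velocity_mem: "chart_velocity c \<gamma> p w \<Longrightarrow> p \<in> fst c"
  unfolding chart_velocity_def using eventually_nhds_x_imp_x by blast

lemma chart_velocity_const: "p \<in> fst c \<Longrightarrow> chart_velocity c (\<lambda>_. p) p 0"
  by (simp add: chart_velocity_def)

lemma chart_velocity_tendsto: "chart_velocity c \<gamma> p w \<Longrightarrow> ((\<lambda>\<tau>. snd c (\<gamma> \<tau>)) \<longlongrightarrow> snd c p) (nhds 0)"
  unfolding chart_velocity_def
  using has_vector_derivative_continuous[of "\<lambda>\<tau>. snd c (\<gamma> \<tau>)" w 0 UNIV]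
    tendsto_at_iff_tendsto_nhds[of "\<lambda>\<tau>. snd c (\<gamma> \<tau>)" 0]
  by (simp add: continuous_within)

lemma chart_velocity_eventually_in:
  assumes M: "chart_system M" and c: "c \<in> atlas M" and v: "chart_velocity c \<gamma> p w"
    and U: "openin (manifold_topology M) U" "p \<in> U"
  shows "\<forall>\<^sub>F \<tau> in nhds 0. \<gamma> \<tau> \<in> U"
proof -
  obtain W where W: "open W" "snd c p \<in> W" "\<And>q. q \<in> fst c \<Longrightarrow> snd c q \<in> W \<Longrightarrow> q \<in> U"
    by (rule openin_chart_nhd[OF M c U chart_velocity_mem[OF v]]) (rule that)
  have "\<forall>\<^sub>F \<tau> in nhds 0. snd c (\<gamma> \<tau>) \<in> W"
    using topological_tendstoD[OF chart_velocity_tendsto[OF v] W(1,2)] .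
  moreover have "\<forall>\<^sub>F \<tau> in nhds 0. \<gamma> \<tau> \<in> fst c" using v by (simp add: chart_velocity_def)
  ultimately show ?thesis by eventually_elim (rule W(3))
qed

text \<open>Along the curve the inner product with a vector orthogonal to the chart space is
  constantly 0, hence so is its derivative; this is applied to the component of \<open>w\<close>
  orthogonal to that space.\<close>

lemma chart_velocity_in_space:
  assumes "chart_velocity c \<gamma> p w"
  shows "w \<in> chart_space c"
proof -
  have V: "subspace (chart_space c)" by (simp add: chart_space_def)
  define z where "z = w - orth_proj (chart_space c) w"
  have z: "v \<bullet> z = 0" if "v \<in> chart_space c" for v
    using inner_orth_proj[OF V that, of w] by (simp add: z_def inner_diff_right inner_commute)
  have d: "((\<lambda>\<tau>. snd c (\<gamma> \<tau>) \<bullet> z) has_vector_derivative w \<bullet> z) (at 0)"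
    using assms bounded_linear.has_vector_derivative[OF bounded_linear_inner_left,
        of "\<lambda>\<tau>. snd c (\<gamma> \<tau>)" w "at 0" z]
    by (simp add: chart_velocity_def)
  have "\<forall>\<^sub>F \<tau> in nhds 0. \<gamma> \<tau> \<in> fst c" using assms by (simp add: chart_velocity_def)
  then have e: "\<forall>\<^sub>F \<tau> in nhds 0. snd c (\<gamma> \<tau>) \<bullet> z = 0"
    by eventually_elim (simp add: z chart_space_def span_base)
  have "((\<lambda>\<tau>. 0) has_vector_derivative w \<bullet> z) (at (0::real))"
    using d has_vector_derivative_cong_ev[where x = 0 and S = UNIV and f' = "w \<bullet> z" and
        f = "\<lambda>\<tau>. snd c (\<gamma> \<tau>) \<bullet> z" and g = "\<lambda>\<tau>. 0"]
      e eventually_nhds_x_imp_x[OF e] by simp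
  then have "w \<bullet> z = 0"
    by (rule vector_derivative_unique_at[OF _ has_vector_derivative_const])
  moreover have "orth_proj (chart_space c) w \<bullet> z = 0" by (rule z[OF orth_proj_in[OF V]])
  ultimately have "z \<bullet> z = 0" by (simp add: z_def inner_diff_left)
  then have "w = orth_proj (chart_space c) w" by (simp add: z_def)
  then show ?thesis using orth_proj_in[OF V, of w] by simp
qed

text \<open>The derivative within the coordinate image of \<open>B\<close> need not be unique, but
  the chain rule along a curve that stays in \<open>B\<close> holds for whichever one is chosen.
  \<open>B\<close> is left free to serve domains of maps, chart overlaps and the fibres on which
  translations act.\<close>

lemma chart_velocity_image:
  assumes inj: "inj_on (snd c) (fst c)" and v: "chart_velocity c \<gamma> p w"
    and B: "B \<subseteq> fst c" "\<forall>\<^sub>F \<tau> in nhds 0. \<gamma> \<tau> \<in> B"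
    and diff: "(snd d \<circ> F \<circ> chart_inv c) differentiable (at (snd c p) within snd c ` B)"
    and ev: "\<forall>\<^sub>F \<tau> in nhds 0. F (\<gamma> \<tau>) \<in> fst d"
  shows "chart_velocity d (\<lambda>\<tau>. F (\<gamma> \<tau>)) (F p)
    (frechet_derivative (snd d \<circ> F \<circ> chart_inv c) (at (snd c p) within snd c ` B) w)"
proof -
  let ?f = "snd d \<circ> F \<circ> chart_inv c"
  let ?D = "frechet_derivative ?f (at (snd c p) within snd c ` B)"
  let ?g = "\<lambda>\<tau>. snd c (\<gamma> \<tau>)"
  have p: "\<gamma> 0 = p" using v by (simp add: chart_velocity_def)
  obtain T where T: "open T" "0 \<in> T" "\<And>\<tau>. \<tau> \<in> T \<Longrightarrow> \<gamma> \<tau> \<in> B"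
    using B(2) unfolding eventually_nhds by auto
  have D: "(?f has_derivative ?D) (at (?g 0) within snd c ` B)"
    using diff frechet_derivative_works p by auto
  have "(?g has_derivative (\<lambda>t. t *\<^sub>R w)) (at 0 within T)"
    using v has_derivative_at_withinI by (auto simp: chart_velocity_def has_vector_derivative_def)
  then have "((?f \<circ> ?g) has_derivative (?D \<circ> (\<lambda>t. t *\<^sub>R w))) (at 0 within T)"
    by (rule diff_chain_within) (rule has_derivative_subset[OF D], use T(3) in auto)
  moreover have "?D \<circ> (\<lambda>t. t *\<^sub>R w) = (\<lambda>t. t *\<^sub>R ?D w)"
    using linear_scale[OF has_derivative_linear[OF D]] by auto
  ultimately have "((?f \<circ> ?g) has_vector_derivative ?D w) (at 0)"
    using at_within_open[OF T(2,1)] by (simp add: has_vector_derivative_def)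
  then have "((\<lambda>\<tau>. snd d (F (\<gamma> \<tau>))) has_vector_derivative ?D w) (at 0)"
    by (rule has_vector_derivative_transform_within_open[OF _ T(1,2)])
      (simp add: chart_inv_eq[OF inj subsetD[OF B(1) T(3)]])
  then show ?thesis using ev p by (simp add: chart_velocity_def)
qed

text \<open>\<open>f\<close> is a smooth extension of the coordinate expression of \<open>F\<close>
  to an ambient open set, so its derivative is unique. The clause \<open>F q \<in> fst d\<close>
  stores what continuity of \<open>F\<close> contributes.\<close>

definition represents_on ::
  "'a set \<Rightarrow> ('a, 'e::euclidean_space) chart \<Rightarrow> ('b, 'f::euclidean_space) chart \<Rightarrow> ('a \<Rightarrow> 'b) \<Rightarrow> 'a \<Rightarrow>
   'e set \<Rightarrow> ('e \<Rightarrow> 'f) \<Rightarrow> bool" where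
  "represents_on S c d F p W f \<longleftrightarrow>
     open W \<and> snd c p \<in> W \<and> (\<forall>n. times_diff_on n W f) \<and>
     (\<forall>q\<in>S \<inter> fst c. snd c q \<in> W \<longrightarrow> F q \<in> fst d \<and> snd d (F q) = f (snd c q))"

lemma smooth_map_on_represents:
  assumes M: "chart_system M" and F: "smooth_map_on M S N F"
    and c: "c \<in> atlas M" "p \<in> fst c" and d: "d \<in> atlas N" "F p \<in> fst d" and p: "p \<in> S"
  obtains W f where "represents_on S c d F p W f"
proof -
  have inj: "inj_on (snd c) (fst c)" using M c by (simp add: chart_system_def)
  have "smooth_on (snd c ` (S \<inter> fst c \<inter> F -` fst d)) (snd d \<circ> F \<circ> chart_inv c)"
    using F c(1) d(1) by (simp add: smooth_map_on_def)
  from smooth_on_ex[OF this, of "snd c p"] p c(2) d(2)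
  obtain N0 f where N0: "open N0" "snd c p \<in> N0" "\<And>n. times_diff_on n N0 f"
      "\<And>y. y \<in> snd c ` (S \<inter> fst c \<inter> F -` fst d) \<Longrightarrow> y \<in> N0 \<Longrightarrow> (snd d \<circ> F \<circ> chart_inv c) y = f y"
    by blast
  \<comment> \<open>Smoothness in coordinates speaks only about points that \<open>F\<close> maps
    into \<open>fst d\<close>; continuity shrinks the neighbourhood until all of its points in
    \<open>S\<close> are mapped there.\<close>
  have "openin (subtopology (manifold_topology M) S) {q \<in> topspace (subtopology (manifold_topology M) S). F q \<in> fst d}"
    using F openin_chart[OF d(1)] by (intro openin_continuous_map_preimage) (auto simp: smooth_map_on_def)
  then obtain U where U: "openin (manifold_topology M) U"
      "{q \<in> topspace (subtopology (manifold_topology M) S). F q \<in> fst d} = U \<inter> S"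
    unfolding openin_subtopology by (elim exE conjE) (rule that)
  have SM: "S \<subseteq> points M" using F by (simp add: smooth_map_on_def)
  have "p \<in> U \<inter> S" unfolding U(2)[symmetric] using p SM d(2) by (auto simp: topspace_manifold_topology)
  then obtain W where W: "open W" "snd c p \<in> W" "\<And>q. q \<in> fst c \<Longrightarrow> snd c q \<in> W \<Longrightarrow> q \<in> U"
    using openin_chart_nhd[OF M c(1) U(1) _ c(2)] by blast
  have "F q \<in> fst d \<and> snd d (F q) = f (snd c q)" if q: "q \<in> S \<inter> fst c" "snd c q \<in> N0 \<inter> W" for q
  proof -
    have "q \<in> U \<inter> S" using W(3) q by blast
    then have Fq: "F q \<in> fst d" unfolding U(2)[symmetric] by simp
    have "(snd d \<circ> F \<circ> chart_inv c) (snd c q) = f (snd c q)"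
      by (rule N0(4)) (use q Fq in auto)
    then show ?thesis using Fq chart_inv_eq[OF inj, of q] q by simp
  qed
  moreover have "times_diff_on n (N0 \<inter> W) f" for n using times_diff_on_subset[OF N0(3)] by simp
  ultimately have "represents_on S c d F p (N0 \<inter> W) f"
    using N0(1,2) W(1,2) by (simp add: represents_on_def open_Int)
  then show thesis by (rule that)
qed

lemma represents_on_has_derivative:
  assumes "represents_on S c d F p W f"
  shows "(f has_derivative frechet_derivative f (at (snd c p))) (at (snd c p))"
  by (rule smooth_times_diff_derivative[of W]) (use assms in \<open>auto simp: represents_on_def\<close>)

lemma represents_on_differentiable:
  assumes inj: "inj_on (snd c) (fst c)" and R: "represents_on S c d F p W f" and p: "p \<in> S" "p \<in> fst c"
  shows "((snd d \<circ> F \<circ> chart_inv c) has_derivative frechet_derivative f (at (snd c p)))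
    (at (snd c p) within snd c ` (S \<inter> fst c))"
proof -
  obtain e where e: "e > 0" "ball (snd c p) e \<subseteq> W"
    using R openE by (metis represents_on_def)
  have 1: "(f has_derivative frechet_derivative f (at (snd c p))) (at (snd c p) within snd c ` (S \<inter> fst c))"
    by (rule has_derivative_at_withinI[OF represents_on_has_derivative[OF R]])
  show ?thesis
  proof (rule has_derivative_transform_within[OF 1 e(1)])
    show "snd c p \<in> snd c ` (S \<inter> fst c)" using p by blast
    fix x assume x: "x \<in> snd c ` (S \<inter> fst c)" "dist x (snd c p) < e"
    then obtain q where q: "q \<in> S" "q \<in> fst c" "x = snd c q" by auto
    have "x \<in> W" using x(2) e(2) by (auto simp: dist_commute)
    then show "f x = (snd d \<circ> F \<circ> chart_inv c) x"
      using R q chart_inv_eq[OF inj] by (simp add: represents_on_def)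
  qed
qed

lemma represents_on_eventually:
  assumes R: "represents_on S c d F p W f" and v: "chart_velocity c \<gamma> p w" and S: "\<forall>\<^sub>F \<tau> in nhds 0. \<gamma> \<tau> \<in> S"
  shows "\<forall>\<^sub>F \<tau> in nhds 0. F (\<gamma> \<tau>) \<in> fst d \<and> snd d (F (\<gamma> \<tau>)) = f (snd c (\<gamma> \<tau>))"
proof -
  have "\<forall>\<^sub>F \<tau> in nhds 0. snd c (\<gamma> \<tau>) \<in> W"
    using topological_tendstoD[OF chart_velocity_tendsto[OF v]] R by (simp add: represents_on_def)
  moreover have "\<forall>\<^sub>F \<tau> in nhds 0. \<gamma> \<tau> \<in> fst c" using v by (simp add: chart_velocity_def)
  ultimately show ?thesis using S
    by eventually_elim (use R in \<open>simp add: represents_on_def\<close>)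
qed

lemma represents_on_velocity:
  assumes R: "represents_on S c d F p W f" and v: "chart_velocity c \<gamma> p w" and S: "\<forall>\<^sub>F \<tau> in nhds 0. \<gamma> \<tau> \<in> S"
  shows "chart_velocity d (\<lambda>\<tau>. F (\<gamma> \<tau>)) (F p) (frechet_derivative f (at (snd c p)) w)"
proof -
  have p: "\<gamma> 0 = p" using v by (simp add: chart_velocity_def)
  note ev = represents_on_eventually[OF R v S]
  have D: "(f has_derivative frechet_derivative f (at (snd c p))) (at (snd c (\<gamma> 0)))"
    using represents_on_has_derivative[OF R] p by simp
  have "((\<lambda>\<tau>. snd c (\<gamma> \<tau>)) has_derivative (\<lambda>t. t *\<^sub>R w)) (at 0)"
    using v by (simp add: chart_velocity_def has_vector_derivative_def)
  from diff_chain_at[OF this D]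
  have "((\<lambda>\<tau>. f (snd c (\<gamma> \<tau>))) has_derivative (\<lambda>t. frechet_derivative f (at (snd c p)) (t *\<^sub>R w))) (at 0)"
    by (simp add: o_def)
  then have 1: "((\<lambda>\<tau>. f (snd c (\<gamma> \<tau>))) has_vector_derivative frechet_derivative f (at (snd c p)) w) (at 0)"
    using linear_scale[OF has_derivative_linear[OF D]] by (simp add: has_vector_derivative_def)
  have ev2: "\<forall>\<^sub>F \<tau> in nhds 0. f (snd c (\<gamma> \<tau>)) = snd d (F (\<gamma> \<tau>))"
    using ev by eventually_elim simp
  have "((\<lambda>\<tau>. snd d (F (\<gamma> \<tau>))) has_vector_derivative frechet_derivative f (at (snd c p)) w) (at 0)"
    using 1 ev2 eventually_nhds_x_imp_x[OF ev2]
      has_vector_derivative_cong_ev[where x = 0 and S = UNIV and f' = "frechet_derivative f (at (snd c p)) w" and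
        f = "\<lambda>\<tau>. f (snd c (\<gamma> \<tau>))" and g = "\<lambda>\<tau>. snd d (F (\<gamma> \<tau>))"]
    by simp
  moreover have "\<forall>\<^sub>F \<tau> in nhds 0. F (\<gamma> \<tau>) \<in> fst d" using ev by eventually_elim simp
  ultimately show ?thesis using p by (simp add: chart_velocity_def)
qed

lemma chart_at:
  assumes "chart_system M" "p \<in> points M"
  shows chart_at_atlas: "chart_at M p \<in> atlas M" and chart_at_mem: "p \<in> fst (chart_at M p)"
    and inj_chart_at: "inj_on (snd (chart_at M p)) (fst (chart_at M p))"
  using assms by (simp_all add: chart_system_def)

text \<open>\<open>frechet_derivative\<close> is a choice that is meaningful only where a derivative
  exists; this supplies the existence, within the coordinate image of \<open>S\<close>.\<close>

lemma smooth_map_on_differentiable: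
  assumes M: "chart_system M" and N: "chart_system N" and F: "smooth_map_on M S N F" and p: "p \<in> S"
  shows "(snd (chart_at N (F p)) \<circ> F \<circ> chart_inv (chart_at M p))
    differentiable (at (snd (chart_at M p) p) within snd (chart_at M p) ` (S \<inter> fst (chart_at M p)))"
proof -
  have pM: "p \<in> points M" "F p \<in> points N" using F p by (auto simp: smooth_map_on_def)
  obtain W f where "represents_on S (chart_at M p) (chart_at N (F p)) F p W f"
    by (rule smooth_map_on_represents[OF M F _ _ _ _ p])
      (use pM chart_at[OF M] chart_at[OF N] in blast)+
  then show ?thesis
    using represents_on_differentiable[OF inj_chart_at[OF M pM(1)] _ p chart_at_mem[OF M pM(1)]]
    unfolding differentiable_def by (intro exI)
qed

lemma linear_tangent_map_on:
  assumes "chart_system M" "chart_system N" "smooth_map_on M S N F" "p \<in> S"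
  shows "linear (tangent_map_on M S N F p)"
  using smooth_map_on_differentiable[OF assms]
  unfolding tangent_map_on_def Let_def frechet_derivative_works by (rule has_derivative_linear)

text \<open>Whatever derivative is selected in \<open>tangent_map_on\<close>, it is pinned down on
  velocities of curves staying in \<open>S\<close>; tangent maps are computed through this from here
  on.\<close>

lemma velocity_map:
  assumes M: "chart_system M" and N: "chart_system N" and F: "smooth_map_on M S N F" and p: "p \<in> S"
    and v: "velocity M \<gamma> p v" and S: "\<forall>\<^sub>F \<tau> in nhds 0. \<gamma> \<tau> \<in> S"
  shows "velocity N (\<lambda>\<tau>. F (\<gamma> \<tau>)) (F p) (tangent_map_on M S N F p v)"
  unfolding tangent_map_on_def Let_def
proof (rule chart_velocity_image[OF _ v _ _ smooth_map_on_differentiable[OF M N F p]])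
  have pM: "p \<in> points M" "F p \<in> points N" using F p by (auto simp: smooth_map_on_def)
  show "inj_on (snd (chart_at M p)) (fst (chart_at M p))" by (rule inj_chart_at[OF M pM(1)])
  have "\<forall>\<^sub>F \<tau> in nhds 0. \<gamma> \<tau> \<in> fst (chart_at M p)" using v by (simp add: chart_velocity_def)
  with S show "\<forall>\<^sub>F \<tau> in nhds 0. \<gamma> \<tau> \<in> S \<inter> fst (chart_at M p)" by eventually_elim simp
  obtain W f where "represents_on S (chart_at M p) (chart_at N (F p)) F p W f"
    by (rule smooth_map_on_represents[OF M F _ _ _ _ p])
      (use pM chart_at[OF M] chart_at[OF N] in blast)+
  from represents_on_eventually[OF this v S]
  show "\<forall>\<^sub>F \<tau> in nhds 0. F (\<gamma> \<tau>) \<in> fst (chart_at N (F p))" by eventually_elim simp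
qed simp

section \<open>Realising tangent vectors as velocities\<close>

lemma compatible_charts: "smooth_manifold M \<Longrightarrow> c \<in> atlas M \<Longrightarrow> d \<in> atlas M \<Longrightarrow> compatible c d"
  by (simp add: smooth_manifold_def)

lemma inj_chart: "smooth_manifold M \<Longrightarrow> c \<in> atlas M \<Longrightarrow> inj_on (snd c) (fst c)"
  by (simp add: smooth_manifold_def)

lemma subspace_chart_space: "subspace (chart_space c)"
  by (simp add: chart_space_def)

lemma subspace_tangent_space: "subspace (tangent_space M p)"
  by (simp add: tangent_space_def chart_space_def)

lemma openin_chart_space:
  assumes "smooth_manifold M" "c \<in> atlas M"
  obtains W where "open W" "snd c ` fst c = chart_space c \<inter> W"
proof -
  have "openin (top_of_set (chart_space c)) (snd c ` fst c)"
    using compatible_charts[OF assms assms(2)] by (simp add: compatible_def)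
  then show thesis unfolding openin_open by (elim exE conjE) (rule that)
qed

text \<open>The image of a chart is open only relative to \<open>chart_space c\<close>, so a
  coordinate curve has to remain in that subspace before continuity puts it into the image.\<close>

lemma chart_velocity_of_coordinates:
  assumes M: "smooth_manifold M" and c: "c \<in> atlas M" "p \<in> fst c"
    and y: "y 0 = snd c p" "(y has_vector_derivative w) (at 0)" "\<forall>\<^sub>F \<tau> in nhds 0. y \<tau> \<in> chart_space c"
  shows "chart_velocity c (\<lambda>\<tau>. chart_inv c (y \<tau>)) p w"
    and "\<forall>\<^sub>F \<tau> in nhds 0. chart_inv c (y \<tau>) \<in> fst c \<and> snd c (chart_inv c (y \<tau>)) = y \<tau>"
proof -
  obtain W where W: "open W" "snd c ` fst c = chart_space c \<inter> W" by (rule openin_chart_space[OF M c(1)])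
  have "snd c p \<in> W" using W(2) c(2) by blast
  have "(y \<longlongrightarrow> y 0) (nhds 0)"
    using has_vector_derivative_continuous[OF y(2)] tendsto_at_iff_tendsto_nhds[of y 0] by (simp add: continuous_within)
  then have "\<forall>\<^sub>F \<tau> in nhds 0. y \<tau> \<in> W" using topological_tendstoD W(1) \<open>snd c p \<in> W\<close> y(1) by metis
  with y(3) have "\<forall>\<^sub>F \<tau> in nhds 0. y \<tau> \<in> snd c ` fst c" by eventually_elim (simp add: W(2))
  then show ev: "\<forall>\<^sub>F \<tau> in nhds 0. chart_inv c (y \<tau>) \<in> fst c \<and> snd c (chart_inv c (y \<tau>)) = y \<tau>"
    by eventually_elim (simp add: chart_inv_def inv_into_into f_inv_into_f)
  have ev2: "\<forall>\<^sub>F \<tau> in nhds 0. y \<tau> = snd c (chart_inv c (y \<tau>))" using ev by eventually_elim simp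
  have "((\<lambda>\<tau>. snd c (chart_inv c (y \<tau>))) has_vector_derivative w) (at 0)"
    using y(2) ev2 eventually_nhds_x_imp_x[OF ev2]
      has_vector_derivative_cong_ev[where x = 0 and S = UNIV and f' = w and
        f = y and g = "\<lambda>\<tau>. snd c (chart_inv c (y \<tau>))"]
    by simp
  moreover have "\<forall>\<^sub>F \<tau> in nhds 0. chart_inv c (y \<tau>) \<in> fst c" using ev by eventually_elim simp
  ultimately show "chart_velocity c (\<lambda>\<tau>. chart_inv c (y \<tau>)) p w"
    using y(1) chart_inv_eq[OF inj_chart[OF M c(1)] c(2)] by (simp add: chart_velocity_def)
qed

lemma ex_chart_velocity:
  assumes M: "smooth_manifold M" and c: "c \<in> atlas M" "p \<in> fst c" and w: "w \<in> chart_space c"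
  obtains \<gamma> where "chart_velocity c \<gamma> p w"
proof -
  have p: "snd c p \<in> chart_space c" using c(2) by (simp add: chart_space_def span_base)
  have "((\<lambda>\<tau>. snd c p + \<tau> *\<^sub>R w) has_vector_derivative w) (at 0)"
    by (auto intro!: derivative_eq_intros)
  moreover have "\<forall>\<^sub>F \<tau> in nhds 0. snd c p + \<tau> *\<^sub>R w \<in> chart_space c"
    using p w by (simp add: subspace_add subspace_scale subspace_chart_space)
  ultimately show thesis
    using chart_velocity_of_coordinates(1)[OF M c, of "\<lambda>\<tau>. snd c p + \<tau> *\<^sub>R w" w] that by simp
qed

lemma ex_velocity:
  assumes M: "smooth_manifold M" and p: "p \<in> points M" and v: "v \<in> tangent_space M p"
  obtains \<gamma> where "velocity M \<gamma> p v" "\<forall>\<^sub>F \<tau> in nhds 0. \<gamma> \<tau> \<in> points M"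
proof -
  note cs = smooth_manifold_imp_chart_system[OF M]
  obtain \<gamma> where g: "velocity M \<gamma> p v"
    by (rule ex_chart_velocity[OF M chart_at_atlas[OF cs p] chart_at_mem[OF cs p]])
      (use v in \<open>auto simp: tangent_space_def\<close>)
  show thesis
    by (rule that[OF g chart_velocity_eventually_in[OF cs chart_at_atlas[OF cs p] g openin_points p]])
qed

lemma velocity_in_tangent_space: "velocity M \<gamma> p v \<Longrightarrow> v \<in> tangent_space M p"
  unfolding tangent_space_def by (rule chart_velocity_in_space)

lemma tangent_map_in:
  assumes M: "smooth_manifold M" and N: "smooth_manifold N" and F: "smooth_map M N F" and p: "p \<in> points M"
    and v: "v \<in> tangent_space M p"
  shows "tangent_map M N F p v \<in> tangent_space N (F p)"
proof -
  obtain \<gamma> where g: "velocity M \<gamma> p v" "\<forall>\<^sub>F \<tau> in nhds 0. \<gamma> \<tau> \<in> points M" by (rule ex_velocity[OF M p v])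
  from velocity_map[OF smooth_manifold_imp_chart_system[OF M] smooth_manifold_imp_chart_system[OF N] F p g]
  show ?thesis by (rule velocity_in_tangent_space)
qed

subsection \<open>Coordinate changes\<close>

lemma coord_change_differentiable:
  assumes M: "smooth_manifold M" and c: "c \<in> atlas M" "p \<in> fst c" and d: "d \<in> atlas M" "p \<in> fst d"
  shows "(snd d \<circ> chart_inv c) differentiable (at (snd c p) within snd c ` (fst c \<inter> fst d))"
proof -
  have "smooth_on (snd c ` (fst c \<inter> fst d)) (snd d \<circ> chart_inv c)"
    using compatible_charts[OF M c(1) d(1)] by (simp add: compatible_def)
  from smooth_on_ex[OF this, of "snd c p"] c d
  obtain N0 f where N0: "open N0" "snd c p \<in> N0" "\<And>n. times_diff_on n N0 f"
      "\<And>y. y \<in> snd c ` (fst c \<inter> fst d) \<Longrightarrow> y \<in> N0 \<Longrightarrow> (snd d \<circ> chart_inv c) y = f y"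
    by blast
  obtain e where e: "e > 0" "ball (snd c p) e \<subseteq> N0" by (rule openE[OF N0(1,2)])
  have D: "(f has_derivative frechet_derivative f (at (snd c p))) (at (snd c p) within snd c ` (fst c \<inter> fst d))"
    by (rule has_derivative_at_withinI[OF smooth_times_diff_derivative[OF N0(3,2)]])
  have "((snd d \<circ> chart_inv c) has_derivative frechet_derivative f (at (snd c p))) (at (snd c p) within snd c ` (fst c \<inter> fst d))"
  proof (rule has_derivative_transform_within[OF D e(1)])
    show "snd c p \<in> snd c ` (fst c \<inter> fst d)" using c d by blast
    fix x assume "x \<in> snd c ` (fst c \<inter> fst d)" "dist x (snd c p) < e"
    then show "f x = (snd d \<circ> chart_inv c) x" using N0(4)[of x] e(2) by (simp add: dist_commute subset_iff)
  qed
  then show ?thesis by (rule differentiableI)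
qed

lemma linear_coord_change:
  assumes "smooth_manifold M" "c \<in> atlas M" "p \<in> fst c" "d \<in> atlas M" "p \<in> fst d"
  shows "linear (coord_change c d p)"
  using coord_change_differentiable[OF assms]
  unfolding coord_change_def frechet_derivative_works by (rule has_derivative_linear)

lemma chart_velocity_change:
  assumes M: "smooth_manifold M" and c: "c \<in> atlas M" and d: "d \<in> atlas M" "p \<in> fst d"
    and v: "chart_velocity c \<gamma> p w"
  shows "chart_velocity d \<gamma> p (coord_change c d p w)"
proof -
  have p: "p \<in> fst c" by (rule chart_velocity_mem[OF v])
  have ev: "\<forall>\<^sub>F \<tau> in nhds 0. \<gamma> \<tau> \<in> fst d"
    by (rule chart_velocity_eventually_in[OF smooth_manifold_imp_chart_system[OF M] c v openin_chart[OF d(1)] d(2)])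
  have "\<forall>\<^sub>F \<tau> in nhds 0. \<gamma> \<tau> \<in> fst c" using v by (simp add: chart_velocity_def)
  with ev have ev2: "\<forall>\<^sub>F \<tau> in nhds 0. \<gamma> \<tau> \<in> fst c \<inter> fst d" by eventually_elim simp
  have "(snd d \<circ> (\<lambda>q. q) \<circ> chart_inv c) differentiable (at (snd c p) within snd c ` (fst c \<inter> fst d))"
    using coord_change_differentiable[OF M c p d] by (simp add: o_def)
  from chart_velocity_image[OF inj_chart[OF M c] v _ ev2 this ev]
  show ?thesis by (simp add: coord_change_def o_def)
qed

lemma coord_change_in:
  assumes M: "smooth_manifold M" and c: "c \<in> atlas M" "p \<in> fst c" and d: "d \<in> atlas M" "p \<in> fst d"
    and w: "w \<in> chart_space c"
  shows "coord_change c d p w \<in> chart_space d"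
proof -
  obtain \<gamma> where "chart_velocity c \<gamma> p w" by (rule ex_chart_velocity[OF M c w])
  from chart_velocity_change[OF M c(1) d this] show ?thesis by (rule chart_velocity_in_space)
qed

text \<open>Both sides are the velocity of one curve, read in \<open>c\<close>.\<close>

lemma coord_change_inverse:
  assumes M: "smooth_manifold M" and c: "c \<in> atlas M" "p \<in> fst c" and d: "d \<in> atlas M" "p \<in> fst d"
    and w: "w \<in> chart_space c"
  shows "coord_change d c p (coord_change c d p w) = w"
proof -
  obtain \<gamma> where g: "chart_velocity c \<gamma> p w" by (rule ex_chart_velocity[OF M c w])
  show ?thesis
    by (rule chart_velocity_unique[OF chart_velocity_change[OF M d(1) c chart_velocity_change[OF M c(1) d g]] g]) simp
qed

text \<open>A common curve compares the tangent map, taken in preferred charts, with the derivative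
  of one smooth extension in fixed charts. Since the latter depends smoothly on the point, so do
  tangent maps applied to smooth sections.\<close>

lemma tangent_map_in_charts:
  assumes M: "smooth_manifold M" and N: "smooth_manifold N" and F: "smooth_map M N F" and p: "p \<in> points M"
    and c: "c \<in> atlas M" "p \<in> fst c" and d: "d \<in> atlas N" "F p \<in> fst d"
    and R: "represents_on (points M) c d F p W f" and v: "v \<in> tangent_space M p"
  shows "coord_change (chart_at N (F p)) d (F p) (tangent_map M N F p v) =
    frechet_derivative f (at (snd c p)) (coord_change (chart_at M p) c p v)"
proof -
  note csM = smooth_manifold_imp_chart_system[OF M] and csN = smooth_manifold_imp_chart_system[OF N]
  have Fp: "F p \<in> points N" using F p by (auto simp: smooth_map_on_def)
  obtain \<gamma> where g: "velocity M \<gamma> p v" "\<forall>\<^sub>F \<tau> in nhds 0. \<gamma> \<tau> \<in> points M" by (rule ex_velocity[OF M p v])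
  have "chart_velocity c \<gamma> p (coord_change (chart_at M p) c p v)"
    by (rule chart_velocity_change[OF M chart_at_atlas[OF csM p] c g(1)])
  from represents_on_velocity[OF R this g(2)]
  have 1: "chart_velocity d (\<lambda>\<tau>. F (\<gamma> \<tau>)) (F p) (frechet_derivative f (at (snd c p)) (coord_change (chart_at M p) c p v))" .
  have 2: "chart_velocity d (\<lambda>\<tau>. F (\<gamma> \<tau>)) (F p) (coord_change (chart_at N (F p)) d (F p) (tangent_map M N F p v))"
    by (rule chart_velocity_change[OF N chart_at_atlas[OF csN Fp] d velocity_map[OF csM csN F p g]])
  show ?thesis by (rule chart_velocity_unique[OF 2 1]) simp
qed

section \<open>Lifting curves through submersions\<close>

text \<open>
  The map \<open>y \<mapsto> y + R (f y - A y)\<close>, where \<open>R\<close> is a right inverse of the derivative \<open>A\<close> of \<open>f\<close> at \<open>x\<close>,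
  has derivative \<open>id\<close> at \<open>x\<close> and preserves the space in which \<open>R\<close> takes its values.
\<close>

lemma straightening_inverse:
  fixes f :: "'e::euclidean_space \<Rightarrow> 'f::euclidean_space"
  assumes W: "open W" "x \<in> W" and f: "\<And>n. times_diff_on n W f" and R: "linear R"
  defines "A \<equiv> frechet_derivative f (at x)"
  defines "\<Psi> \<equiv> \<lambda>y. y + R (f y - A y)"
  obtains V g where "open V" "\<Psi> x \<in> V" "\<And>z. z \<in> V \<Longrightarrow> g z \<in> W" "\<And>z. z \<in> V \<Longrightarrow> \<Psi> (g z) = z"
    "g (\<Psi> x) = x" "(g has_derivative (\<lambda>h. h)) (at (\<Psi> x))"
proof -
  have fd: "(f has_derivative frechet_derivative f (at y)) (at y)" if "y \<in> W" for y
    by (rule smooth_times_diff_derivative[OF f that])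
  have A: "(f has_derivative A) (at x)" "bounded_linear A"
    unfolding A_def using fd[OF W(2)] has_derivative_bounded_linear by blast+
  have bR: "bounded_linear R" using R linear_conv_bounded_linear by blast
  define \<Psi>' where "\<Psi>' y = (\<lambda>h. h + R (frechet_derivative f (at y) h - A h))" for y
  have d: "(\<Psi> has_derivative \<Psi>' y) (at y)" if "y \<in> W" for y
    unfolding \<Psi>_def \<Psi>'_def
    by (intro has_derivative_add has_derivative_ident bounded_linear.has_derivative[OF bR]
        has_derivative_diff fd[OF that] bounded_linear_imp_has_derivative A)
  have bl: "blinfun_apply (Blinfun (\<Psi>' y)) = \<Psi>' y" if "y \<in> W" for y
    using has_derivative_bounded_linear[OF d[OF that]] by (rule bounded_linear_Blinfun_apply)
  have d': "(\<Psi> has_derivative blinfun_apply (Blinfun (\<Psi>' y))) (at y)" if "y \<in> W" for y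
    using d[OF that] bl[OF that] by simp
  \<comment> \<open>The inverse function theorem wants the derivative continuous in the operator
    norm; in finite dimension each basis direction can be checked separately.\<close>
  have cont: "continuous_on W (\<lambda>y. Blinfun (\<Psi>' y))"
  proof (rule continuous_on_blinfun_componentwise)
    fix i :: 'e
    have "continuous_on W (\<lambda>y. frechet_derivative f (at y) i)"
      using f[of 1] by simp
    then have "continuous_on W (\<lambda>y. \<Psi>' y i)"
      unfolding \<Psi>'_def by (intro continuous_intros bounded_linear.continuous_on[OF bR])
    then show "continuous_on W (\<lambda>y. blinfun_apply (Blinfun (\<Psi>' y)) i)"
      by (rule continuous_on_eq) (simp add: bl)
  qed
  have \<Psi>'x: "\<Psi>' x = (\<lambda>h. h)" using linear_0[OF R] by (simp add: \<Psi>'_def A_def)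
  have blx: "blinfun_apply (Blinfun (\<Psi>' x)) = (\<lambda>h. h)" using bl[OF W(2)] unfolding \<Psi>'x .
  have inv: "id_blinfun o\<^sub>L Blinfun (\<Psi>' x) = id_blinfun"
    by (rule blinfun_eqI) (simp add: blx)
  obtain U' V g g' where g: "open U'" "U' \<subseteq> W" "x \<in> U'" "open V" "\<Psi> x \<in> V" "homeomorphism U' V \<Psi> g"
    "\<And>y. y \<in> V \<Longrightarrow> (g has_derivative (g' y)) (at y)"
    "\<And>y. y \<in> V \<Longrightarrow> g' y = inv (blinfun_apply (Blinfun (\<Psi>' (g y))))"
    by (rule inverse_function_theorem[OF W(1) d' cont W(2) inv]) (assumption, rule that)
  have gx: "g (\<Psi> x) = x" using g(3,6) by (simp add: homeomorphism_def)
  have "g' (\<Psi> x) = inv (\<lambda>h. h)" using g(8)[OF g(5)] by (simp add: gx blx)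
  also have "\<dots> = (\<lambda>h. h)" using inv_id by (simp add: id_def)
  finally have g'x: "g' (\<Psi> x) = (\<lambda>h. h)" .
  show thesis
  proof (rule that[of V g])
    show "open V" "\<Psi> x \<in> V" "g (\<Psi> x) = x" by (fact g(4) g(5) gx)+
    show "g z \<in> W" if "z \<in> V" for z using g(2,6) that by (auto simp: homeomorphism_def)
    show "\<Psi> (g z) = z" if "z \<in> V" for z using g(6) that by (simp add: homeomorphism_def)
    show "(g has_derivative (\<lambda>h. h)) (at (\<Psi> x))" using g(7)[OF g(5)] g'x by simp
  qed
qed

text \<open>In straightened coordinates \<open>F\<close> is linear:
  \<open>A (\<Psi> y) = f y\<close> on the tangent space. A lift is therefore found by solving a
  linear equation and pulling back along the local inverse \<open>g\<close>.\<close>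

lemma submersion_lift:
  assumes M: "smooth_manifold M" and N: "smooth_manifold N" and F: "smooth_map M N F" and p: "p \<in> points M"
    and surj: "tangent_map M N F p ` tangent_space M p = tangent_space N (F p)"
    and v: "v \<in> tangent_space M p" and \<delta>: "velocity N \<delta> (F p) (tangent_map M N F p v)"
  obtains \<gamma> where "velocity M \<gamma> p v" "\<forall>\<^sub>F \<tau> in nhds 0. \<gamma> \<tau> \<in> points M" "\<forall>\<^sub>F \<tau> in nhds 0. F (\<gamma> \<tau>) = \<delta> \<tau>"
proof -
  note csM = smooth_manifold_imp_chart_system[OF M] and csN = smooth_manifold_imp_chart_system[OF N]
  have Fp: "F p \<in> points N" using F p by (auto simp: smooth_map_on_def)
  let ?c = "chart_at M p" and ?d = "chart_at N (F p)"
  note c = chart_at_atlas[OF csM p] chart_at_mem[OF csM p]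
  note d = chart_at_atlas[OF csN Fp] chart_at_mem[OF csN Fp]
  let ?x = "snd ?c p" and ?V = "tangent_space M p" and ?T = "tangent_map M N F p"
  obtain W f where Rep: "represents_on (points M) ?c ?d F p W f"
    by (rule smooth_map_on_represents[OF csM F c d p])
  have W: "open W" "?x \<in> W" and f: "\<And>n. times_diff_on n W f" using Rep by (auto simp: represents_on_def)
  have frep: "F q \<in> fst ?d \<and> snd ?d (F q) = f (snd ?c q)" if "q \<in> points M" "q \<in> fst ?c" "snd ?c q \<in> W" for q
    using Rep that by (simp add: represents_on_def)
  define A where "A = frechet_derivative f (at ?x)"
  have A: "linear A" unfolding A_def by (rule has_derivative_linear[OF represents_on_has_derivative[OF Rep]])
  \<comment> \<open>\<open>A\<close> is the derivative of the ambient extension, \<open>?T\<close>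
    the one chosen within the chart image; they are compared only on tangent vectors, where curves
    determine both.\<close>
  have AT: "A u = ?T u" if u: "u \<in> ?V" for u
  proof -
    obtain \<gamma> where g: "velocity M \<gamma> p u" "\<forall>\<^sub>F \<tau> in nhds 0. \<gamma> \<tau> \<in> points M" by (rule ex_velocity[OF M p u])
    show ?thesis unfolding A_def
      by (rule chart_velocity_unique[OF represents_on_velocity[OF Rep g] velocity_map[OF csM csN F p g]]) simp
  qed
  have AV: "A ` ?V = tangent_space N (F p)" using AT surj by (simp cong: image_cong)
  note V = subspace_tangent_space[of M p] and V' = subspace_tangent_space[of N "F p"]
  obtain R where R: "range R \<subseteq> ?V" "linear R" "\<And>u. u \<in> A ` ?V \<Longrightarrow> A (R u) = u"
    using linear_exists_right_inverse_on[OF A V] by blast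
  have RV: "R u \<in> ?V" for u using R(1) by blast
  define \<Psi> where "\<Psi> y = y + R (f y - A y)" for y
  obtain V0 g where g: "open V0" "\<Psi> ?x \<in> V0" "\<And>z. z \<in> V0 \<Longrightarrow> g z \<in> W" "\<And>z. z \<in> V0 \<Longrightarrow> \<Psi> (g z) = z"
    "g (\<Psi> ?x) = ?x" "(g has_derivative (\<lambda>h. h)) (at (\<Psi> ?x))"
    by (rule straightening_inverse[OF W f R(2), folded A_def, folded \<Psi>_def]) (rule that)
  have xV: "?x \<in> ?V" using c(2) by (simp add: tangent_space_def chart_space_def span_base)
  have dV': "snd ?d q \<in> tangent_space N (F p)" if "q \<in> fst ?d" for q
    using that by (simp add: tangent_space_def chart_space_def span_base)
  have A\<Psi>: "A (\<Psi> y) = f y" if "y \<in> ?V" "f y \<in> tangent_space N (F p)" for y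
  proof -
    have "f y - A y \<in> A ` ?V" using that AV subspace_diff[OF V'] by blast
    then show ?thesis using R(3) by (simp add: \<Psi>_def linear_add[OF A])
  qed
  \<comment> \<open>The deviation of \<delta> from its linear approximation. Its derivative at 0
    vanishes, so adding \<open>R (?u \<tau>)\<close> makes the image follow \<delta> exactly without
    changing the velocity \<open>v\<close>.\<close>
  let ?u = "\<lambda>\<tau>. snd ?d (\<delta> \<tau>) - snd ?d (F p) - \<tau> *\<^sub>R A v"
  define z where "z \<tau> = \<Psi> ?x + \<tau> *\<^sub>R v + R (?u \<tau>)" for \<tau>
  define y where "y \<tau> = g (z \<tau>)" for \<tau>
  have \<delta>0: "\<delta> 0 = F p" using \<delta> by (simp add: chart_velocity_def)
  have z0: "z 0 = \<Psi> ?x" by (simp add: z_def \<delta>0 linear_0[OF R(2)])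
  have bR: "bounded_linear R" using R(2) linear_conv_bounded_linear by blast
  have "((\<lambda>\<tau>. snd ?d (\<delta> \<tau>)) has_vector_derivative A v) (at 0)"
    using \<delta> AT[OF v] by (simp add: chart_velocity_def)
  then have "(?u has_vector_derivative (A v - 0 - 1 *\<^sub>R A v)) (at 0)"
    by (intro has_vector_derivative_diff has_vector_derivative_const) (auto intro!: derivative_eq_intros)
  then have "((\<lambda>\<tau>. R (?u \<tau>)) has_vector_derivative R 0) (at 0)"
    using bounded_linear.has_vector_derivative[OF bR] by fastforce
  then have "(z has_vector_derivative (0 + 1 *\<^sub>R v + R 0)) (at 0)"
    unfolding z_def by (intro has_vector_derivative_add has_vector_derivative_const) (auto intro!: derivative_eq_intros)
  then have dz: "(z has_vector_derivative v) (at 0)" by (simp add: linear_0[OF R(2)])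
  have dy: "(y has_vector_derivative v) (at 0)"
  proof -
    have "((g \<circ> z) has_derivative ((\<lambda>h. h) \<circ> (\<lambda>t. t *\<^sub>R v))) (at 0)"
      using dz g(6) z0 by (intro diff_chain_at) (simp_all add: has_vector_derivative_def)
    then show ?thesis unfolding has_vector_derivative_def y_def[abs_def] by (simp add: o_def)
  qed
  have y0: "y 0 = ?x" by (simp add: y_def z0 g(5))
  have "(z \<longlongrightarrow> z 0) (nhds 0)"
    using has_vector_derivative_continuous[OF dz] tendsto_at_iff_tendsto_nhds[of z 0] by (simp add: continuous_within)
  then have evz: "\<forall>\<^sub>F \<tau> in nhds 0. z \<tau> \<in> V0" using topological_tendstoD[OF _ g(1)] g(2) z0 by simp
  \<comment> \<open>\<open>g\<close> inverts \<Psi> in the ambient space and might leave the chart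
    space; solving \<open>\<Psi> (y \<tau>) = z \<tau>\<close> for \<open>y \<tau>\<close> shows
    that it does not, since \<open>R\<close> takes values in the tangent space.\<close>
  have yV: "y \<tau> \<in> ?V" if "z \<tau> \<in> V0" for \<tau>
  proof -
    have "y \<tau> = z \<tau> - R (f (y \<tau>) - A (y \<tau>))" using g(4)[OF that] by (simp add: \<Psi>_def y_def algebra_simps)
    also have "\<dots> \<in> ?V"
      unfolding z_def \<Psi>_def using xV v RV by (intro subspace_diff[OF V] subspace_add[OF V] subspace_scale[OF V])
    finally show ?thesis .
  qed
  have evV: "\<forall>\<^sub>F \<tau> in nhds 0. y \<tau> \<in> chart_space ?c"
    using evz by eventually_elim (use yV in \<open>simp add: tangent_space_def\<close>)
  note vel = chart_velocity_of_coordinates[OF M c y0 dy evV]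
  show thesis
  proof (rule that[OF vel(1)])
    show pts: "\<forall>\<^sub>F \<tau> in nhds 0. chart_inv ?c (y \<tau>) \<in> points M"
      by (rule chart_velocity_eventually_in[OF csM c(1) vel(1) openin_points p])
    have evd: "\<forall>\<^sub>F \<tau> in nhds 0. \<delta> \<tau> \<in> fst ?d" using \<delta> by (simp add: chart_velocity_def)
    show "\<forall>\<^sub>F \<tau> in nhds 0. F (chart_inv ?c (y \<tau>)) = \<delta> \<tau>"
      using pts evd evz vel(2)
    proof eventually_elim
      case (elim \<tau>)
      let ?q = "chart_inv ?c (y \<tau>)"
      have q: "F ?q \<in> fst ?d" "snd ?d (F ?q) = f (y \<tau>)"
        using frep[of ?q] elim g(3)[of "z \<tau>"] by (auto simp: y_def)
      have "f (y \<tau>) = A (\<Psi> (y \<tau>))" using A\<Psi>[OF yV[OF elim(3)]] q dV' by metis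
      also have "\<dots> = A (z \<tau>)" using g(4)[OF elim(3)] by (simp add: y_def)
      also have "\<dots> = A (\<Psi> ?x) + \<tau> *\<^sub>R A v + A (R (?u \<tau>))"
        by (simp add: z_def linear_add[OF A] linear_scale[OF A])
      also have "A (R (?u \<tau>)) = ?u \<tau>"
      proof (rule R(3))
        have "A v \<in> tangent_space N (F p)" using v AV by blast
        then have "?u \<tau> \<in> tangent_space N (F p)"
          using elim(2) d(2) by (intro subspace_diff[OF V'] subspace_scale[OF V'] dV')
        then show "?u \<tau> \<in> A ` ?V" using AV by simp
      qed
      also have "A (\<Psi> ?x) = snd ?d (F p)"
        using A\<Psi>[OF xV] frep[OF p c(2) W(2)] dV'[OF d(2)] by simp
      finally have "snd ?d (F ?q) = snd ?d (\<delta> \<tau>)" using q(2) by simp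
      then show ?case using inj_onD[OF inj_chart_at[OF csN Fp] _ q(1) elim(2)] by simp
    qed
  qed
qed

subsection \<open>Products\<close>

lemma fst_prod_chart: "fst (prod_chart c d) = fst c \<times> fst d"
  by (simp add: prod_chart_def)

lemma atlas_prod_manifold:
  "a \<in> atlas (prod_manifold M N) \<longleftrightarrow> (\<exists>c\<in>atlas M. \<exists>d\<in>atlas N. a = prod_chart c d)"
  unfolding prod_manifold_def by (simp del: split_paired_Ex) blast

lemma points_prod_manifold: "points (prod_manifold M N) = points M \<times> points N"
proof (intro set_eqI iffI)
  fix z assume "z \<in> points (prod_manifold M N)"
  then obtain a where a: "a \<in> atlas (prod_manifold M N)" "z \<in> fst a" unfolding points_def by (elim UN_E)
  then obtain c d where "c \<in> atlas M" "d \<in> atlas N" "z \<in> fst c \<times> fst d"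
    unfolding atlas_prod_manifold using fst_prod_chart by fast
  then show "z \<in> points M \<times> points N" unfolding points_def by (elim SigmaE) auto
next
  fix z assume "z \<in> points M \<times> points N"
  then obtain c d where c: "c \<in> atlas M" "d \<in> atlas N" "z \<in> fst (prod_chart c d)"
    unfolding points_def fst_prod_chart by (elim SigmaE UN_E) simp
  then have "prod_chart c d \<in> atlas (prod_manifold M N)" unfolding atlas_prod_manifold by blast
  then show "z \<in> points (prod_manifold M N)" unfolding points_def using c(3) by (rule UN_I)
qed

lemma chart_at_prod_manifold: "chart_at (prod_manifold M N) (p, q) = prod_chart (chart_at M p) (chart_at N q)"
  by (simp add: prod_manifold_def)

lemma chart_system_prod:
  assumes M: "chart_system M" and N: "chart_system N"
  shows "chart_system (prod_manifold M N)"
proof -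
  have inj: "inj_on (snd (prod_chart c d)) (fst (prod_chart c d))" if "c \<in> atlas M" "d \<in> atlas N" for c d
    using M N that by (simp add: chart_system_def prod_chart_def map_prod_inj_on)
  have im: "snd (prod_chart c d) ` (A \<times> B) = (snd c ` A) \<times> (snd d ` B)" for c d A B
    by (auto simp: prod_chart_def image_iff)
  have trans: "openin (top_of_set (snd (prod_chart c d) ` fst (prod_chart c d)))
          (snd (prod_chart c d) ` (fst (prod_chart c d) \<inter> fst (prod_chart c' d'))) \<and>
        continuous_on (snd (prod_chart c d) ` (fst (prod_chart c d) \<inter> fst (prod_chart c' d')))
          (snd (prod_chart c' d') \<circ> chart_inv (prod_chart c d))"
    if c: "c \<in> atlas M" "c' \<in> atlas M" and d: "d \<in> atlas N" "d' \<in> atlas N" for c c' d d'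
  proof
    have int: "fst (prod_chart c d) \<inter> fst (prod_chart c' d') = (fst c \<inter> fst c') \<times> (fst d \<inter> fst d')"
      by (auto simp: prod_chart_def)
    have cM: "openin (top_of_set (snd c ` fst c)) (snd c ` (fst c \<inter> fst c'))"
      "continuous_on (snd c ` (fst c \<inter> fst c')) (snd c' \<circ> chart_inv c)"
      using M c by (simp_all add: chart_system_def)
    have dN: "openin (top_of_set (snd d ` fst d)) (snd d ` (fst d \<inter> fst d'))"
      "continuous_on (snd d ` (fst d \<inter> fst d')) (snd d' \<circ> chart_inv d)"
      using N d by (simp_all add: chart_system_def)
    show "openin (top_of_set (snd (prod_chart c d) ` fst (prod_chart c d)))
          (snd (prod_chart c d) ` (fst (prod_chart c d) \<inter> fst (prod_chart c' d')))"
      unfolding int unfolding fst_prod_chart im by (rule openin_Times[OF cM(1) dN(1)])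
    have "continuous_on ((snd c ` (fst c \<inter> fst c')) \<times> (snd d ` (fst d \<inter> fst d')))
      (\<lambda>z. ((snd c' \<circ> chart_inv c) (fst z), (snd d' \<circ> chart_inv d) (snd z)))"
      by (intro continuous_on_Pair continuous_on_compose2[OF cM(2)] continuous_on_compose2[OF dN(2)]
          continuous_on_fst continuous_on_snd continuous_on_id) auto
    then show "continuous_on (snd (prod_chart c d) ` (fst (prod_chart c d) \<inter> fst (prod_chart c' d')))
          (snd (prod_chart c' d') \<circ> chart_inv (prod_chart c d))"
      unfolding int im
    proof (rule continuous_on_eq)
      fix z assume "z \<in> (snd c ` (fst c \<inter> fst c')) \<times> (snd d ` (fst d \<inter> fst d'))"
      then obtain a b where ab: "a \<in> fst c" "b \<in> fst d" "z = (snd c a, snd d b)" by auto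
      have "chart_inv (prod_chart c d) (snd (prod_chart c d) (a, b)) = (a, b)"
        by (rule chart_inv_eq[OF inj[OF c(1) d(1)]]) (simp add: prod_chart_def ab)
      then have "chart_inv (prod_chart c d) z = (a, b)" by (simp add: prod_chart_def ab)
      moreover have "chart_inv c (snd c a) = a" "chart_inv d (snd d b) = b"
        using M N c d ab by (simp_all add: chart_inv_eq chart_system_def)
      ultimately show "((snd c' \<circ> chart_inv c) (fst z), (snd d' \<circ> chart_inv d) (snd z)) =
          (snd (prod_chart c' d') \<circ> chart_inv (prod_chart c d)) z"
        by (simp add: ab(3) prod_chart_def)
    qed
  qed
  have tr: "openin (top_of_set (snd a ` fst a)) (snd a ` (fst a \<inter> fst b)) \<and>
        continuous_on (snd a ` (fst a \<inter> fst b)) (snd b \<circ> chart_inv a)"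
    if ab: "a \<in> atlas (prod_manifold M N)" "b \<in> atlas (prod_manifold M N)" for a b
  proof -
    obtain c d where "a = prod_chart c d" "c \<in> atlas M" "d \<in> atlas N"
      using ab(1) unfolding atlas_prod_manifold by blast
    moreover obtain c' d' where "b = prod_chart c' d'" "c' \<in> atlas M" "d' \<in> atlas N"
      using ab(2) unfolding atlas_prod_manifold by blast
    ultimately show ?thesis using trans[of c c' d d'] by simp
  qed
  have at: "chart_at (prod_manifold M N) z \<in> atlas (prod_manifold M N) \<and> z \<in> fst (chart_at (prod_manifold M N) z)"
    if zz: "z \<in> points (prod_manifold M N)" for z
  proof -
    obtain p q where z: "z = (p, q)" "p \<in> points M" "q \<in> points N"
      using zz by (cases z) (simp add: points_prod_manifold)
    have "prod_chart (chart_at M p) (chart_at N q) \<in> atlas (prod_manifold M N)"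
      unfolding atlas_prod_manifold using chart_at_atlas[OF M z(2)] chart_at_atlas[OF N z(3)] by blast
    then show ?thesis
      using chart_at_mem[OF M z(2)] chart_at_mem[OF N z(3)]
      by (simp add: z(1) chart_at_prod_manifold fst_prod_chart)
  qed
  have "inj_on (snd a) (fst a)" if a: "a \<in> atlas (prod_manifold M N)" for a
  proof -
    obtain c d where "a = prod_chart c d" "c \<in> atlas M" "d \<in> atlas N"
      using a unfolding atlas_prod_manifold by blast
    then show ?thesis using inj by simp
  qed
  with tr at show ?thesis unfolding chart_system_def by simp
qed

lemma velocity_Pair:
  assumes v: "velocity M \<gamma> p v" and w: "velocity N \<gamma>' q w"
  shows "velocity (prod_manifold M N) (\<lambda>\<tau>. (\<gamma> \<tau>, \<gamma>' \<tau>)) (p, q) (v, w)"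
proof -
  have "\<forall>\<^sub>F \<tau> in nhds 0. \<gamma> \<tau> \<in> fst (chart_at M p)" "\<forall>\<^sub>F \<tau> in nhds 0. \<gamma>' \<tau> \<in> fst (chart_at N q)"
    using v w by (simp_all add: chart_velocity_def)
  then have "\<forall>\<^sub>F \<tau> in nhds 0. (\<gamma> \<tau>, \<gamma>' \<tau>) \<in> fst (chart_at M p) \<times> fst (chart_at N q)"
    by eventually_elim simp
  moreover have "((\<lambda>\<tau>. (snd (chart_at M p) (\<gamma> \<tau>), snd (chart_at N q) (\<gamma>' \<tau>))) has_vector_derivative (v, w)) (at 0)"
    using v w by (intro has_vector_derivative_Pair) (simp_all add: chart_velocity_def)
  ultimately show ?thesis using v w
    by (simp add: chart_velocity_def chart_at_prod_manifold prod_chart_def)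
qed

lemma velocity_in_points:
  assumes M: "smooth_manifold M" and p: "p \<in> points M" and v: "velocity M \<gamma> p v"
  shows "\<forall>\<^sub>F \<tau> in nhds 0. \<gamma> \<tau> \<in> points M"
proof -
  note cs = smooth_manifold_imp_chart_system[OF M]
  show ?thesis by (rule chart_velocity_eventually_in[OF cs chart_at_atlas[OF cs p] v openin_points p])
qed

section \<open>Tangent maps of a Lie groupoid\<close>

locale lie_gpd =
  fixes \<Gamma> :: "('g, 'e::euclidean_space, 'p, 'f::euclidean_space) groupoid"
  assumes L: "lie_groupoid \<Gamma>"
begin

abbreviation "G \<equiv> arrows \<Gamma>"
abbreviation "P \<equiv> objects \<Gamma>"
abbreviation "s \<equiv> src \<Gamma>"
abbreviation "t \<equiv> tgt \<Gamma>"
abbreviation "u \<equiv> unit_at \<Gamma>"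
abbreviation "m \<equiv> mult \<Gamma>"

section \<open>Structure maps of the groupoid and their tangent maps\<close>

lemma smooth_arrows: "smooth_manifold G" and smooth_objects: "smooth_manifold P"
  and smooth_src: "smooth_map G P s" and smooth_tgt: "smooth_map G P t"
  and smooth_unit: "smooth_map P G u" and smooth_inverse: "smooth_map G G (inverse_of \<Gamma>)"
  and smooth_mult: "smooth_map_on (prod_manifold G G) (composable \<Gamma>) G (\<lambda>(g, h). m g h)"
  and groupoid_axioms: "algebraic_groupoid \<Gamma>"
  using L by (simp_all add: lie_groupoid_def submersion_def)

lemmas csG = smooth_manifold_imp_chart_system[OF smooth_arrows]
lemmas csP = smooth_manifold_imp_chart_system[OF smooth_objects]

lemma arrow_src: "g \<in> points G \<Longrightarrow> s g \<in> points P"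
  and arrow_tgt: "g \<in> points G \<Longrightarrow> t g \<in> points P"
  and unit_arrow: "p \<in> points P \<Longrightarrow> u p \<in> points G"
  and src_unit: "p \<in> points P \<Longrightarrow> s (u p) = p"
  and tgt_unit: "p \<in> points P \<Longrightarrow> t (u p) = p"
  and mult_unit: "g \<in> points G \<Longrightarrow> m g (u (s g)) = g"
  and unit_mult: "g \<in> points G \<Longrightarrow> m (u (t g)) g = g"
  and ex_inverses: "g \<in> points G \<Longrightarrow> \<exists>h. inverses \<Gamma> g h"
  using groupoid_axioms by (simp_all add: algebraic_groupoid_def)

lemma mult_arrow:
  assumes "g \<in> points G" "h \<in> points G" "s g = t h"
  shows "m g h \<in> points G" and src_mult: "s (m g h) = s h" and tgt_mult: "t (m g h) = t g"
proof -
  have "(g, h) \<in> composable \<Gamma>" using assms by (simp add: composable_def)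
  then have "m g h \<in> points G \<and> s (m g h) = s h \<and> t (m g h) = t g"
    using groupoid_axioms unfolding algebraic_groupoid_def by fast
  then show "m g h \<in> points G" "s (m g h) = s h" "t (m g h) = t g" by blast+
qed

lemma mult_assoc:
  assumes "g \<in> points G" "h \<in> points G" "k \<in> points G" "s g = t h" "s h = t k"
  shows "m (m g h) k = m g (m h k)"
  using groupoid_axioms assms by (simp add: algebraic_groupoid_def composable_def)

lemma inverse_of_inverses:
  assumes g: "g \<in> points G"
  shows "inverses \<Gamma> g (inverse_of \<Gamma> g)"
  unfolding inverse_of_def
proof (rule theI')
  obtain h where h: "inverses \<Gamma> g h" using ex_inverses[OF g] ..
  have "h' = h" if h': "inverses \<Gamma> g h'" for h'
  proof -
    have "h' = m h' (m g h)" using h h' mult_unit[of h'] by (simp add: inverses_def)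
    also have "\<dots> = m (m h' g) h" using h h' g mult_assoc[of h' g h] by (simp add: inverses_def)
    also have "\<dots> = h" using h h' unit_mult[of h] by (simp add: inverses_def)
    finally show ?thesis .
  qed
  with h show "\<exists>!h. inverses \<Gamma> g h" by (rule ex1I)
qed

lemma inverse_arrow:
  assumes g: "g \<in> points G"
  shows "inverse_of \<Gamma> g \<in> points G" and src_inverse: "s (inverse_of \<Gamma> g) = t g"
    and tgt_inverse: "t (inverse_of \<Gamma> g) = s g"
    and mult_inverse: "m g (inverse_of \<Gamma> g) = u (t g)" and inverse_mult: "m (inverse_of \<Gamma> g) g = u (s g)"
  using inverse_of_inverses[OF g] by (simp_all add: inverses_def)

lemma inverse_mult_cancel:
  assumes "g \<in> points G" "h \<in> points G" "s g = t h"
  shows "m (inverse_of \<Gamma> g) (m g h) = h"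
  using assms inverse_arrow[OF assms(1)] unit_mult[OF assms(2)]
    mult_assoc[of "inverse_of \<Gamma> g" g h] by simp

lemma mult_inverse_cancel:
  assumes "g \<in> points G" "h \<in> points G" "t g = t h"
  shows "m g (m (inverse_of \<Gamma> g) h) = h"
  using assms inverse_arrow[OF assms(1)] unit_mult[OF assms(2)]
    mult_assoc[of g "inverse_of \<Gamma> g" h] by simp

lemma linear_tsrc: "g \<in> points G \<Longrightarrow> linear (tsrc \<Gamma> g)"
  and linear_ttgt: "g \<in> points G \<Longrightarrow> linear (ttgt \<Gamma> g)"
  and linear_tunit: "p \<in> points P \<Longrightarrow> linear (tunit \<Gamma> p)"
  unfolding tsrc_def ttgt_def tunit_def
  using linear_tangent_map_on[OF csG csP smooth_src] linear_tangent_map_on[OF csG csP smooth_tgt]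
    linear_tangent_map_on[OF csP csG smooth_unit] by blast+

lemma tsrc_in: "g \<in> points G \<Longrightarrow> v \<in> tangent_space G g \<Longrightarrow> tsrc \<Gamma> g v \<in> tangent_space P (s g)"
  and ttgt_in: "g \<in> points G \<Longrightarrow> v \<in> tangent_space G g \<Longrightarrow> ttgt \<Gamma> g v \<in> tangent_space P (t g)"
  and tunit_in: "p \<in> points P \<Longrightarrow> w \<in> tangent_space P p \<Longrightarrow> tunit \<Gamma> p w \<in> tangent_space G (u p)"
  unfolding tsrc_def ttgt_def tunit_def
  using tangent_map_in[OF smooth_arrows smooth_objects smooth_src] tangent_map_in[OF smooth_arrows smooth_objects smooth_tgt]
    tangent_map_in[OF smooth_objects smooth_arrows smooth_unit] by blast+

lemma surj_tsrc: "g \<in> points G \<Longrightarrow> tsrc \<Gamma> g ` tangent_space G g = tangent_space P (s g)"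
  and surj_ttgt: "g \<in> points G \<Longrightarrow> ttgt \<Gamma> g ` tangent_space G g = tangent_space P (t g)"
  unfolding tsrc_def ttgt_def using L by (simp_all add: lie_groupoid_def submersion_def)

lemma velocity_src:
  assumes "g \<in> points G" "velocity G \<gamma> g v"
  shows "velocity P (\<lambda>\<tau>. s (\<gamma> \<tau>)) (s g) (tsrc \<Gamma> g v)"
  unfolding tsrc_def
  by (rule velocity_map[OF csG csP smooth_src assms velocity_in_points[OF smooth_arrows assms]])

lemma velocity_tgt:
  assumes "g \<in> points G" "velocity G \<gamma> g v"
  shows "velocity P (\<lambda>\<tau>. t (\<gamma> \<tau>)) (t g) (ttgt \<Gamma> g v)"
  unfolding ttgt_def
  by (rule velocity_map[OF csG csP smooth_tgt assms velocity_in_points[OF smooth_arrows assms]])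

lemma velocity_unit:
  assumes "p \<in> points P" "velocity P \<gamma> p v"
  shows "velocity G (\<lambda>\<tau>. u (\<gamma> \<tau>)) (u p) (tunit \<Gamma> p v)"
  unfolding tunit_def
  by (rule velocity_map[OF csP csG smooth_unit assms velocity_in_points[OF smooth_objects assms]])

lemma tsrc_tunit:
  assumes p: "p \<in> points P" and v: "v \<in> tangent_space P p"
  shows "tsrc \<Gamma> (u p) (tunit \<Gamma> p v) = v"
proof -
  obtain \<gamma> where g: "velocity P \<gamma> p v" "\<forall>\<^sub>F \<tau> in nhds 0. \<gamma> \<tau> \<in> points P" by (rule ex_velocity[OF smooth_objects p v])
  have 1: "velocity P (\<lambda>\<tau>. s (u (\<gamma> \<tau>))) p (tsrc \<Gamma> (u p) (tunit \<Gamma> p v))"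
    using velocity_src[OF unit_arrow[OF p] velocity_unit[OF p g(1)]] by (simp add: src_unit[OF p])
  show ?thesis
    by (rule chart_velocity_unique[OF 1 g(1)]) (use g(2) in eventually_elim, simp add: src_unit)
qed

lemma ttgt_tunit:
  assumes p: "p \<in> points P" and v: "v \<in> tangent_space P p"
  shows "ttgt \<Gamma> (u p) (tunit \<Gamma> p v) = v"
proof -
  obtain \<gamma> where g: "velocity P \<gamma> p v" "\<forall>\<^sub>F \<tau> in nhds 0. \<gamma> \<tau> \<in> points P" by (rule ex_velocity[OF smooth_objects p v])
  have 1: "velocity P (\<lambda>\<tau>. t (u (\<gamma> \<tau>))) p (ttgt \<Gamma> (u p) (tunit \<Gamma> p v))"
    using velocity_tgt[OF unit_arrow[OF p] velocity_unit[OF p g(1)]] by (simp add: tgt_unit[OF p])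
  show ?thesis
    by (rule chart_velocity_unique[OF 1 g(1)]) (use g(2) in eventually_elim, simp add: tgt_unit)
qed

lemma lift_src:
  assumes g: "g \<in> points G" and v: "v \<in> tangent_space G g" and \<delta>: "velocity P \<delta> (s g) (tsrc \<Gamma> g v)"
  obtains \<gamma> where "velocity G \<gamma> g v" "\<forall>\<^sub>F \<tau> in nhds 0. \<gamma> \<tau> \<in> points G" "\<forall>\<^sub>F \<tau> in nhds 0. s (\<gamma> \<tau>) = \<delta> \<tau>"
  by (rule submersion_lift[OF smooth_arrows smooth_objects smooth_src g surj_tsrc[OF g, unfolded tsrc_def] v
        \<delta>[unfolded tsrc_def]]) (rule that)

lemma lift_tgt:
  assumes g: "g \<in> points G" and v: "v \<in> tangent_space G g" and \<delta>: "velocity P \<delta> (t g) (ttgt \<Gamma> g v)"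
  obtains \<gamma> where "velocity G \<gamma> g v" "\<forall>\<^sub>F \<tau> in nhds 0. \<gamma> \<tau> \<in> points G" "\<forall>\<^sub>F \<tau> in nhds 0. t (\<gamma> \<tau>) = \<delta> \<tau>"
  by (rule submersion_lift[OF smooth_arrows smooth_objects smooth_tgt g surj_ttgt[OF g, unfolded ttgt_def] v
        \<delta>[unfolded ttgt_def]]) (rule that)

section \<open>Multiplying curves and tangent vectors\<close>

lemma velocity_mult:
  assumes g: "g \<in> points G" and h: "h \<in> points G"
    and v: "velocity G \<gamma> g v" and w: "velocity G \<gamma>' h w" and c: "\<forall>\<^sub>F \<tau> in nhds 0. s (\<gamma> \<tau>) = t (\<gamma>' \<tau>)"
  shows "velocity G (\<lambda>\<tau>. m (\<gamma> \<tau>) (\<gamma>' \<tau>)) (m g h) (tmult \<Gamma> g h v w)"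
proof -
  have "s g = t h" using eventually_nhds_x_imp_x[OF c] v w by (simp add: chart_velocity_def)
  then have gh: "(g, h) \<in> composable \<Gamma>" using g h by (simp add: composable_def)
  have "\<forall>\<^sub>F \<tau> in nhds 0. (\<gamma> \<tau>, \<gamma>' \<tau>) \<in> composable \<Gamma>"
    using velocity_in_points[OF smooth_arrows g v] velocity_in_points[OF smooth_arrows h w] c
    by eventually_elim (simp add: composable_def)
  from velocity_map[OF chart_system_prod[OF csG csG] csG smooth_mult gh velocity_Pair[OF v w] this]
  show ?thesis by (simp add: tmult_def)
qed

text \<open>The condition on the vectors is only of first order. The second curve is kept, and the
  submersion \<open>s\<close> allows the first to be chosen above the target path of the
  second.\<close>

lemma ex_composable_velocities:
  assumes g: "g \<in> points G" and h: "h \<in> points G" and gh: "s g = t h"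
    and v: "v \<in> tangent_space G g" and w: "w \<in> tangent_space G h" and vw: "tsrc \<Gamma> g v = ttgt \<Gamma> h w"
  obtains \<gamma> \<gamma>' where "velocity G \<gamma> g v" "velocity G \<gamma>' h w"
    "\<forall>\<^sub>F \<tau> in nhds 0. \<gamma> \<tau> \<in> points G" "\<forall>\<^sub>F \<tau> in nhds 0. \<gamma>' \<tau> \<in> points G" "\<forall>\<^sub>F \<tau> in nhds 0. s (\<gamma> \<tau>) = t (\<gamma>' \<tau>)"
proof -
  obtain \<gamma>' where g': "velocity G \<gamma>' h w" "\<forall>\<^sub>F \<tau> in nhds 0. \<gamma>' \<tau> \<in> points G" by (rule ex_velocity[OF smooth_arrows h w])
  have "velocity P (\<lambda>\<tau>. t (\<gamma>' \<tau>)) (s g) (tsrc \<Gamma> g v)" using velocity_tgt[OF h g'(1)] gh vw by simp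
  then obtain \<gamma> where "velocity G \<gamma> g v" "\<forall>\<^sub>F \<tau> in nhds 0. \<gamma> \<tau> \<in> points G" "\<forall>\<^sub>F \<tau> in nhds 0. s (\<gamma> \<tau>) = t (\<gamma>' \<tau>)"
    by (rule lift_src[OF g v]) (rule that)
  then show thesis by (rule that[OF _ g'(1) _ g'(2)])
qed

lemma tmult:
  assumes g: "g \<in> points G" and h: "h \<in> points G" and gh: "s g = t h"
    and v: "v \<in> tangent_space G g" and w: "w \<in> tangent_space G h" and vw: "tsrc \<Gamma> g v = ttgt \<Gamma> h w"
  shows tmult_in: "tmult \<Gamma> g h v w \<in> tangent_space G (m g h)"
    and tsrc_tmult: "tsrc \<Gamma> (m g h) (tmult \<Gamma> g h v w) = tsrc \<Gamma> h w"
    and ttgt_tmult: "ttgt \<Gamma> (m g h) (tmult \<Gamma> g h v w) = ttgt \<Gamma> g v"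
proof -
  obtain \<gamma> \<gamma>' where c: "velocity G \<gamma> g v" "velocity G \<gamma>' h w"
    "\<forall>\<^sub>F \<tau> in nhds 0. \<gamma> \<tau> \<in> points G" "\<forall>\<^sub>F \<tau> in nhds 0. \<gamma>' \<tau> \<in> points G" "\<forall>\<^sub>F \<tau> in nhds 0. s (\<gamma> \<tau>) = t (\<gamma>' \<tau>)"
    by (rule ex_composable_velocities[OF g h gh v w vw])
  note mv = velocity_mult[OF g h c(1,2,5)]
  note mgh = mult_arrow[OF g h gh]
  show "tmult \<Gamma> g h v w \<in> tangent_space G (m g h)" by (rule velocity_in_tangent_space[OF mv])
  have "\<forall>\<^sub>F \<tau> in nhds 0. s (m (\<gamma> \<tau>) (\<gamma>' \<tau>)) = s (\<gamma>' \<tau>)" using c(3-5) by eventually_elim (rule src_mult)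
  with velocity_src[OF mgh(1) mv] velocity_src[OF h c(2)]
  show "tsrc \<Gamma> (m g h) (tmult \<Gamma> g h v w) = tsrc \<Gamma> h w"
    unfolding mgh(2) by (rule chart_velocity_unique)
  have "\<forall>\<^sub>F \<tau> in nhds 0. t (m (\<gamma> \<tau>) (\<gamma>' \<tau>)) = t (\<gamma> \<tau>)" using c(3-5) by eventually_elim (rule tgt_mult)
  with velocity_tgt[OF mgh(1) mv] velocity_tgt[OF g c(1)]
  show "ttgt \<Gamma> (m g h) (tmult \<Gamma> g h v w) = ttgt \<Gamma> g v"
    unfolding mgh(3) by (rule chart_velocity_unique)
qed

text \<open>Take \<open>v\<close> with the same target projection as \<open>x\<close>, lift it to a
  curve \<open>k\<close> over the target path of a curve \<open>c\<close> with velocity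
  \<open>x\<close>, and read \<open>w\<close> off \<open>k^-1 c\<close>; the product of
  \<open>k\<close> and \<open>k^-1 c\<close> is \<open>c\<close> again. The surjectivity gives
  uniqueness of covectors described by their values on products.\<close>

lemma tmult_surj:
  assumes g: "g \<in> points G" and h: "h \<in> points G" and gh: "s g = t h" and x: "x \<in> tangent_space G (m g h)"
  obtains v w where "v \<in> tangent_space G g" "w \<in> tangent_space G h" "tsrc \<Gamma> g v = ttgt \<Gamma> h w" "tmult \<Gamma> g h v w = x"
proof -
  note mgh = mult_arrow[OF g h gh] and ig = inverse_arrow[OF g]
  have "ttgt \<Gamma> (m g h) x \<in> ttgt \<Gamma> g ` tangent_space G g"
    unfolding surj_ttgt[OF g] using ttgt_in[OF mgh(1) x] mgh(3) by simp
  then obtain v where v: "v \<in> tangent_space G g" "ttgt \<Gamma> g v = ttgt \<Gamma> (m g h) x" by (elim imageE) simp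
  obtain c where c: "velocity G c (m g h) x" "\<forall>\<^sub>F \<tau> in nhds 0. c \<tau> \<in> points G"
    by (rule ex_velocity[OF smooth_arrows mgh(1) x])
  have "velocity P (\<lambda>\<tau>. t (c \<tau>)) (t g) (ttgt \<Gamma> g v)" using velocity_tgt[OF mgh(1) c(1)] mgh(3) v(2) by simp
  then obtain k where k: "velocity G k g v" "\<forall>\<^sub>F \<tau> in nhds 0. k \<tau> \<in> points G" "\<forall>\<^sub>F \<tau> in nhds 0. t (k \<tau>) = t (c \<tau>)"
    by (rule lift_tgt[OF g v(1)])
  let ?k' = "\<lambda>\<tau>. inverse_of \<Gamma> (k \<tau>)"
  \<comment> \<open>The vector \<open>v'\<close> matters only as a witness that the inverted curve
    has a velocity, so that it can be multiplied with \<open>c\<close>.\<close>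
  obtain v' where v': "velocity G ?k' (inverse_of \<Gamma> g) v'"
    by (rule that[OF velocity_map[OF csG csG smooth_inverse g k(1,2)]])
  have "\<forall>\<^sub>F \<tau> in nhds 0. s (?k' \<tau>) = t (c \<tau>)" using k(2,3) by eventually_elim (simp add: src_inverse)
  note velocity_mult[OF ig(1) mgh(1) v' c(1) this, unfolded inverse_mult_cancel[OF g h gh]]
  then obtain w where w: "velocity G (\<lambda>\<tau>. m (?k' \<tau>) (c \<tau>)) h w"
    by (rule that)
  have ev: "\<forall>\<^sub>F \<tau> in nhds 0. s (k \<tau>) = t (m (?k' \<tau>) (c \<tau>))"
    using k(2,3) c(2) by eventually_elim (simp add: inverse_arrow tgt_mult)
  have km: "velocity G (\<lambda>\<tau>. m (k \<tau>) (m (?k' \<tau>) (c \<tau>))) (m g h) (tmult \<Gamma> g h v w)"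
    by (rule velocity_mult[OF g h k(1) w ev])
  have "\<forall>\<^sub>F \<tau> in nhds 0. m (k \<tau>) (m (?k' \<tau>) (c \<tau>)) = c \<tau>"
    using k(2,3) c(2) by eventually_elim (rule mult_inverse_cancel)
  with km c(1) have "tmult \<Gamma> g h v w = x" by (rule chart_velocity_unique)
  moreover have "tsrc \<Gamma> g v = ttgt \<Gamma> h w"
    by (rule chart_velocity_unique[OF velocity_src[OF g k(1), unfolded gh] velocity_tgt[OF h w] ev])
  ultimately show thesis by (intro that[OF v(1) velocity_in_tangent_space[OF w]])
qed

end

context lie_gpd
begin

subsection \<open>Translations and the cotangent groupoid\<close>

abbreviation "ctgt g \<equiv> cotangent_map G P t g"
abbreviation "csrc g \<equiv> cotangent_map G P s g"

lemma ctgt: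
  assumes g: "g \<in> points G"
  shows ctgt_in: "ctgt g a \<in> tangent_space G g"
    and inner_ctgt: "v \<in> tangent_space G g \<Longrightarrow> ctgt g a \<bullet> v = a \<bullet> ttgt \<Gamma> g v"
  using pullback_covector[OF subspace_tangent_space[of G g] linear_ttgt[OF g]]
  by (simp_all add: cotangent_map_def ttgt_def)

lemma csrc:
  assumes g: "g \<in> points G"
  shows csrc_in: "csrc g a \<in> tangent_space G g"
    and inner_csrc: "v \<in> tangent_space G g \<Longrightarrow> csrc g a \<bullet> v = a \<bullet> tsrc \<Gamma> g v"
  using pullback_covector[OF subspace_tangent_space[of G g] linear_tsrc[OF g]]
  by (simp_all add: cotangent_map_def tsrc_def)

lemma ctgt_zero: "g \<in> points G \<Longrightarrow> ctgt g 0 = 0"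
  by (rule subspace_eqI_inner[OF subspace_tangent_space[of G g]])
    (simp_all add: ctgt subspace_0 subspace_tangent_space)

lemma csrc_zero: "g \<in> points G \<Longrightarrow> csrc g 0 = 0"
  by (rule subspace_eqI_inner[OF subspace_tangent_space[of G g]])
    (simp_all add: csrc subspace_0 subspace_tangent_space)

text \<open>Since \<open>t (m g h) = t g\<close> and \<open>s (m g h) = s h\<close>, the two
  pullbacks evaluate on a product as on its factors; \<open>tmult_surj\<close> gives uniqueness.
  \<open>comult\<close> is evaluated only on covectors of this shape, where its definite description
  has an explicit value.\<close>

lemma comult_pullbacks:
  assumes g: "g \<in> points G" and h: "h \<in> points G" and gh: "s g = t h"
  shows "comult \<Gamma> g h (ctgt g a) (csrc h b) = ctgt (m g h) a + csrc (m g h) b"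
  unfolding comult_def
proof (rule the_equality)
  note mgh = mult_arrow[OF g h gh]
  have spec: "(ctgt (m g h) a + csrc (m g h) b) \<bullet> tmult \<Gamma> g h v w = ctgt g a \<bullet> v + csrc h b \<bullet> w"
    if v: "v \<in> tangent_space G g" and w: "w \<in> tangent_space G h" and vw: "tsrc \<Gamma> g v = ttgt \<Gamma> h w" for v w
    using tmult[OF g h gh v w vw] inner_ctgt[OF g v] inner_csrc[OF h w]
    by (simp add: inner_add_left inner_ctgt[OF mgh(1)] inner_csrc[OF mgh(1)])
  moreover have "ctgt (m g h) a + csrc (m g h) b \<in> tangent_space G (m g h)"
    by (intro subspace_add subspace_tangent_space ctgt_in csrc_in mgh(1))
  ultimately show "ctgt (m g h) a + csrc (m g h) b \<in> tangent_space G (m g h) \<and>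
    (\<forall>v\<in>tangent_space G g. \<forall>w\<in>tangent_space G h.
      tsrc \<Gamma> g v = ttgt \<Gamma> h w \<longrightarrow>
      (ctgt (m g h) a + csrc (m g h) b) \<bullet> tmult \<Gamma> g h v w = ctgt g a \<bullet> v + csrc h b \<bullet> w)" by simp
  fix \<gamma>
  assume \<gamma>: "\<gamma> \<in> tangent_space G (m g h) \<and>
    (\<forall>v\<in>tangent_space G g. \<forall>w\<in>tangent_space G h.
      tsrc \<Gamma> g v = ttgt \<Gamma> h w \<longrightarrow> \<gamma> \<bullet> tmult \<Gamma> g h v w = ctgt g a \<bullet> v + csrc h b \<bullet> w)"
  show "\<gamma> = ctgt (m g h) a + csrc (m g h) b"
  proof (rule subspace_eqI_inner[OF subspace_tangent_space])
    show "\<gamma> \<in> tangent_space G (m g h)" using \<gamma> by blast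
    show "ctgt (m g h) a + csrc (m g h) b \<in> tangent_space G (m g h)"
      by (intro subspace_add subspace_tangent_space ctgt_in csrc_in mgh(1))
    fix x assume "x \<in> tangent_space G (m g h)"
    then obtain v w where vw: "v \<in> tangent_space G g" "w \<in> tangent_space G h" "tsrc \<Gamma> g v = ttgt \<Gamma> h w"
      and x: "tmult \<Gamma> g h v w = x"
      by (rule tmult_surj[OF g h gh])
    then show "\<gamma> \<bullet> x = (ctgt (m g h) a + csrc (m g h) b) \<bullet> x"
      using \<gamma> spec[OF vw] unfolding x[symmetric] by simp
  qed
qed

text \<open>Translations are the multiplication composed with an inclusion that fixes one factor;
  \<open>F1\<close> and \<open>F2\<close> cover the left and the right case at once.
  Differentiability within the coordinate image of the fibre makes \<open>tleft\<close> and
  \<open>tright\<close> genuine derivatives.\<close>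

lemma restricted_translation_differentiable:
  assumes S: "S \<subseteq> points G" "k0 \<in> S" and F: "(\<lambda>x. (F1 x, F2 x)) ` S \<subseteq> composable \<Gamma>"
    and k: "(F1 = (\<lambda>x. x) \<and> F2 = (\<lambda>x. a)) \<or> (F1 = (\<lambda>x. a) \<and> F2 = (\<lambda>x. x))"
  shows "(snd (chart_at G (m (F1 k0) (F2 k0))) \<circ> (\<lambda>x. m (F1 x) (F2 x)) \<circ> chart_inv (chart_at G k0))
    differentiable (at (snd (chart_at G k0) k0) within snd (chart_at G k0) ` (S \<inter> fst (chart_at G k0)))"
proof -
  let ?c = "chart_at G k0" and ?p = "(F1 k0, F2 k0)" and ?GG = "prod_manifold G G"
  let ?C = "chart_at ?GG ?p"
  let ?d = "chart_at G (m (F1 k0) (F2 k0))"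
  let ?B = "snd ?c ` (S \<inter> fst ?c)"
  have p: "?p \<in> composable \<Gamma>" using F S(2) by blast
  then have pts: "F1 k0 \<in> points G" "F2 k0 \<in> points G" by (auto simp: composable_def)
  have k0: "k0 \<in> points G" using S by blast
  have aG: "a \<in> points G" using pts k by auto
  note csGG = chart_system_prod[OF csG csG]
  have C: "?C = prod_chart (chart_at G (F1 k0)) (chart_at G (F2 k0))" by (rule chart_at_prod_manifold)
  \<comment> \<open>The inclusion in coordinates: affine, with the fixed factor frozen at the
    coordinates of \<open>a\<close>.\<close>
  define j where "j x = (if F2 = (\<lambda>x. a) \<and> F1 = (\<lambda>x. x) then (x, snd (chart_at G a) a) else (snd (chart_at G a) a, x))" for x :: 'e
  have jd: "(j has_derivative (\<lambda>h. if F2 = (\<lambda>x. a) \<and> F1 = (\<lambda>x. x) then (h, 0) else (0, h))) (at x within T)" for x T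
    unfolding j_def
    by (cases "F2 = (\<lambda>x. a) \<and> F1 = (\<lambda>x. x)") (auto intro!: derivative_eq_intros)
  have jc: "j (snd ?c x) = snd ?C (F1 x, F2 x)" if "x \<in> S" for x
    using k unfolding j_def C by (auto simp: prod_chart_def)
  have jB: "j ` ?B \<subseteq> snd ?C ` (composable \<Gamma> \<inter> fst ?C)"
  proof
    fix y assume "y \<in> j ` ?B"
    then obtain x where x: "x \<in> S" "x \<in> fst ?c" "y = j (snd ?c x)" by auto
    have "(F1 x, F2 x) \<in> fst ?C"
      using k x chart_at_mem[OF csG aG] unfolding C by (auto simp: prod_chart_def)
    moreover have "(F1 x, F2 x) \<in> composable \<Gamma>" using F x(1) by blast
    ultimately show "y \<in> snd ?C ` (composable \<Gamma> \<inter> fst ?C)" using jc[OF x(1)] x(3) by blast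
  qed
  obtain D where D: "(snd ?d \<circ> (\<lambda>(g, h). m g h) \<circ> chart_inv ?C has_derivative D)
      (at (snd ?C ?p) within snd ?C ` (composable \<Gamma> \<inter> fst ?C))"
    using smooth_map_on_differentiable[OF csGG csG smooth_mult p] unfolding differentiable_def by auto
  have D': "(snd ?d \<circ> (\<lambda>(g, h). m g h) \<circ> chart_inv ?C has_derivative D) (at (j (snd ?c k0)) within j ` ?B)"
    unfolding jc[OF S(2)] by (rule has_derivative_subset[OF D jB])
  have 1: "((snd ?d \<circ> (\<lambda>(g, h). m g h) \<circ> chart_inv ?C) \<circ> j has_derivative
    D \<circ> (\<lambda>h. if F2 = (\<lambda>x. a) \<and> F1 = (\<lambda>x. x) then (h, 0) else (0, h))) (at (snd ?c k0) within ?B)"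
    by (rule diff_chain_within[OF jd D'])
  have "(snd ?d \<circ> (\<lambda>x. m (F1 x) (F2 x)) \<circ> chart_inv ?c has_derivative
    D \<circ> (\<lambda>h. if F2 = (\<lambda>x. a) \<and> F1 = (\<lambda>x. x) then (h, 0) else (0, h))) (at (snd ?c k0) within ?B)"
  proof (rule has_derivative_transform[OF _ _ 1])
    show "snd ?c k0 \<in> ?B" using S(2) chart_at_mem[OF csG k0] by blast
    fix y assume "y \<in> ?B"
    then obtain x where x: "x \<in> S" "x \<in> fst ?c" "y = snd ?c x" by auto
    have "(F1 x, F2 x) \<in> fst ?C"
      using k x chart_at_mem[OF csG aG] unfolding C by (auto simp: prod_chart_def)
    moreover have "inj_on (snd ?C) (fst ?C)"
      by (rule inj_chart_at[OF csGG]) (simp add: points_prod_manifold pts)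
    ultimately have "chart_inv ?C (snd ?C (F1 x, F2 x)) = (F1 x, F2 x)" by (intro chart_inv_eq)
    moreover have "chart_inv ?c (snd ?c x) = x" by (rule chart_inv_eq[OF inj_chart_at[OF csG k0] x(2)])
    ultimately show "(snd ?d \<circ> (\<lambda>x. m (F1 x) (F2 x)) \<circ> chart_inv ?c) y =
        ((snd ?d \<circ> (\<lambda>(g, h). m g h) \<circ> chart_inv ?C) \<circ> j) y"
      using jc[OF x(1)] x(3) by simp
  qed
  then show ?thesis by (rule differentiableI)
qed

lemma tleft_differentiable:
  assumes g: "g \<in> points G"
  shows "(snd (chart_at G (m g (u (s g)))) \<circ> (\<lambda>h. m g h) \<circ> chart_inv (chart_at G (u (s g))))
    differentiable (at (snd (chart_at G (u (s g))) (u (s g))) within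
      snd (chart_at G (u (s g))) ` ({h \<in> points G. t h = s g} \<inter> fst (chart_at G (u (s g)))))"
  by (rule restricted_translation_differentiable[where ?F1.0 = "\<lambda>x. g" and ?F2.0 = "\<lambda>x. x" and a = g])
    (use g unit_arrow[OF arrow_src[OF g]] tgt_unit[OF arrow_src[OF g]] in \<open>auto simp: composable_def\<close>)

lemma tright_differentiable:
  assumes g: "g \<in> points G"
  shows "(snd (chart_at G (m (u (t g)) g)) \<circ> (\<lambda>h. m h g) \<circ> chart_inv (chart_at G (u (t g))))
    differentiable (at (snd (chart_at G (u (t g))) (u (t g))) within
      snd (chart_at G (u (t g))) ` ({h \<in> points G. s h = t g} \<inter> fst (chart_at G (u (t g)))))"
  by (rule restricted_translation_differentiable[where ?F1.0 = "\<lambda>x. x" and ?F2.0 = "\<lambda>x. g" and a = g])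
    (use g unit_arrow[OF arrow_tgt[OF g]] src_unit[OF arrow_tgt[OF g]] in \<open>auto simp: composable_def\<close>)

lemma linear_tleft: "g \<in> points G \<Longrightarrow> linear (tleft \<Gamma> g)"
  using tleft_differentiable[of g]
  unfolding tleft_def tangent_map_on_def Let_def frechet_derivative_works by (rule has_derivative_linear)

lemma linear_tright: "g \<in> points G \<Longrightarrow> linear (tright \<Gamma> g)"
  using tright_differentiable[of g]
  unfolding tright_def tangent_map_on_def Let_def frechet_derivative_works by (rule has_derivative_linear)

section \<open>Translating curves within target and source fibres\<close>

lemma velocity_tleft:
  assumes g: "g \<in> points G" and v: "velocity G \<gamma> (u (s g)) v" and S: "\<forall>\<^sub>F \<tau> in nhds 0. t (\<gamma> \<tau>) = s g"
  shows "velocity G (\<lambda>\<tau>. m g (\<gamma> \<tau>)) g (tleft \<Gamma> g v)"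
proof -
  let ?e = "u (s g)"
  have e: "?e \<in> points G" using g arrow_src unit_arrow by blast
  have pts: "\<forall>\<^sub>F \<tau> in nhds 0. \<gamma> \<tau> \<in> points G" by (rule velocity_in_points[OF smooth_arrows e v])
  have ev: "\<forall>\<^sub>F \<tau> in nhds 0. \<gamma> \<tau> \<in> {h \<in> points G. t h = s g} \<inter> fst (chart_at G ?e)"
  proof -
    have "\<forall>\<^sub>F \<tau> in nhds 0. \<gamma> \<tau> \<in> fst (chart_at G ?e)" using v by (simp add: chart_velocity_def)
    with pts S show ?thesis by eventually_elim simp
  qed
  have c: "velocity G (\<lambda>_. g) g 0" by (rule chart_velocity_const[OF chart_at_mem[OF csG g]])
  have "\<forall>\<^sub>F \<tau> in nhds 0. s g = t (\<gamma> \<tau>)" using S by eventually_elim simp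
  from velocity_mult[OF g e c v this]
  have "\<forall>\<^sub>F \<tau> in nhds 0. m g (\<gamma> \<tau>) \<in> fst (chart_at G (m g ?e))" by (simp add: chart_velocity_def)
  from chart_velocity_image[OF inj_chart_at[OF csG e] v _ ev tleft_differentiable[OF g] this]
  show ?thesis unfolding tleft_def tangent_map_on_def Let_def by (simp add: mult_unit[OF g])
qed

lemma velocity_tright:
  assumes g: "g \<in> points G" and v: "velocity G \<gamma> (u (t g)) v" and S: "\<forall>\<^sub>F \<tau> in nhds 0. s (\<gamma> \<tau>) = t g"
  shows "velocity G (\<lambda>\<tau>. m (\<gamma> \<tau>) g) g (tright \<Gamma> g v)"
proof -
  let ?e = "u (t g)"
  have e: "?e \<in> points G" using g arrow_tgt unit_arrow by blast
  have pts: "\<forall>\<^sub>F \<tau> in nhds 0. \<gamma> \<tau> \<in> points G" by (rule velocity_in_points[OF smooth_arrows e v])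
  have ev: "\<forall>\<^sub>F \<tau> in nhds 0. \<gamma> \<tau> \<in> {h \<in> points G. s h = t g} \<inter> fst (chart_at G ?e)"
  proof -
    have "\<forall>\<^sub>F \<tau> in nhds 0. \<gamma> \<tau> \<in> fst (chart_at G ?e)" using v by (simp add: chart_velocity_def)
    with pts S show ?thesis by eventually_elim simp
  qed
  have c: "velocity G (\<lambda>_. g) g 0" by (rule chart_velocity_const[OF chart_at_mem[OF csG g]])
  from velocity_mult[OF e g v c S]
  have "\<forall>\<^sub>F \<tau> in nhds 0. m (\<gamma> \<tau>) g \<in> fst (chart_at G (m ?e g))" by (simp add: chart_velocity_def)
  from chart_velocity_image[OF inj_chart_at[OF csG e] v _ ev tright_differentiable[OF g] this]
  show ?thesis unfolding tright_def tangent_map_on_def Let_def by (simp add: unit_mult[OF g])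
qed

text \<open>The constant curve at \<open>t g\<close> has velocity 0 and lifts through the submersion
  \<open>t\<close> to a curve in the target fibre.\<close>

lemma ex_tgt_fibre_velocity:
  assumes g: "g \<in> points G" and v: "v \<in> tangent_space G g" "ttgt \<Gamma> g v = 0"
  obtains \<gamma> where "velocity G \<gamma> g v" "\<forall>\<^sub>F \<tau> in nhds 0. \<gamma> \<tau> \<in> points G" "\<forall>\<^sub>F \<tau> in nhds 0. t (\<gamma> \<tau>) = t g"
proof -
  have "velocity P (\<lambda>_. t g) (t g) (ttgt \<Gamma> g v)"
    unfolding v(2) by (rule chart_velocity_const[OF chart_at_mem[OF csP arrow_tgt[OF g]]])
  then show thesis by (rule lift_tgt[OF g v(1)]) (rule that)
qed

lemma ex_src_fibre_velocity:
  assumes g: "g \<in> points G" and v: "v \<in> tangent_space G g" "tsrc \<Gamma> g v = 0"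
  obtains \<gamma> where "velocity G \<gamma> g v" "\<forall>\<^sub>F \<tau> in nhds 0. \<gamma> \<tau> \<in> points G" "\<forall>\<^sub>F \<tau> in nhds 0. s (\<gamma> \<tau>) = s g"
proof -
  have "velocity P (\<lambda>_. s g) (s g) (tsrc \<Gamma> g v)"
    unfolding v(2) by (rule chart_velocity_const[OF chart_at_mem[OF csP arrow_src[OF g]]])
  then show thesis by (rule lift_src[OF g v(1)]) (rule that)
qed

lemma tleft_unit:
  assumes p: "p \<in> points P" and v: "v \<in> algebroid_fibre \<Gamma> p"
  shows "tleft \<Gamma> (u p) v = v"
proof -
  note e = unit_arrow[OF p]
  obtain \<gamma> where c: "velocity G \<gamma> (u p) v" "\<forall>\<^sub>F \<tau> in nhds 0. \<gamma> \<tau> \<in> points G" "\<forall>\<^sub>F \<tau> in nhds 0. t (\<gamma> \<tau>) = t (u p)"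
    by (rule ex_tgt_fibre_velocity[OF e]) (use v in \<open>auto simp: algebroid_fibre_def\<close>)
  have 1: "velocity G (\<lambda>\<tau>. m (u p) (\<gamma> \<tau>)) (u p) (tleft \<Gamma> (u p) v)"
    by (rule velocity_tleft[OF e]) (use c in \<open>simp_all add: src_unit[OF p] tgt_unit[OF p]\<close>)
  have "\<forall>\<^sub>F \<tau> in nhds 0. m (u p) (\<gamma> \<tau>) = \<gamma> \<tau>"
    using c(2,3) by eventually_elim (metis tgt_unit[OF p] unit_mult)
  with 1 c(1) show ?thesis by (rule chart_velocity_unique)
qed

lemma tright_unit:
  assumes p: "p \<in> points P" and v: "v \<in> tangent_space G (u p)" "tsrc \<Gamma> (u p) v = 0"
  shows "tright \<Gamma> (u p) v = v"
proof -
  note e = unit_arrow[OF p]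
  obtain \<gamma> where c: "velocity G \<gamma> (u p) v" "\<forall>\<^sub>F \<tau> in nhds 0. \<gamma> \<tau> \<in> points G" "\<forall>\<^sub>F \<tau> in nhds 0. s (\<gamma> \<tau>) = s (u p)"
    by (rule ex_src_fibre_velocity[OF e v])
  have 1: "velocity G (\<lambda>\<tau>. m (\<gamma> \<tau>) (u p)) (u p) (tright \<Gamma> (u p) v)"
    by (rule velocity_tright[OF e]) (use c in \<open>simp_all add: src_unit[OF p] tgt_unit[OF p]\<close>)
  have "\<forall>\<^sub>F \<tau> in nhds 0. m (\<gamma> \<tau>) (u p) = \<gamma> \<tau>"
    using c(2,3) by eventually_elim (metis src_unit[OF p] mult_unit)
  with 1 c(1) show ?thesis by (rule chart_velocity_unique)
qed

text \<open>A curve in the target fibre through \<open>g\<close> is translated to the unit by the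
  inverse of \<open>g\<close>, and translating it forward again recovers it. So the kernel of
  \<open>Tt\<close> is the left translate of \<open>AG\<close>.\<close>

lemma ttgt_kernel_tleft:
  assumes g: "g \<in> points G" and w: "w \<in> tangent_space G g" "ttgt \<Gamma> g w = 0"
  obtains v where "v \<in> algebroid_fibre \<Gamma> (s g)" "tleft \<Gamma> g v = w"
proof -
  let ?i = "inverse_of \<Gamma> g"
  note ig = inverse_arrow[OF g]
  obtain \<gamma> where c: "velocity G \<gamma> g w" "\<forall>\<^sub>F \<tau> in nhds 0. \<gamma> \<tau> \<in> points G" "\<forall>\<^sub>F \<tau> in nhds 0. t (\<gamma> \<tau>) = t g"
    by (rule ex_tgt_fibre_velocity[OF g w])
  have e: "u (s g) \<in> points G" using g arrow_src unit_arrow by blast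
  have ci: "velocity G (\<lambda>_. ?i) ?i 0" by (rule chart_velocity_const[OF chart_at_mem[OF csG ig(1)]])
  have "\<forall>\<^sub>F \<tau> in nhds 0. s ?i = t (\<gamma> \<tau>)" using c(3) by eventually_elim (simp add: ig)
  note velocity_mult[OF ig(1) g ci c(1) this, unfolded ig(5)]
  then obtain v where v: "velocity G (\<lambda>\<tau>. m ?i (\<gamma> \<tau>)) (u (s g)) v" by (rule that)
  have ev: "\<forall>\<^sub>F \<tau> in nhds 0. t (m ?i (\<gamma> \<tau>)) = s g"
    using c(2,3) by eventually_elim (simp add: ig tgt_mult)
  have 1: "velocity G (\<lambda>\<tau>. m g (m ?i (\<gamma> \<tau>))) g (tleft \<Gamma> g v)" by (rule velocity_tleft[OF g v ev])
  have "\<forall>\<^sub>F \<tau> in nhds 0. m g (m ?i (\<gamma> \<tau>)) = \<gamma> \<tau>"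
    using c(2,3) by eventually_elim (simp add: mult_inverse_cancel[OF g])
  with 1 c(1) have "tleft \<Gamma> g v = w" by (rule chart_velocity_unique)
  moreover have "ttgt \<Gamma> (u (s g)) v = 0"
  proof -
    have sg: "s g \<in> points P" by (rule arrow_src[OF g])
    have "velocity P (\<lambda>_. s g) (s g) 0" by (rule chart_velocity_const[OF chart_at_mem[OF csP sg]])
    from chart_velocity_unique[OF velocity_tgt[OF e v, unfolded tgt_unit[OF sg]] this ev] show ?thesis .
  qed
  ultimately show thesis
    using that[of v] velocity_in_tangent_space[OF v] by (simp add: algebroid_fibre_def)
qed

section \<open>The splitting into \<open>TP\<close> and \<open>AG\<close> at a unit, and the
  projections of covectors\<close>

lemma algebroid_part:
  assumes p: "p \<in> points P" and z: "z \<in> tangent_space G (u p)"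
  shows "z - tunit \<Gamma> p (ttgt \<Gamma> (u p) z) \<in> algebroid_fibre \<Gamma> p"
proof -
  have "ttgt \<Gamma> (u p) z \<in> tangent_space P p" using ttgt_in[OF unit_arrow[OF p] z] by (simp add: tgt_unit[OF p])
  then show ?thesis
    unfolding algebroid_fibre_def
    using z subspace_diff[OF subspace_tangent_space z tunit_in[OF p]]
    by (simp add: linear_diff[OF linear_ttgt[OF unit_arrow[OF p]]] ttgt_tunit[OF p])
qed

lemma covector_unit_eqI:
  assumes p: "p \<in> points P" and \<xi>: "\<xi> \<in> tangent_space G (u p)" and \<eta>: "\<eta> \<in> tangent_space G (u p)"
    and P: "\<And>w. w \<in> tangent_space P p \<Longrightarrow> \<xi> \<bullet> tunit \<Gamma> p w = \<eta> \<bullet> tunit \<Gamma> p w"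
    and A: "\<And>v. v \<in> algebroid_fibre \<Gamma> p \<Longrightarrow> \<xi> \<bullet> v = \<eta> \<bullet> v"
  shows "\<xi> = \<eta>"
proof (rule subspace_eqI_inner[OF subspace_tangent_space \<xi> \<eta>])
  fix z assume z: "z \<in> tangent_space G (u p)"
  have "ttgt \<Gamma> (u p) z \<in> tangent_space P p" using ttgt_in[OF unit_arrow[OF p] z] by (simp add: tgt_unit[OF p])
  from P[OF this] A[OF algebroid_part[OF p z]] show "\<xi> \<bullet> z = \<eta> \<bullet> z"
    by (simp add: inner_diff_right)
qed

text \<open>Extend \<open>f\<close> by 0 along \<open>TP\<close>, using the projection
  \<open>z \<mapsto> z - T\<epsilon> (Tt z)\<close> onto \<open>AG\<close>. This is the
  well-definedness behind the descriptions in \<open>cosrc\<close> and \<open>cotgt\<close>.\<close>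

lemma dual_algebroid_covector:
  assumes p: "p \<in> points P" and f: "linear f"
  shows "\<exists>!\<xi>. \<xi> \<in> dual_algebroid_fibre \<Gamma> p \<and> (\<forall>v\<in>algebroid_fibre \<Gamma> p. \<xi> \<bullet> v = f v)"
proof -
  note e = unit_arrow[OF p]
  let ?f = "\<lambda>z. f (z - tunit \<Gamma> p (ttgt \<Gamma> (u p) z))"
  have lin: "linear ?f"
    by (rule linearI)
      (simp_all add: linear_add[OF linear_ttgt[OF e]] linear_add[OF linear_tunit[OF p]] linear_scale[OF linear_ttgt[OF e]]
        linear_scale[OF linear_tunit[OF p]] linear_add[OF f] linear_scale[OF f] linear_diff[OF f] algebra_simps)
  let ?\<xi> = "covector_of (tangent_space G (u p)) ?f"
  have \<xi>: "?\<xi> \<in> tangent_space G (u p)" "\<And>z. z \<in> tangent_space G (u p) \<Longrightarrow> ?\<xi> \<bullet> z = ?f z"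
    using covector_of[OF subspace_tangent_space[of G "u p"] lin] by blast+
  have 1: "?\<xi> \<in> dual_algebroid_fibre \<Gamma> p"
    unfolding dual_algebroid_fibre_def
    using \<xi> tunit_in[OF p] by (simp add: ttgt_tunit[OF p] linear_0[OF f])
  have 2: "?\<xi> \<bullet> v = f v" if "v \<in> algebroid_fibre \<Gamma> p" for v
    using that \<xi>(2)[of v] linear_0[OF linear_tunit[OF p]] by (simp add: algebroid_fibre_def)
  show ?thesis
  proof (rule ex1I[of _ ?\<xi>])
    fix \<eta> assume \<eta>: "\<eta> \<in> dual_algebroid_fibre \<Gamma> p \<and> (\<forall>v\<in>algebroid_fibre \<Gamma> p. \<eta> \<bullet> v = f v)"
    show "\<eta> = ?\<xi>"
      by (rule covector_unit_eqI[OF p]) (use \<eta> 1 2 in \<open>simp_all add: dual_algebroid_fibre_def\<close>)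
  qed (use 1 2 in simp)
qed

lemma cosrc:
  assumes g: "g \<in> points G"
  shows cosrc_in: "cosrc \<Gamma> g \<alpha> \<in> dual_algebroid_fibre \<Gamma> (s g)"
    and inner_cosrc: "v \<in> algebroid_fibre \<Gamma> (s g) \<Longrightarrow> cosrc \<Gamma> g \<alpha> \<bullet> v = \<alpha> \<bullet> tleft \<Gamma> g v"
proof -
  have "linear (\<lambda>v. \<alpha> \<bullet> tleft \<Gamma> g v)"
    using linear_compose[OF linear_tleft[OF g] bounded_linear.linear[OF bounded_linear_inner_right[of \<alpha>]]]
    by (simp add: o_def)
  from theI'[OF dual_algebroid_covector[OF arrow_src[OF g] this]]
  show "cosrc \<Gamma> g \<alpha> \<in> dual_algebroid_fibre \<Gamma> (s g)"
    "v \<in> algebroid_fibre \<Gamma> (s g) \<Longrightarrow> cosrc \<Gamma> g \<alpha> \<bullet> v = \<alpha> \<bullet> tleft \<Gamma> g v"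
    unfolding cosrc_def by blast+
qed

lemma cotgt:
  assumes g: "g \<in> points G"
  shows cotgt_in: "cotgt \<Gamma> g \<alpha> \<in> dual_algebroid_fibre \<Gamma> (t g)"
    and inner_cotgt: "v \<in> algebroid_fibre \<Gamma> (t g) \<Longrightarrow>
      cotgt \<Gamma> g \<alpha> \<bullet> v = \<alpha> \<bullet> tright \<Gamma> g (v - tunit \<Gamma> (t g) (tsrc \<Gamma> (u (t g)) v))"
proof -
  note p = arrow_tgt[OF g]
  have "linear (\<lambda>v. \<alpha> \<bullet> tright \<Gamma> g (v - tunit \<Gamma> (t g) (tsrc \<Gamma> (u (t g)) v)))"
    by (rule linearI)
      (simp_all add: linear_add[OF linear_tsrc[OF unit_arrow[OF p]]] linear_add[OF linear_tunit[OF p]] linear_scale[OF linear_tsrc[OF unit_arrow[OF p]]]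
        linear_scale[OF linear_tunit[OF p]] linear_add[OF linear_tright[OF g]] linear_scale[OF linear_tright[OF g]]
        linear_diff[OF linear_tright[OF g]] inner_add_right inner_diff_right algebra_simps)
  from theI'[OF dual_algebroid_covector[OF p this]]
  show "cotgt \<Gamma> g \<alpha> \<in> dual_algebroid_fibre \<Gamma> (t g)"
    "v \<in> algebroid_fibre \<Gamma> (t g) \<Longrightarrow>
      cotgt \<Gamma> g \<alpha> \<bullet> v = \<alpha> \<bullet> tright \<Gamma> g (v - tunit \<Gamma> (t g) (tsrc \<Gamma> (u (t g)) v))"
    unfolding cotgt_def by blast+
qed

lemma dual_algebroid_eqI:
  assumes p: "p \<in> points P" and \<xi>: "\<xi> \<in> dual_algebroid_fibre \<Gamma> p" and \<eta>: "\<eta> \<in> dual_algebroid_fibre \<Gamma> p"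
    and A: "\<And>v. v \<in> algebroid_fibre \<Gamma> p \<Longrightarrow> \<xi> \<bullet> v = \<eta> \<bullet> v"
  shows "\<xi> = \<eta>"
  by (rule covector_unit_eqI[OF p _ _ _ A]) (use \<xi> \<eta> in \<open>simp_all add: dual_algebroid_fibre_def\<close>)

lemma zero_in_dual_algebroid: "0 \<in> dual_algebroid_fibre \<Gamma> p"
  by (simp add: dual_algebroid_fibre_def subspace_0 subspace_tangent_space)

lemma cosrc_zero: "g \<in> points G \<Longrightarrow> cosrc \<Gamma> g 0 = 0"
  by (rule dual_algebroid_eqI[OF arrow_src cosrc_in zero_in_dual_algebroid]) (simp_all add: inner_cosrc)

lemma cotgt_zero: "g \<in> points G \<Longrightarrow> cotgt \<Gamma> g 0 = 0"
  by (rule dual_algebroid_eqI[OF arrow_tgt cotgt_in zero_in_dual_algebroid]) (simp_all add: inner_cotgt)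

text \<open>The kernel of \<open>Tt\<close> consists of left translates of \<open>AG\<close>, on
  which the vanishing of \<open>cosrc\<close> makes \<beta> vanish; a covector killing that kernel
  factors through \<open>Tt\<close>.\<close>

lemma cosrc_zero_imp_pullback:
  assumes g: "g \<in> points G" and \<beta>: "\<beta> \<in> tangent_space G g" and z: "cosrc \<Gamma> g \<beta> = 0"
  obtains a where "\<beta> = ctgt g a"
proof -
  have ker: "\<beta> \<bullet> w = 0" if w: "w \<in> tangent_space G g" "ttgt \<Gamma> g w = 0" for w
  proof -
    obtain v where v: "v \<in> algebroid_fibre \<Gamma> (s g)" "tleft \<Gamma> g v = w" by (rule ttgt_kernel_tleft[OF g w])
    show ?thesis using inner_cosrc[OF g v(1), of \<beta>] z v(2) by simp
  qed
  have "linear (\<lambda>x. \<beta> \<bullet> x)" using bounded_linear.linear[OF bounded_linear_inner_right] .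
  then obtain a where a: "\<And>x. x \<in> tangent_space G g \<Longrightarrow> \<beta> \<bullet> x = a \<bullet> ttgt \<Gamma> g x"
  proof (rule linear_factor_covector[OF subspace_tangent_space _ linear_ttgt[OF g] subspace_tangent_space])
    show "ttgt \<Gamma> g ` tangent_space G g \<subseteq> tangent_space P (t g)" using surj_ttgt[OF g] by simp
  qed (use ker in \<open>assumption | simp\<close>)+
  have "\<beta> = ctgt g a"
    by (rule subspace_eqI_inner[OF subspace_tangent_space \<beta> ctgt_in[OF g]]) (simp add: a inner_ctgt[OF g])
  then show thesis by (rule that)
qed

end

section \<open>Multiplicative Dirac structures\<close>

lemma points_submanifold:
  assumes "embedded_submanifold M S"
  shows "points (submanifold M S) = S"
proof (intro set_eqI iffI)
  fix p assume "p \<in> points (submanifold M S)"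
  then show "p \<in> S" by (auto simp: points_def submanifold_def)
next
  fix p assume p: "p \<in> S"
  then obtain c where c: "c \<in> slice_charts M S" "p \<in> fst c"
    using assms unfolding embedded_submanifold_def by blast
  then have "(S \<inter> fst c, snd c) \<in> atlas (submanifold M S)" unfolding submanifold_def by auto
  then show "p \<in> points (submanifold M S)" unfolding points_def by (rule UN_I) (simp add: c(2) p)
qed

locale dirac_gpd = lie_gpd \<Gamma> for \<Gamma> :: "('g, 'e::euclidean_space, 'p, 'f::euclidean_space) groupoid" +
  fixes D :: "'g \<Rightarrow> ('e \<times> 'e) set"
  assumes dirac: "dirac_groupoid \<Gamma> D"
begin

lemma dirac_arrows: "dirac_structure G D"
  using dirac by (simp add: dirac_groupoid_def)

lemma subspace_D: "g \<in> points G \<Longrightarrow> subspace (D g)"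
  and D_subset: "g \<in> points G \<Longrightarrow> D g \<subseteq> tangent_space G g \<times> tangent_space G g"
proof -
  have "smooth_subbundle G D" using dirac_arrows by (simp add: dirac_structure_def)
  then show "g \<in> points G \<Longrightarrow> subspace (D g)" "g \<in> points G \<Longrightarrow> D g \<subseteq> tangent_space G g \<times> tangent_space G g"
    unfolding smooth_subbundle_def pontryagin_fibre_def by blast+
qed

lemma D_lagrangian:
  "g \<in> points G \<Longrightarrow> D g = {x \<in> tangent_space G g \<times> tangent_space G g. \<forall>y\<in>D g. pairing x y = 0}"
  using dirac_arrows unfolding dirac_structure_def pairing_orth_def pontryagin_fibre_def by blast

definition "dirac_arrow x \<longleftrightarrow> fst x \<in> points G \<and> snd x \<in> D (fst x)"

lemma subgroupoid_axioms:
  obtains Q where "algebraic_groupoid (pontryagin_groupoid \<Gamma>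
      \<lparr>arrows := submanifold (pontryagin_bundle G) (Collect dirac_arrow),
       objects := submanifold (objects (pontryagin_groupoid \<Gamma>)) Q\<rparr>)"
    "points (submanifold (pontryagin_bundle G) (Collect dirac_arrow)) = Collect dirac_arrow"
proof -
  obtain Q where Q: "lie_subgroupoid (pontryagin_groupoid \<Gamma>) {(g, v, \<alpha>). g \<in> points G \<and> (v, \<alpha>) \<in> D g} Q"
    using dirac unfolding dirac_groupoid_def by blast
  have eq: "{(g, v, \<alpha>). g \<in> points G \<and> (v, \<alpha>) \<in> D g} = Collect dirac_arrow"
    by (auto simp: dirac_arrow_def)
  have ar: "arrows (pontryagin_groupoid \<Gamma>) = pontryagin_bundle G" by (simp add: pontryagin_groupoid_def)
  have "embedded_submanifold (pontryagin_bundle G) (Collect dirac_arrow)"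
    "algebraic_groupoid (pontryagin_groupoid \<Gamma>
      \<lparr>arrows := submanifold (pontryagin_bundle G) (Collect dirac_arrow),
       objects := submanifold (objects (pontryagin_groupoid \<Gamma>)) Q\<rparr>)"
    using Q unfolding eq lie_subgroupoid_def lie_groupoid_def ar by blast+
  then show thesis by (intro that[of Q] points_submanifold)
qed

abbreviation "PG \<equiv> pontryagin_groupoid \<Gamma>"

text \<open>The groupoid axioms of the subgroupoid, read in \<open>pontryagin_groupoid\<close>. Its
  unit map is the identity, so the objects of the subgroupoid are themselves elements of
  \<open>D\<close>, and closure under source and target follows.\<close>

lemma dirac_arrow_src: "dirac_arrow x \<Longrightarrow> dirac_arrow (src PG x)"
  and dirac_arrow_tgt: "dirac_arrow x \<Longrightarrow> dirac_arrow (tgt PG x)"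
  and dirac_arrow_mult: "dirac_arrow x \<Longrightarrow> dirac_arrow y \<Longrightarrow> src PG x = tgt PG y \<Longrightarrow> dirac_arrow (mult PG x y)"
  and dirac_arrow_inverse: "dirac_arrow x \<Longrightarrow>
    \<exists>y. dirac_arrow y \<and> src PG y = tgt PG x \<and> tgt PG y = src PG x \<and> mult PG x y = tgt PG x \<and> mult PG y x = src PG x"
proof -
  obtain Q where Q: "algebraic_groupoid (PG
      \<lparr>arrows := submanifold (pontryagin_bundle G) (Collect dirac_arrow),
       objects := submanifold (objects PG) Q\<rparr>)" (is "algebraic_groupoid ?H")
    and pts: "points (submanifold (pontryagin_bundle G) (Collect dirac_arrow)) = Collect dirac_arrow"
    by (rule subgroupoid_axioms)
  have sel: "arrows ?H = submanifold (pontryagin_bundle G) (Collect dirac_arrow)" "src ?H = src PG" "tgt ?H = tgt PG"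
    "unit_at ?H = (\<lambda>x. x)" "mult ?H = mult PG"
    by (simp_all add: pontryagin_groupoid_def)
  have ax1: "\<And>x. dirac_arrow x \<Longrightarrow> src PG x \<in> points (objects ?H) \<and> tgt PG x \<in> points (objects ?H)"
    and ax2: "\<And>x. x \<in> points (objects ?H) \<Longrightarrow> dirac_arrow x"
    and ax3: "\<And>x y. (x, y) \<in> composable ?H \<Longrightarrow> dirac_arrow (mult PG x y)"
    and ax4: "\<And>x. dirac_arrow x \<Longrightarrow> \<exists>y. inverses ?H x y"
    using Q unfolding algebraic_groupoid_def sel pts by auto
  show "dirac_arrow x \<Longrightarrow> dirac_arrow (src PG x)" "dirac_arrow x \<Longrightarrow> dirac_arrow (tgt PG x)"
    using ax1 ax2 by blast+
  show "dirac_arrow x \<Longrightarrow> dirac_arrow y \<Longrightarrow> src PG x = tgt PG y \<Longrightarrow> dirac_arrow (mult PG x y)"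
    by (rule ax3) (simp add: composable_def sel pts del: select_convs update_convs)
  show "dirac_arrow x \<Longrightarrow>
    \<exists>y. dirac_arrow y \<and> src PG y = tgt PG x \<and> tgt PG y = src PG x \<and> mult PG x y = tgt PG x \<and> mult PG y x = src PG x"
    using ax4[of x] unfolding inverses_def sel pts by simp
qed

section \<open>Closure properties of \<open>D\<close> and projections of pullbacks at a unit\<close>

lemma src_PG: "src PG (g, v, \<alpha>) = (u (s g), tunit \<Gamma> (s g) (tsrc \<Gamma> g v), cosrc \<Gamma> g \<alpha>)"
  and tgt_PG: "tgt PG (g, v, \<alpha>) = (u (t g), tunit \<Gamma> (t g) (ttgt \<Gamma> g v), cotgt \<Gamma> g \<alpha>)"
  and mult_PG: "mult PG (g, v, \<alpha>) (h, w, \<beta>) = (m g h, tmult \<Gamma> g h v w, comult \<Gamma> g h \<alpha> \<beta>)"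
  by (simp_all add: pontryagin_groupoid_def)

lemma dirac_arrow_iff: "dirac_arrow (g, v, \<alpha>) \<longleftrightarrow> g \<in> points G \<and> (v, \<alpha>) \<in> D g"
  by (simp add: dirac_arrow_def)

lemma D_src:
  assumes "p \<in> points P" "(w, \<beta>) \<in> D (u p)"
  shows "(tunit \<Gamma> p (tsrc \<Gamma> (u p) w), cosrc \<Gamma> (u p) \<beta>) \<in> D (u p)"
  using dirac_arrow_src[of "(u p, w, \<beta>)"] assms by (simp add: src_PG dirac_arrow_iff unit_arrow src_unit)

lemma D_tgt:
  assumes "p \<in> points P" "(w, \<beta>) \<in> D (u p)"
  shows "(tunit \<Gamma> p (ttgt \<Gamma> (u p) w), cotgt \<Gamma> (u p) \<beta>) \<in> D (u p)"
  using dirac_arrow_tgt[of "(u p, w, \<beta>)"] assms by (simp add: tgt_PG dirac_arrow_iff unit_arrow tgt_unit)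

lemma D_mult:
  assumes "g \<in> points G" "h \<in> points G" "s g = t h" "(v, \<alpha>) \<in> D g" "(w, \<beta>) \<in> D h"
    "tsrc \<Gamma> g v = ttgt \<Gamma> h w" "cosrc \<Gamma> g \<alpha> = cotgt \<Gamma> h \<beta>"
  shows "(tmult \<Gamma> g h v w, comult \<Gamma> g h \<alpha> \<beta>) \<in> D (m g h)"
  using dirac_arrow_mult[of "(g, v, \<alpha>)" "(h, w, \<beta>)"] assms
  by (simp add: src_PG tgt_PG mult_PG dirac_arrow_iff)

lemma D_tangent:
  assumes "g \<in> points G" "(v, \<alpha>) \<in> D g"
  shows "v \<in> tangent_space G g" "\<alpha> \<in> tangent_space G g"
  using D_subset[OF assms(1)] assms(2) by blast+

text \<open>Left translation by a unit is the identity on \<open>AG\<close>, and \<open>AG\<close>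
  is the kernel of \<open>Tt\<close>.\<close>

lemma cosrc_ctgt:
  assumes p: "p \<in> points P"
  shows "cosrc \<Gamma> (u p) (ctgt (u p) a) = 0"
proof (rule dual_algebroid_eqI[OF p _ zero_in_dual_algebroid])
  note e = unit_arrow[OF p]
  show "cosrc \<Gamma> (u p) (ctgt (u p) a) \<in> dual_algebroid_fibre \<Gamma> p"
    using cosrc_in[OF e] by (simp add: src_unit[OF p])
  fix v assume v: "v \<in> algebroid_fibre \<Gamma> p"
  then have "v \<in> tangent_space G (u p)" "ttgt \<Gamma> (u p) v = 0" by (simp_all add: algebroid_fibre_def)
  then show "cosrc \<Gamma> (u p) (ctgt (u p) a) \<bullet> v = 0 \<bullet> v"
    using inner_cosrc[OF e, of v] v by (simp add: src_unit[OF p] tleft_unit[OF p v] inner_ctgt[OF e])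
qed

text \<open>Right translation by a unit is the identity on the kernel of \<open>Ts\<close>, which
  contains \<open>v - T\<epsilon> (Ts v)\<close>; the image of that vector under \<open>Tt\<close>
  is \<open>- Ts v\<close> because \<open>Tt\<close> kills \<open>v\<close>.\<close>

lemma inner_cotgt_unit:
  assumes p: "p \<in> points P" and v: "v \<in> algebroid_fibre \<Gamma> p"
  shows "cotgt \<Gamma> (u p) \<beta> \<bullet> v = \<beta> \<bullet> (v - tunit \<Gamma> p (tsrc \<Gamma> (u p) v))"
    and "v - tunit \<Gamma> p (tsrc \<Gamma> (u p) v) \<in> tangent_space G (u p)"
    and "tsrc \<Gamma> (u p) (v - tunit \<Gamma> p (tsrc \<Gamma> (u p) v)) = 0"
    and "ttgt \<Gamma> (u p) (v - tunit \<Gamma> p (tsrc \<Gamma> (u p) v)) = - tsrc \<Gamma> (u p) v"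
proof -
  note e = unit_arrow[OF p]
  have vT: "v \<in> tangent_space G (u p)" "ttgt \<Gamma> (u p) v = 0" using v by (simp_all add: algebroid_fibre_def)
  have sv: "tsrc \<Gamma> (u p) v \<in> tangent_space P p" using tsrc_in[OF e vT(1)] by (simp add: src_unit[OF p])
  let ?z = "v - tunit \<Gamma> p (tsrc \<Gamma> (u p) v)"
  show z: "?z \<in> tangent_space G (u p)"
    by (intro subspace_diff subspace_tangent_space vT(1) tunit_in p sv)
  show zs: "tsrc \<Gamma> (u p) ?z = 0" by (simp add: linear_diff[OF linear_tsrc[OF e]] tsrc_tunit[OF p sv])
  show "ttgt \<Gamma> (u p) ?z = - tsrc \<Gamma> (u p) v"
    by (simp add: linear_diff[OF linear_ttgt[OF e]] ttgt_tunit[OF p sv] vT(2))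
  show "cotgt \<Gamma> (u p) \<beta> \<bullet> v = \<beta> \<bullet> ?z"
    using inner_cotgt[OF e, of v \<beta>] v by (simp add: tgt_unit[OF p] tright_unit[OF p z zs])
qed

text \<open>The difference of the pullbacks vanishes along \<open>TP\<close>, where
  \<open>Ts\<close> and \<open>Tt\<close> agree, and on \<open>AG\<close> both sides reduce to
  \<open>- a \<bullet> Ts v\<close>.\<close>

lemma cotgt_ctgt:
  assumes p: "p \<in> points P"
  shows "cotgt \<Gamma> (u p) (ctgt (u p) a) = ctgt (u p) a - csrc (u p) a"
proof (rule dual_algebroid_eqI[OF p])
  note e = unit_arrow[OF p]
  show "cotgt \<Gamma> (u p) (ctgt (u p) a) \<in> dual_algebroid_fibre \<Gamma> p"
    using cotgt_in[OF e] by (simp add: tgt_unit[OF p])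
  show "ctgt (u p) a - csrc (u p) a \<in> dual_algebroid_fibre \<Gamma> p"
    unfolding dual_algebroid_fibre_def
    using subspace_diff[OF subspace_tangent_space ctgt_in[OF e] csrc_in[OF e]]
    by (simp add: inner_diff_left inner_ctgt[OF e] inner_csrc[OF e] tunit_in[OF p] tsrc_tunit[OF p] ttgt_tunit[OF p])
  fix v assume v: "v \<in> algebroid_fibre \<Gamma> p"
  then have "v \<in> tangent_space G (u p)" "ttgt \<Gamma> (u p) v = 0" by (simp_all add: algebroid_fibre_def)
  then show "cotgt \<Gamma> (u p) (ctgt (u p) a) \<bullet> v = (ctgt (u p) a - csrc (u p) a) \<bullet> v"
    using inner_cotgt_unit[OF p v] by (simp add: inner_diff_left inner_ctgt[OF e] inner_csrc[OF e])
qed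

lemma cotgt_csrc:
  assumes p: "p \<in> points P"
  shows "cotgt \<Gamma> (u p) (csrc (u p) a) = 0"
proof (rule dual_algebroid_eqI[OF p _ zero_in_dual_algebroid])
  note e = unit_arrow[OF p]
  show "cotgt \<Gamma> (u p) (csrc (u p) a) \<in> dual_algebroid_fibre \<Gamma> p"
    using cotgt_in[OF e] by (simp add: tgt_unit[OF p])
  fix v assume v: "v \<in> algebroid_fibre \<Gamma> p"
  show "cotgt \<Gamma> (u p) (csrc (u p) a) \<bullet> v = 0 \<bullet> v"
    using inner_cotgt_unit[OF p v] by (simp add: inner_csrc[OF e])
qed

text \<open>The source projection of \<open>(w, t^* a)\<close> has covector 0 by
  \<open>cosrc_ctgt\<close>. This is where the distribution \<open>TP \<inter> G0\<close>
  enters.\<close>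

lemma tsrc_in_G0_units:
  assumes p: "p \<in> points P" and w: "(w, ctgt (u p) a) \<in> D (u p)"
  shows "tsrc \<Gamma> (u p) w \<in> G0_units \<Gamma> D p"
proof -
  note e = unit_arrow[OF p]
  have sw: "tsrc \<Gamma> (u p) w \<in> tangent_space P p"
    using tsrc_in[OF e D_tangent(1)[OF e w]] by (simp add: src_unit[OF p])
  have "(tunit \<Gamma> p (tsrc \<Gamma> (u p) w), 0) \<in> D (u p)" using D_src[OF p w] by (simp add: cosrc_ctgt[OF p])
  then show ?thesis using sw tunit_in[OF p sw] by (simp add: G0_units_def G0_def)
qed

text \<open>An element \<open>x\<close> over a unit whose source projection vanishes has the inverse \<open>t(x) - x\<close>; this turns
  a representative along \<open>t\<close> into one along \<open>s\<close> by linear algebra alone.\<close>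

lemma src_representative:
  assumes p: "p \<in> points P" and w: "(w, ctgt (u p) a) \<in> D (u p)"
  obtains w' where "(w', csrc (u p) a) \<in> D (u p)" "tsrc \<Gamma> (u p) w' = - ttgt \<Gamma> (u p) w"
    "ttgt \<Gamma> (u p) w' = - tsrc \<Gamma> (u p) w"
proof -
  note e = unit_arrow[OF p]
  note wT = D_tangent(1)[OF e w]
  have sw: "tsrc \<Gamma> (u p) w \<in> tangent_space P p" using tsrc_in[OF e wT] by (simp add: src_unit[OF p])
  have tw: "ttgt \<Gamma> (u p) w \<in> tangent_space P p" using ttgt_in[OF e wT] by (simp add: tgt_unit[OF p])
  have 1: "(tunit \<Gamma> p (ttgt \<Gamma> (u p) w), ctgt (u p) a - csrc (u p) a) \<in> D (u p)"
    using D_tgt[OF p w] by (simp add: cotgt_ctgt[OF p])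
  have 2: "(tunit \<Gamma> p (tsrc \<Gamma> (u p) w), 0) \<in> D (u p)" using D_src[OF p w] by (simp add: cosrc_ctgt[OF p])
  \<comment> \<open>The inverse of an element \<open>x\<close> over a unit is
    \<open>s(x) + t(x) - x\<close>. Its negative also lies in the linear space
    \<open>D (u p)\<close> and has covector exactly \<open>s^* a\<close>, at the price of the signs
    in the conclusion.\<close>
  from subspace_diff[OF subspace_D[OF e] subspace_diff[OF subspace_D[OF e] w 1] 2]
  have "(w - tunit \<Gamma> p (ttgt \<Gamma> (u p) w) - tunit \<Gamma> p (tsrc \<Gamma> (u p) w), csrc (u p) a) \<in> D (u p)" by simp
  then show thesis
  proof (rule that)
    show "tsrc \<Gamma> (u p) (w - tunit \<Gamma> p (ttgt \<Gamma> (u p) w) - tunit \<Gamma> p (tsrc \<Gamma> (u p) w)) = - ttgt \<Gamma> (u p) w"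
      by (simp add: linear_diff[OF linear_tsrc[OF e]] tsrc_tunit[OF p] sw tw)
    show "ttgt \<Gamma> (u p) (w - tunit \<Gamma> p (ttgt \<Gamma> (u p) w) - tunit \<Gamma> p (tsrc \<Gamma> (u p) w)) = - tsrc \<Gamma> (u p) w"
      by (simp add: linear_diff[OF linear_ttgt[OF e]] ttgt_tunit[OF p] sw tw)
  qed
qed

section \<open>Fibres of the induced structure\<close>

lemma induced_dirac_iff:
  assumes p: "p \<in> points P"
  shows "(v, \<alpha>) \<in> induced_dirac \<Gamma> D p \<longleftrightarrow>
    v \<in> tangent_space P p \<and> \<alpha> \<in> tangent_space P p \<and> (\<exists>w. (w, ctgt (u p) \<alpha>) \<in> D (u p) \<and> v = ttgt \<Gamma> (u p) w)"
proof -
  note e = unit_arrow[OF p]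
  have ann: "ctgt (u p) \<alpha> \<in> algebroid_annihilator \<Gamma> p"
    using ctgt_in[OF e] by (simp add: algebroid_annihilator_def algebroid_fibre_def inner_ctgt[OF e])
  show ?thesis
    unfolding induced_dirac_def pontryagin_fibre_def using ann D_tangent(1)[OF e] by auto
qed

lemma induced_dirac_lagrangian:
  assumes p: "p \<in> points P"
  shows "subspace (induced_dirac \<Gamma> D p)"
    and "induced_dirac \<Gamma> D p =
      {x \<in> tangent_space P p \<times> tangent_space P p. \<forall>y\<in>induced_dirac \<Gamma> D p. pairing x y = 0}"
proof -
  note e = unit_arrow[OF p]
  have surj: "ttgt \<Gamma> (u p) ` tangent_space G (u p) = tangent_space P p"
    using surj_ttgt[OF e] by (simp add: tgt_unit[OF p])
  have M: "induced_dirac \<Gamma> D p = {(v, \<alpha>). v \<in> tangent_space P p \<and> \<alpha> \<in> tangent_space P p \<and>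
      (\<exists>w. (w, pullback_covector (tangent_space G (u p)) (ttgt \<Gamma> (u p)) \<alpha>) \<in> D (u p) \<and> v = ttgt \<Gamma> (u p) w)}"
    using induced_dirac_iff[OF p] unfolding cotangent_map_def ttgt_def by auto
  show "subspace (induced_dirac \<Gamma> D p)"
    "induced_dirac \<Gamma> D p =
      {x \<in> tangent_space P p \<times> tangent_space P p. \<forall>y\<in>induced_dirac \<Gamma> D p. pairing x y = 0}"
    by (rule lagrangian_pushforward[OF subspace_tangent_space subspace_tangent_space linear_ttgt[OF e] surj
        subspace_D[OF e] D_subset[OF e] D_lagrangian[OF e] M])+
qed

lemma induced_dirac_of_section:
  assumes p: "p \<in> points P" and w: "(w, \<beta>) \<in> D (u p)" and X: "X \<in> G0_units \<Gamma> D p"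
  shows "(X + ttgt \<Gamma> (u p) w - tsrc \<Gamma> (u p) w, cotangent_map P G u p \<beta>) \<in> induced_dirac \<Gamma> D p"
proof -
  note e = unit_arrow[OF p]
  note wT = D_tangent[OF e w]
  let ?\<alpha> = "cotangent_map P G u p \<beta>"
  have \<alpha>: "?\<alpha> \<in> tangent_space P p" "\<And>x. x \<in> tangent_space P p \<Longrightarrow> ?\<alpha> \<bullet> x = \<beta> \<bullet> tunit \<Gamma> p x"
    using pullback_covector[OF subspace_tangent_space[of P p] linear_tunit[OF p]]
    by (simp_all add: cotangent_map_def tunit_def)
  have sw: "tsrc \<Gamma> (u p) w \<in> tangent_space P p" using tsrc_in[OF e wT(1)] by (simp add: src_unit[OF p])
  have tw: "ttgt \<Gamma> (u p) w \<in> tangent_space P p" using ttgt_in[OF e wT(1)] by (simp add: tgt_unit[OF p])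
  have XT: "X \<in> tangent_space P p" "(tunit \<Gamma> p X, 0) \<in> D (u p)" using X by (simp_all add: G0_units_def G0_def)
  \<comment> \<open>Tested on the two summands: along \<open>TP\<close> the \<open>cosrc\<close>
    term vanishes, and on \<open>AG\<close> it equals \<beta>, because left translation by a unit is
    the identity, while the pullback along \<open>t\<close> is 0.\<close>
  have eq: "\<beta> - cosrc \<Gamma> (u p) \<beta> = ctgt (u p) ?\<alpha>"
  proof (rule covector_unit_eqI[OF p])
    have co: "cosrc \<Gamma> (u p) \<beta> \<in> dual_algebroid_fibre \<Gamma> p" using cosrc_in[OF e] by (simp add: src_unit[OF p])
    then show "\<beta> - cosrc \<Gamma> (u p) \<beta> \<in> tangent_space G (u p)"
      by (intro subspace_diff subspace_tangent_space wT(2)) (simp add: dual_algebroid_fibre_def)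
    show "ctgt (u p) ?\<alpha> \<in> tangent_space G (u p)" by (rule ctgt_in[OF e])
    show "(\<beta> - cosrc \<Gamma> (u p) \<beta>) \<bullet> tunit \<Gamma> p x = ctgt (u p) ?\<alpha> \<bullet> tunit \<Gamma> p x" if x: "x \<in> tangent_space P p" for x
      using co x by (simp add: dual_algebroid_fibre_def inner_diff_left inner_ctgt[OF e tunit_in[OF p x]]
          ttgt_tunit[OF p x] \<alpha>(2))
    show "(\<beta> - cosrc \<Gamma> (u p) \<beta>) \<bullet> v = ctgt (u p) ?\<alpha> \<bullet> v" if v: "v \<in> algebroid_fibre \<Gamma> p" for v
      using v inner_cosrc[OF e, of v \<beta>] inner_ctgt[OF e, of v ?\<alpha>]
      by (simp add: src_unit[OF p] tleft_unit[OF p v] inner_diff_left) (simp add: algebroid_fibre_def)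
  qed
  have "(tunit \<Gamma> p X + (w - tunit \<Gamma> p (tsrc \<Gamma> (u p) w)), ctgt (u p) ?\<alpha>) \<in> D (u p)"
    using subspace_add[OF subspace_D[OF e] XT(2) subspace_diff[OF subspace_D[OF e] w D_src[OF p w]]]
    by (simp add: eq)
  moreover have "X + ttgt \<Gamma> (u p) w - tsrc \<Gamma> (u p) w =
      ttgt \<Gamma> (u p) (tunit \<Gamma> p X + (w - tunit \<Gamma> p (tsrc \<Gamma> (u p) w)))"
    by (simp add: linear_add[OF linear_ttgt[OF e]] linear_diff[OF linear_ttgt[OF e]] ttgt_tunit[OF p] sw XT(1))
  moreover have "X + ttgt \<Gamma> (u p) w - tsrc \<Gamma> (u p) w \<in> tangent_space P p"
    by (intro subspace_diff subspace_add subspace_tangent_space sw tw XT(1))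
  ultimately show ?thesis unfolding induced_dirac_iff[OF p] using \<alpha>(1) by blast
qed

section \<open>Forward Dirac properties, arrow by arrow\<close>

lemma G0_D: "v \<in> G0 \<Gamma> D g \<longleftrightarrow> v \<in> tangent_space G g \<and> (v, 0) \<in> D g"
  by (simp add: G0_def)

lemma tunit_inj:
  assumes p: "p \<in> points P" and "v \<in> tangent_space P p" "w \<in> tangent_space P p" "tunit \<Gamma> p v = tunit \<Gamma> p w"
  shows "v = w"
  using assms tsrc_tunit[OF p] by metis

text \<open>The hypothesis concerns targets; it is applied at the inverse of \<open>g\<close>, and
  inversion in the subgroupoid exchanges source and target. It remains to see that inversion keeps
  the covector 0, which is deduced from the groupoid equations without a formula for
  inversion.\<close>

lemma G0_src_surj:
  assumes surj: "\<forall>g\<in>points G. ttgt \<Gamma> g ` G0 \<Gamma> D g = G0_units \<Gamma> D (t g)"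
    and g: "g \<in> points G" and X: "X \<in> G0_units \<Gamma> D (s g)"
  obtains w where "w \<in> G0 \<Gamma> D g" "tsrc \<Gamma> g w = X"
proof -
  let ?i = "inverse_of \<Gamma> g"
  note i = inverse_arrow[OF g]
  have "X \<in> ttgt \<Gamma> ?i ` G0 \<Gamma> D ?i" unfolding bspec[OF surj i(1)] using X i(3) by simp
  then obtain v where v: "v \<in> tangent_space G ?i" "(v, 0) \<in> D ?i" "ttgt \<Gamma> ?i v = X"
    unfolding image_iff Bex_def G0_D by (elim exE conjE) simp
  have "dirac_arrow (?i, v, 0)" using v(2) i(1) by (simp add: dirac_arrow_iff)
  from dirac_arrow_inverse[OF this] obtain y where y: "dirac_arrow y" "src PG y = tgt PG (?i, v, 0)"
    "tgt PG y = src PG (?i, v, 0)" "mult PG (?i, v, 0) y = tgt PG (?i, v, 0)" "mult PG y (?i, v, 0) = src PG (?i, v, 0)"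
    by (elim exE conjE) (rule that)
  obtain h w \<beta> where yh: "y = (h, w, \<beta>)" by (cases y)
  have h: "h \<in> points G" "(w, \<beta>) \<in> D h" using y(1) yh by (simp_all add: dirac_arrow_iff)
  note y2 = y(2)[unfolded yh src_PG tgt_PG prod.inject] and y5 = y(5)[unfolded yh mult_PG src_PG prod.inject]
  \<comment> \<open>Object equations arrive as equations between units; applying \<open>s\<close>
    removes the embedding \<open>u\<close>.\<close>
  have "s (u (s h)) = s (u (s g))" using y2 by (simp only: i(3))
  then have shg: "s h = s g"
    unfolding src_unit[OF arrow_src[OF h(1)]] src_unit[OF arrow_src[OF g]] .
  have hg: "h = g"
  proof -
    have hi: "m h ?i = u (t g)" using y5 by (simp only: i(2))
    have "h = m h (m ?i g)" using mult_unit[OF h(1)] by (simp add: i(5) shg)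
    also have "\<dots> = m (m h ?i) g" by (rule mult_assoc[OF h(1) i(1) g, symmetric]) (simp_all add: i(2,3) shg)
    also have "\<dots> = g" unfolding hi by (rule unit_mult[OF g])
    finally show ?thesis .
  qed
  have wT: "w \<in> tangent_space G g" "\<beta> \<in> tangent_space G g" using D_tangent[OF h(1,2)] by (simp_all add: hg)
  have "tunit \<Gamma> (s g) (tsrc \<Gamma> g w) = tunit \<Gamma> (s g) X"
    and cs: "cosrc \<Gamma> g \<beta> = cotgt \<Gamma> ?i 0"
    using y2 by (simp_all only: hg i(3) v(3))
  then have wX: "tsrc \<Gamma> g w = X"
    using tunit_inj[OF arrow_src[OF g] tsrc_in[OF g wT(1)], of X] X by (simp add: G0_units_def)
  have "cosrc \<Gamma> g \<beta> = 0" using cs by (simp add: cotgt_zero[OF i(1)])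
  \<comment> \<open>The source projection of \<beta> is the target projection of 0, so \<beta> is a
    pullback along \<open>t\<close>, the shape for which \<open>comult\<close> can be
    computed.\<close>
  then obtain a where a: "\<beta> = ctgt g a" by (rule cosrc_zero_imp_pullback[OF g wT(2)])
  \<comment> \<open>The product with the inverse is a unit whose covector is the source projection
    of 0. Written with \<open>0 = s^* 0\<close>, the same product is \<open>t^* a\<close> at
    \<open>u (t g)\<close>, so \<open>a\<close> vanishes on the tangent space of \<open>P\<close>
    and \<beta> is 0.\<close>
  have "comult \<Gamma> g ?i \<beta> 0 = 0"
    using y5 by (simp only: hg cosrc_zero[OF i(1)])
  moreover have "comult \<Gamma> g ?i (ctgt g a) (csrc ?i 0) = ctgt (u (t g)) a + csrc (u (t g)) 0"
    using comult_pullbacks[OF g i(1), of a 0] by (simp add: i)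
  ultimately have z: "ctgt (u (t g)) a = 0"
    using csrc_zero[OF i(1)] csrc_zero[OF unit_arrow[OF arrow_tgt[OF g]]] a by simp
  have "\<beta> = 0"
  proof (rule subspace_eqI_inner[OF subspace_tangent_space wT(2) subspace_0[OF subspace_tangent_space]])
    fix x assume x: "x \<in> tangent_space G g"
    note tg = arrow_tgt[OF g]
    have tx: "ttgt \<Gamma> g x \<in> tangent_space P (t g)" by (rule ttgt_in[OF g x])
    have "a \<bullet> ttgt \<Gamma> g x = ctgt (u (t g)) a \<bullet> tunit \<Gamma> (t g) (ttgt \<Gamma> g x)"
      by (simp add: inner_ctgt[OF unit_arrow[OF tg] tunit_in[OF tg tx]] ttgt_tunit[OF tg tx])
    then show "\<beta> \<bullet> x = 0 \<bullet> x" by (simp add: a inner_ctgt[OF g x] z)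
  qed
  then have "w \<in> G0 \<Gamma> D g" using h(2) wT(1) by (simp add: hg G0_D)
  then show thesis using wX by (rule that)
qed

lemma tgt_forward:
  assumes surj: "\<forall>g\<in>points G. ttgt \<Gamma> g ` G0 \<Gamma> D g = G0_units \<Gamma> D (t g)"
    and g: "g \<in> points G" and v: "(v, \<alpha>) \<in> induced_dirac \<Gamma> D (t g)"
  obtains x where "(x, ctgt g \<alpha>) \<in> D g" "ttgt \<Gamma> g x = v"
proof -
  let ?p = "t g"
  note p = arrow_tgt[OF g] and e = unit_arrow[OF arrow_tgt[OF g]]
  obtain w where w: "(w, ctgt (u ?p) \<alpha>) \<in> D (u ?p)" "v = ttgt \<Gamma> (u ?p) w"
    using v unfolding induced_dirac_iff[OF p] by (elim exE conjE) (rule that)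
  have "tsrc \<Gamma> (u ?p) w \<in> ttgt \<Gamma> g ` G0 \<Gamma> D g" unfolding bspec[OF surj g] by (rule tsrc_in_G0_units[OF p w(1)])
  then obtain y where y: "y \<in> tangent_space G g" "(y, 0) \<in> D g" "ttgt \<Gamma> g y = tsrc \<Gamma> (u ?p) w"
    unfolding image_iff Bex_def G0_D by (elim exE conjE) simp
  have "(tmult \<Gamma> (u ?p) g w y, comult \<Gamma> (u ?p) g (ctgt (u ?p) \<alpha>) 0) \<in> D (m (u ?p) g)"
    by (rule D_mult[OF e g _ w(1) y(2)])
      (simp_all add: src_unit[OF p] y(3) cosrc_ctgt[OF p] cotgt_zero[OF g])
  \<comment> \<open>The zero covector over \<open>g\<close> is read as \<open>s^* 0\<close>, which
    brings the product under \<open>comult_pullbacks\<close>.\<close>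
  moreover have "comult \<Gamma> (u ?p) g (ctgt (u ?p) \<alpha>) (csrc g 0) = ctgt (m (u ?p) g) \<alpha> + csrc (m (u ?p) g) 0"
    by (rule comult_pullbacks[OF e g src_unit[OF p]])
  ultimately have "(tmult \<Gamma> (u ?p) g w y, ctgt g \<alpha>) \<in> D g"
    by (simp add: unit_mult[OF g] csrc_zero[OF g])
  moreover have "ttgt \<Gamma> g (tmult \<Gamma> (u ?p) g w y) = v"
    using ttgt_tmult[OF e g src_unit[OF p] D_tangent(1)[OF e w(1)] y(1)] y(3) w(2) by (simp add: unit_mult[OF g])
  ultimately show thesis by (rule that)
qed

text \<open>The representative along \<open>s\<close> multiplies from the right. The signs in
  \<open>src_representative\<close> force the factor \<open>- y\<close> and produce
  \<open>- v\<close>, which is why \<open>s\<close> is forward Dirac onto the opposite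
  structure.\<close>

lemma src_forward:
  assumes surj: "\<forall>g\<in>points G. ttgt \<Gamma> g ` G0 \<Gamma> D g = G0_units \<Gamma> D (t g)"
    and g: "g \<in> points G" and v: "(v, \<alpha>) \<in> induced_dirac \<Gamma> D (s g)"
  obtains x where "(x, csrc g \<alpha>) \<in> D g" "tsrc \<Gamma> g x = - v"
proof -
  let ?p = "s g"
  note p = arrow_src[OF g] and e = unit_arrow[OF arrow_src[OF g]]
  obtain w where w: "(w, ctgt (u ?p) \<alpha>) \<in> D (u ?p)" "v = ttgt \<Gamma> (u ?p) w"
    using v unfolding induced_dirac_iff[OF p] by (elim exE conjE) (rule that)
  obtain w' where w': "(w', csrc (u ?p) \<alpha>) \<in> D (u ?p)" "tsrc \<Gamma> (u ?p) w' = - ttgt \<Gamma> (u ?p) w"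
    "ttgt \<Gamma> (u ?p) w' = - tsrc \<Gamma> (u ?p) w"
    by (rule src_representative[OF p w(1)])
  have "tsrc \<Gamma> (u ?p) w \<in> G0_units \<Gamma> D (s g)" by (rule tsrc_in_G0_units[OF p w(1)])
  then obtain y where y: "y \<in> G0 \<Gamma> D g" "tsrc \<Gamma> g y = tsrc \<Gamma> (u ?p) w" by (rule G0_src_surj[OF surj g])
  have yD: "y \<in> tangent_space G g" "(y, 0) \<in> D g" using y(1) by (simp_all add: G0_D)
  have y': "(- y, 0) \<in> D g" using subspace_neg[OF subspace_D[OF g] yD(2)] by simp
  have sy: "tsrc \<Gamma> g (- y) = ttgt \<Gamma> (u ?p) w'" by (simp add: linear_neg[OF linear_tsrc[OF g]] y(2) w'(3))
  have "(tmult \<Gamma> g (u ?p) (- y) w', comult \<Gamma> g (u ?p) 0 (csrc (u ?p) \<alpha>)) \<in> D (m g (u ?p))"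
    by (rule D_mult[OF g e _ y' w'(1) sy]) (simp_all add: tgt_unit[OF p] cosrc_zero[OF g] cotgt_csrc[OF p])
  moreover have "comult \<Gamma> g (u ?p) (ctgt g 0) (csrc (u ?p) \<alpha>) = ctgt (m g (u ?p)) 0 + csrc (m g (u ?p)) \<alpha>"
    by (rule comult_pullbacks[OF g e tgt_unit[OF p, symmetric]])
  ultimately have "(tmult \<Gamma> g (u ?p) (- y) w', csrc g \<alpha>) \<in> D g"
    by (simp add: mult_unit[OF g] ctgt_zero[OF g])
  moreover have "tsrc \<Gamma> g (tmult \<Gamma> g (u ?p) (- y) w') = - v"
    using tsrc_tmult[OF g e tgt_unit[OF p, symmetric] D_tangent(1)[OF g y'] D_tangent(1)[OF e w'(1)] sy] w'(2) w(2)
    by (simp add: mult_unit[OF g])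
  ultimately show thesis by (rule that)
qed

end

section \<open>Smooth sections in charts\<close>

definition tcoord :: "('a, 'e::euclidean_space) manifold \<Rightarrow> ('a, 'e) chart \<Rightarrow> 'a \<Rightarrow> 'e \<Rightarrow> 'e" where
  "tcoord M c q = coord_change (chart_at M q) c q"

text \<open>The covector slot of \<open>pontryagin_chart\<close>. Covectors are transported by the
  inverse coordinate change, so that evaluation on vectors is preserved, as
  \<open>ccoord_tcoord\<close> states.\<close>

definition ccoord :: "('a, 'e::euclidean_space) manifold \<Rightarrow> ('a, 'e) chart \<Rightarrow> 'a \<Rightarrow> 'e \<Rightarrow> 'e" where
  "ccoord M c q = pullback_covector (chart_space c) (coord_change c (chart_at M q) q)"

definition pcoord :: "('a, 'e::euclidean_space) manifold \<Rightarrow> ('a, 'e) chart \<Rightarrow> 'a \<Rightarrow> 'e \<times> 'e \<Rightarrow> 'e \<times> 'e" where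
  "pcoord M c q x = (tcoord M c q (fst x), ccoord M c q (snd x))"

lemma chart_point: "c \<in> atlas M \<Longrightarrow> q \<in> fst c \<Longrightarrow> q \<in> points M"
  by (auto simp: points_def)

context
  fixes M :: "('a, 'e::euclidean_space) manifold" and c :: "('a, 'e) chart" and q :: 'a
  assumes M: "smooth_manifold M" and c: "c \<in> atlas M" "q \<in> fst c"
begin

lemma chart_at_point: "chart_at M q \<in> atlas M" "q \<in> fst (chart_at M q)"
  using chart_at[OF smooth_manifold_imp_chart_system[OF M] chart_point[OF c]] by simp_all

lemma linear_tcoord: "linear (tcoord M c q)"
  unfolding tcoord_def by (rule linear_coord_change[OF M chart_at_point c])

lemma linear_tcoord_back: "linear (coord_change c (chart_at M q) q)"
  by (rule linear_coord_change[OF M c chart_at_point])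

lemma tcoord_in: "v \<in> tangent_space M q \<Longrightarrow> tcoord M c q v \<in> chart_space c"
  unfolding tcoord_def tangent_space_def by (rule coord_change_in[OF M chart_at_point c])

lemma tcoord_back_in: "w \<in> chart_space c \<Longrightarrow> coord_change c (chart_at M q) q w \<in> tangent_space M q"
  unfolding tangent_space_def by (rule coord_change_in[OF M c chart_at_point])

lemma tcoord_back: "w \<in> chart_space c \<Longrightarrow> tcoord M c q (coord_change c (chart_at M q) q w) = w"
  unfolding tcoord_def by (rule coord_change_inverse[OF M c chart_at_point])

lemma back_tcoord: "v \<in> tangent_space M q \<Longrightarrow> coord_change c (chart_at M q) q (tcoord M c q v) = v"
  unfolding tcoord_def tangent_space_def by (rule coord_change_inverse[OF M chart_at_point c])

lemma ccoord_in: "ccoord M c q \<alpha> \<in> chart_space c"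
  and inner_ccoord: "w \<in> chart_space c \<Longrightarrow> ccoord M c q \<alpha> \<bullet> w = \<alpha> \<bullet> coord_change c (chart_at M q) q w"
  unfolding ccoord_def by (rule pullback_covector[OF subspace_chart_space linear_tcoord_back], assumption?)+

lemma ccoord_tcoord: "v \<in> tangent_space M q \<Longrightarrow> ccoord M c q \<alpha> \<bullet> tcoord M c q v = \<alpha> \<bullet> v"
  by (simp add: inner_ccoord tcoord_in back_tcoord)

lemma linear_ccoord: "linear (ccoord M c q)"
  unfolding ccoord_def pullback_covector_eq[OF subspace_chart_space linear_tcoord_back] covector_of_def
  by (rule linearI) (simp_all add: inner_add_left scaleR_add_left sum.distrib scaleR_sum_right)

lemma linear_pcoord: "linear (pcoord M c q)"
  by (rule linearI)
    (simp_all add: pcoord_def linear_add[OF linear_tcoord] linear_add[OF linear_ccoord]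
      linear_scale[OF linear_tcoord] linear_scale[OF linear_ccoord])

lemma inj_on_pcoord: "inj_on (pcoord M c q) (pontryagin_fibre M q)"
proof (rule inj_onI)
  fix x y assume x: "x \<in> pontryagin_fibre M q" and y: "y \<in> pontryagin_fibre M q" and eq: "pcoord M c q x = pcoord M c q y"
  have T: "fst x \<in> tangent_space M q" "snd x \<in> tangent_space M q" "fst y \<in> tangent_space M q" "snd y \<in> tangent_space M q"
    using x y by (auto simp: pontryagin_fibre_def)
  have 1: "tcoord M c q (fst x) = tcoord M c q (fst y)" and 2: "ccoord M c q (snd x) = ccoord M c q (snd y)"
    using eq by (simp_all add: pcoord_def)
  have "fst y = fst x" using back_tcoord[OF T(1)] unfolding 1 back_tcoord[OF T(3)] .
  moreover have "snd x = snd y"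
  proof (rule subspace_eqI_inner[OF subspace_tangent_space T(2,4)])
    fix v assume v: "v \<in> tangent_space M q"
    show "snd x \<bullet> v = snd y \<bullet> v"
      using ccoord_tcoord[OF v, of "snd x"] unfolding 2 ccoord_tcoord[OF v] by (rule sym)
  qed
  ultimately show "x = y" by (intro prod_eqI) simp_all
qed

text \<open>The two coordinate changes are mutually inverse. Hence all tangent spaces over one chart
  have the same dimension, although the preferred charts vary from point to point.\<close>

lemma dim_tangent_space: "dim (tangent_space M q) = dim (chart_space c)"
proof (rule antisym)
  let ?b = "coord_change c (chart_at M q) q"
  have "tangent_space M q \<subseteq> ?b ` chart_space c"
  proof
    fix v assume v: "v \<in> tangent_space M q"
    show "v \<in> ?b ` chart_space c" by (rule image_eqI, rule back_tcoord[OF v, symmetric], rule tcoord_in[OF v])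
  qed
  then have "dim (tangent_space M q) \<le> dim (?b ` chart_space c)" by (rule dim_subset)
  also have "\<dots> \<le> dim (chart_space c)" by (rule dim_image_le[OF linear_tcoord_back])
  finally show "dim (tangent_space M q) \<le> dim (chart_space c)" .
  have "chart_space c \<subseteq> tcoord M c q ` tangent_space M q"
  proof
    fix w assume w: "w \<in> chart_space c"
    show "w \<in> tcoord M c q ` tangent_space M q" by (rule image_eqI, rule tcoord_back[OF w, symmetric], rule tcoord_back_in[OF w])
  qed
  then have "dim (chart_space c) \<le> dim (tcoord M c q ` tangent_space M q)" by (rule dim_subset)
  also have "\<dots> \<le> dim (tangent_space M q)" by (rule dim_image_le[OF linear_tcoord])
  finally show "dim (chart_space c) \<le> dim (tangent_space M q)" .
qed

end

section \<open>Pontryagin charts and smooth sections\<close>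

lemma fst_pontryagin_chart: "(q, x) \<in> fst (pontryagin_chart M c) \<longleftrightarrow> q \<in> fst c \<and> x \<in> pontryagin_fibre M q"
  by (cases x) (simp add: pontryagin_chart_def pontryagin_fibre_def)

lemma snd_pontryagin_chart: "snd (pontryagin_chart M c) (q, x) = (snd c q, pcoord M c q x)"
  by (cases x) (simp add: pontryagin_chart_def pcoord_def tcoord_def ccoord_def)

lemma fst_tangent_chart: "(q, v) \<in> fst (tangent_chart M c) \<longleftrightarrow> q \<in> fst c \<and> v \<in> tangent_space M q"
  by (simp add: tangent_chart_def)

lemma snd_tangent_chart: "snd (tangent_chart M c) (q, v) = (snd c q, tcoord M c q v)"
  by (simp add: tangent_chart_def tcoord_def)

lemma atlas_pontryagin_bundle: "atlas (pontryagin_bundle M) = pontryagin_chart M ` atlas M"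
  by (simp add: pontryagin_bundle_def)

lemma atlas_tangent_bundle: "atlas (tangent_bundle M) = tangent_chart M ` atlas M"
  by (simp add: tangent_bundle_def)

lemma points_pontryagin_bundle: "(q, x) \<in> points (pontryagin_bundle M) \<longleftrightarrow> q \<in> points M \<and> x \<in> pontryagin_fibre M q"
  unfolding points_def atlas_pontryagin_bundle by (simp add: fst_pontryagin_chart)

lemma points_tangent_bundle: "(q, v) \<in> points (tangent_bundle M) \<longleftrightarrow> q \<in> points M \<and> v \<in> tangent_space M q"
  unfolding points_def atlas_tangent_bundle by (simp add: fst_tangent_chart)

text \<open>Base and fibre are read in the same chart. On an open set this is equivalent to
  smoothness as a map into \<open>pontryagin_bundle\<close>, but it is linear in the section and
  free of the topology of the bundle.\<close>

definition smooth_section ::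
  "('a, 'e::euclidean_space) manifold \<Rightarrow> 'a set \<Rightarrow> ('a \<Rightarrow> 'e \<times> 'e) \<Rightarrow> bool" where
  "smooth_section M U \<sigma> \<longleftrightarrow>
     openin (manifold_topology M) U \<and> (\<forall>q\<in>U. \<sigma> q \<in> pontryagin_fibre M q) \<and>
     (\<forall>c\<in>atlas M. smooth_on (snd c ` (U \<inter> fst c)) (\<lambda>x. pcoord M c (chart_inv c x) (\<sigma> (chart_inv c x))))"

lemma smooth_on_chart_image_cong:
  assumes inj: "inj_on (snd c) (fst c)" and S: "S \<subseteq> fst c" and f: "smooth_on (snd c ` S) f"
    and eq: "\<And>q. q \<in> S \<Longrightarrow> f (snd c q) = g q"
  shows "smooth_on (snd c ` S) (\<lambda>x. g (chart_inv c x))"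
proof (rule smooth_on_cong[OF f subset_refl])
  fix x assume "x \<in> snd c ` S"
  then obtain q where q: "q \<in> S" "x = snd c q" by blast
  then show "f x = g (chart_inv c x)" using eq[OF q(1)] chart_inv_eq[OF inj subsetD[OF S q(1)]] by simp
qed

lemma smooth_section_of_map:
  assumes M: "smooth_manifold M" and U: "openin (manifold_topology M) U"
    and \<sigma>: "smooth_map_on M U (pontryagin_bundle M) (\<lambda>q. (q, \<sigma> q))"
  shows "smooth_section M U \<sigma>"
  unfolding smooth_section_def
proof (intro conjI ballI U)
  fix q assume q: "q \<in> U"
  have "(q, \<sigma> q) \<in> points (pontryagin_bundle M)" using \<sigma> q unfolding smooth_map_on_def by blast
  then show "\<sigma> q \<in> pontryagin_fibre M q" unfolding points_pontryagin_bundle by blast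
next
  fix c assume c: "c \<in> atlas M"
  have fib: "\<sigma> q \<in> pontryagin_fibre M q" if "q \<in> U" for q
  proof -
    have "(q, \<sigma> q) \<in> points (pontryagin_bundle M)" using \<sigma> that unfolding smooth_map_on_def by blast
    then show ?thesis unfolding points_pontryagin_bundle by blast
  qed
  let ?F = "\<lambda>q. (q, \<sigma> q)" and ?d = "pontryagin_chart M c"
  have "?d \<in> atlas (pontryagin_bundle M)" unfolding atlas_pontryagin_bundle using c by blast
  then have "smooth_on (snd c ` (U \<inter> fst c \<inter> ?F -` fst ?d)) (snd ?d \<circ> ?F \<circ> chart_inv c)"
    using \<sigma> c unfolding smooth_map_on_def by blast
  moreover have "U \<inter> fst c \<inter> ?F -` fst ?d = U \<inter> fst c"
    using fib by (auto simp: fst_pontryagin_chart)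
  ultimately have "smooth_on (snd c ` (U \<inter> fst c)) (snd ?d \<circ> ?F \<circ> chart_inv c)" by simp
  from smooth_on_snd[OF this]
  show "smooth_on (snd c ` (U \<inter> fst c)) (\<lambda>x. pcoord M c (chart_inv c x) (\<sigma> (chart_inv c x)))"
    by (simp add: snd_pontryagin_chart)
qed

lemma smooth_vector_field_of_map:
  assumes M: "smooth_manifold M" and U: "openin (manifold_topology M) U"
    and X: "smooth_map_on M U (tangent_bundle M) (\<lambda>q. (q, X q))"
  shows "q \<in> U \<Longrightarrow> X q \<in> tangent_space M q"
    and "c \<in> atlas M \<Longrightarrow> smooth_on (snd c ` (U \<inter> fst c)) (\<lambda>x. tcoord M c (chart_inv c x) (X (chart_inv c x)))"
proof -
  have fib: "X q \<in> tangent_space M q" if "q \<in> U" for q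
  proof -
    have "(q, X q) \<in> points (tangent_bundle M)" using X that unfolding smooth_map_on_def by blast
    then show ?thesis unfolding points_tangent_bundle by blast
  qed
  then show "q \<in> U \<Longrightarrow> X q \<in> tangent_space M q" .
  assume c: "c \<in> atlas M"
  let ?F = "\<lambda>q. (q, X q)" and ?d = "tangent_chart M c"
  have "?d \<in> atlas (tangent_bundle M)" unfolding atlas_tangent_bundle using c by blast
  then have "smooth_on (snd c ` (U \<inter> fst c \<inter> ?F -` fst ?d)) (snd ?d \<circ> ?F \<circ> chart_inv c)"
    using X c unfolding smooth_map_on_def by blast
  moreover have "U \<inter> fst c \<inter> ?F -` fst ?d = U \<inter> fst c"
    using fib by (auto simp: fst_tangent_chart)
  ultimately have "smooth_on (snd c ` (U \<inter> fst c)) (snd ?d \<circ> ?F \<circ> chart_inv c)" by simp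
  from smooth_on_snd[OF this]
  show "smooth_on (snd c ` (U \<inter> fst c)) (\<lambda>x. tcoord M c (chart_inv c x) (X (chart_inv c x)))"
    by (simp add: snd_tangent_chart)
qed

lemma openin_chart_preimage:
  assumes c: "c \<in> atlas M" and U: "openin (manifold_topology M) U"
    and f: "continuous_on (snd c ` (U \<inter> fst c)) f" and W: "open W"
  shows "openin (manifold_topology M) {q \<in> U \<inter> fst c. f (snd c q) \<in> W}"
proof -
  have "openin (top_of_set (snd c ` (U \<inter> fst c))) (snd c ` (U \<inter> fst c) \<inter> f -` W)"
    by (rule continuous_openin_preimage_gen[OF f W])
  then obtain W' where W': "open W'" "snd c ` (U \<inter> fst c) \<inter> f -` W = snd c ` (U \<inter> fst c) \<inter> W'"
    unfolding openin_open by (elim exE conjE) (rule that)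
  have "f (snd c q) \<in> W \<longleftrightarrow> snd c q \<in> W'" if "q \<in> U \<inter> fst c" for q
  proof -
    have "snd c q \<in> snd c ` (U \<inter> fst c)" using that by (rule imageI)
    then show ?thesis using W'(2) by blast
  qed
  then have "{q \<in> U \<inter> fst c. f (snd c q) \<in> W} = U \<inter> (fst c \<inter> snd c -` W')" by auto
  then show ?thesis using openin_Int[OF U openin_chart_domain[OF c W'(1)]] by simp
qed

text \<open>The base component of a section is the identity, so preimages of bundle charts are cut
  out in the base; when the charts on the two sides differ, the transition map is composed with the
  expression in a single chart.\<close>

lemma smooth_section_imp_map:
  assumes M: "smooth_manifold M" and \<sigma>: "smooth_section M U \<sigma>"
  shows "smooth_map_on M U (pontryagin_bundle M) (\<lambda>q. (q, \<sigma> q))"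
proof -
  let ?F = "\<lambda>q. (q, \<sigma> q)"
  have U: "openin (manifold_topology M) U" and fib: "\<And>q. q \<in> U \<Longrightarrow> \<sigma> q \<in> pontryagin_fibre M q"
    and sm: "\<And>c. c \<in> atlas M \<Longrightarrow> smooth_on (snd c ` (U \<inter> fst c)) (\<lambda>x. pcoord M c (chart_inv c x) (\<sigma> (chart_inv c x)))"
    using \<sigma> by (simp_all add: smooth_section_def)
  have UM: "U \<subseteq> points M" using openin_subset[OF U] by (simp add: topspace_manifold_topology)
  have ts: "topspace (subtopology (manifold_topology M) U) = U"
    using UM by (auto simp: topspace_manifold_topology)
  have FU: "?F ` U \<subseteq> points (pontryagin_bundle M)"
    using UM fib by (auto simp: points_pontryagin_bundle)
  have sm2: "smooth_on (snd c ` (U \<inter> fst c)) (\<lambda>x. (x, pcoord M c (chart_inv c x) (\<sigma> (chart_inv c x))))"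
    if "c \<in> atlas M" for c
    by (rule smooth_on_Pair[OF smooth_on_linear[OF bounded_linear_ident] sm[OF that]])
  have "continuous_map (subtopology (manifold_topology M) U) (manifold_topology (pontryagin_bundle M)) ?F"
    unfolding manifold_topology_def[of "pontryagin_bundle M"]
  proof (rule continuous_on_generated_topo)
    fix V assume "V \<in> {fst d \<inter> snd d -` W | d W. d \<in> atlas (pontryagin_bundle M) \<and> open W}"
    then obtain c W where c: "c \<in> atlas M" and W: "open W"
      and V: "V = fst (pontryagin_chart M c) \<inter> snd (pontryagin_chart M c) -` W"
      unfolding mem_Collect_eq atlas_pontryagin_bundle by (elim exE conjE imageE) simp
    let ?f = "\<lambda>x. (x, pcoord M c (chart_inv c x) (\<sigma> (chart_inv c x)))"
    have "?F -` V \<inter> topspace (subtopology (manifold_topology M) U) = {q \<in> U \<inter> fst c. ?f (snd c q) \<in> W}"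
      unfolding ts V using fib chart_inv_eq[OF inj_chart[OF M c]]
      by (auto simp: fst_pontryagin_chart snd_pontryagin_chart)
    moreover have "openin (manifold_topology M) {q \<in> U \<inter> fst c. ?f (snd c q) \<in> W}"
      by (rule openin_chart_preimage[OF c U smooth_on_continuous[OF sm2[OF c]] W])
    moreover have "{q \<in> U \<inter> fst c. ?f (snd c q) \<in> W} \<subseteq> U" by blast
    ultimately show "openin (subtopology (manifold_topology M) U) (?F -` V \<inter> topspace (subtopology (manifold_topology M) U))"
      by (simp add: openin_open_subtopology[OF U])
  next
    have "points (pontryagin_bundle M) = \<Union> {fst d \<inter> snd d -` W | d W. d \<in> atlas (pontryagin_bundle M) \<and> open W}"
      using topspace_manifold_topology[of "pontryagin_bundle M"]
      unfolding manifold_topology_def topology_generated_by_topspace by simp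
    then show "?F ` topspace (subtopology (manifold_topology M) U) \<subseteq>
        \<Union> {fst d \<inter> snd d -` W | d W. d \<in> atlas (pontryagin_bundle M) \<and> open W}"
      using FU unfolding ts by simp
  qed
  moreover have "smooth_on (snd c ` (U \<inter> fst c \<inter> ?F -` fst d)) (snd d \<circ> ?F \<circ> chart_inv c)"
    if c: "c \<in> atlas M" and d: "d \<in> atlas (pontryagin_bundle M)" for c d
  proof -
    obtain c' where c': "c' \<in> atlas M" "d = pontryagin_chart M c'"
      using d unfolding atlas_pontryagin_bundle by (elim imageE) simp
    let ?S = "U \<inter> fst c \<inter> ?F -` fst d"
    have S: "?S \<subseteq> fst c" "\<And>q. q \<in> ?S \<Longrightarrow> q \<in> U \<and> q \<in> fst c \<and> q \<in> fst c'"
      using c'(2) by (auto simp: fst_pontryagin_chart)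
    have tr: "smooth_on (snd c ` ?S) (snd c' \<circ> chart_inv c)"
    proof (rule smooth_on_subset)
      show "smooth_on (snd c ` (fst c \<inter> fst c')) (snd c' \<circ> chart_inv c)"
        using compatible_charts[OF M c c'(1)] by (simp add: compatible_def)
      show "snd c ` ?S \<subseteq> snd c ` (fst c \<inter> fst c')" using S(2) by blast
    qed
    have "smooth_on (snd c ` ?S) (\<lambda>x. (\<lambda>x. (x, pcoord M c' (chart_inv c' x) (\<sigma> (chart_inv c' x)))) ((snd c' \<circ> chart_inv c) x))"
    proof (rule smooth_on_compose[OF sm2[OF c'(1)] tr])
      show "(snd c' \<circ> chart_inv c) ` (snd c ` ?S) \<subseteq> snd c' ` (U \<inter> fst c')"
      proof (intro subsetI)
        fix y assume "y \<in> (snd c' \<circ> chart_inv c) ` (snd c ` ?S)"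
        then obtain q where q: "q \<in> ?S" "y = (snd c' \<circ> chart_inv c) (snd c q)" by blast
        then show "y \<in> snd c' ` (U \<inter> fst c')"
          using S(2)[OF q(1)] chart_inv_eq[OF inj_chart[OF M c]] by simp
      qed
    qed
    then have "smooth_on (snd c ` ?S) (\<lambda>x. (snd d \<circ> ?F) (chart_inv c x))"
    proof (rule smooth_on_chart_image_cong[OF inj_chart[OF M c] S(1)])
      fix q assume "q \<in> ?S"
      then have q: "q \<in> fst c" "q \<in> fst c'" using S(2) by blast+
      show "(\<lambda>x. (x, pcoord M c' (chart_inv c' x) (\<sigma> (chart_inv c' x)))) ((snd c' \<circ> chart_inv c) (snd c q)) = (snd d \<circ> ?F) q"
        by (simp add: c'(2) snd_pontryagin_chart chart_inv_eq[OF inj_chart[OF M c] q(1)] chart_inv_eq[OF inj_chart[OF M c'(1)] q(2)])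
    qed
    then show ?thesis by (simp add: o_def)
  qed
  ultimately show ?thesis using UM FU unfolding smooth_map_on_def by blast
qed

lemma smooth_section_linear_combination:
  assumes M: "smooth_manifold M" and I: "finite I" and U: "openin (manifold_topology M) U"
    and \<sigma>: "\<And>i. i \<in> I \<Longrightarrow> smooth_section M U (\<sigma> i)"
  shows "smooth_section M U (\<lambda>q. \<Sum>i\<in>I. a i *\<^sub>R \<sigma> i q)"
  unfolding smooth_section_def
proof (intro conjI ballI U)
  fix q assume q: "q \<in> U"
  have sub: "subspace (pontryagin_fibre M q)"
    unfolding pontryagin_fibre_def by (rule subspace_Times[OF subspace_tangent_space subspace_tangent_space])
  have "\<sigma> i q \<in> pontryagin_fibre M q" if "i \<in> I" for i
    using \<sigma>[OF that] q by (simp add: smooth_section_def)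
  then show "(\<Sum>i\<in>I. a i *\<^sub>R \<sigma> i q) \<in> pontryagin_fibre M q"
    by (rule subspace_sum[OF sub subspace_scale[OF sub]])
next
  fix c assume c: "c \<in> atlas M"
  have "smooth_on (snd c ` (U \<inter> fst c)) (\<lambda>x. pcoord M c (chart_inv c x) (\<sigma> i (chart_inv c x)))" if "i \<in> I" for i
    using \<sigma>[OF that] c by (simp add: smooth_section_def)
  then have "smooth_on (snd c ` (U \<inter> fst c)) (\<lambda>x. \<Sum>i\<in>I. a i *\<^sub>R pcoord M c (chart_inv c x) (\<sigma> i (chart_inv c x)))"
    by (rule smooth_on_sum[OF I smooth_on_scaleR])
  then show "smooth_on (snd c ` (U \<inter> fst c)) (\<lambda>x. pcoord M c (chart_inv c x) (\<Sum>i\<in>I. a i *\<^sub>R \<sigma> i (chart_inv c x)))"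
  proof (rule smooth_on_chart_image_cong[OF inj_chart[OF M c] Int_lower2])
    fix q assume q: "q \<in> U \<inter> fst c"
    then have "chart_inv c (snd c q) = q" by (intro chart_inv_eq[OF inj_chart[OF M c]]) simp
    then show "(\<Sum>i\<in>I. a i *\<^sub>R pcoord M c (chart_inv c (snd c q)) (\<sigma> i (chart_inv c (snd c q)))) =
        pcoord M c q (\<Sum>i\<in>I. a i *\<^sub>R \<sigma> i q)"
      using q linear_pcoord[OF M c, of q] by (simp add: linear_sum linear_scale)
  qed
qed

section \<open>Sections transported along smooth maps\<close>

lemma represents_on_shift:
  assumes "represents_on S c d F p W f" "snd c q \<in> W"
  shows "represents_on S c d F q W f"
  using assms by (simp add: represents_on_def)

text \<open>Applied with \<open>K\<close> the unit map and \<open>F\<close> the source or the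
  target. In coordinates the expression is the derivative of one fixed extension \<open>f\<close>,
  at the moving point \<open>k x\<close>, applied to the fibre coordinates of the section; expanding
  in \<open>Basis\<close> separates the two smooth factors.\<close>

lemma smooth_on_tangent_map_section:
  assumes M: "smooth_manifold M" and N: "smooth_manifold N" and N0: "smooth_manifold N0"
    and F: "smooth_map M N F" and K: "smooth_map N0 M K" and \<sigma>: "smooth_section M U \<sigma>"
    and c: "c \<in> atlas N" and c0: "c0 \<in> atlas N0"
  shows "smooth_on (snd c0 ` {q \<in> fst c0. K q \<in> U \<and> F (K q) \<in> fst c})
    (\<lambda>x. tcoord N c (F (K (chart_inv c0 x))) (tangent_map M N F (K (chart_inv c0 x)) (fst (\<sigma> (K (chart_inv c0 x))))))"
    (is "smooth_on (snd c0 ` ?S) _")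
proof (rule smooth_on_local)
  note cs = smooth_manifold_imp_chart_system
  fix x0 assume "x0 \<in> snd c0 ` ?S"
  then obtain q0 where q0: "q0 \<in> fst c0" "K q0 \<in> U" "F (K q0) \<in> fst c" "x0 = snd c0 q0"
    by (elim imageE CollectE conjE) (rule that)
  have q0N: "q0 \<in> points N0" by (rule chart_point[OF c0 q0(1)])
  have Kpts: "K q \<in> points M" if "q \<in> points N0" for q using K that unfolding smooth_map_on_def by blast
  let ?e = "chart_at M (K q0)"
  note e = chart_at[OF cs[OF M] Kpts[OF q0N]]
  obtain W k where Rk: "represents_on (points N0) c0 ?e K q0 W k"
    by (rule smooth_map_on_represents[OF cs[OF N0] K c0 q0(1) e(1,2) q0N])
  obtain W' f where Rf: "represents_on (points M) ?e c F (K q0) W' f"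
    by (rule smooth_map_on_represents[OF cs[OF M] F e(1,2) c q0(3) Kpts[OF q0N]])
  have kW: "open W" "x0 \<in> W" "\<And>n. times_diff_on n W k" using Rk q0(4) by (simp_all add: represents_on_def)
  have fW: "open W'" "snd ?e (K q0) \<in> W'" "\<And>n. times_diff_on n W' f" using Rf by (simp_all add: represents_on_def)
  have kk: "K q \<in> fst ?e" "snd ?e (K q) = k (snd c0 q)" if "q \<in> fst c0" "snd c0 q \<in> W" for q
    using Rk that chart_point[OF c0 that(1)] by (simp_all add: represents_on_def)
  \<comment> \<open>Over \<open>?T\<close> one chart \<open>?e\<close> and one pair of extensions
    \<open>k\<close> and \<open>f\<close> serve all points simultaneously.\<close>
  let ?T = "W \<inter> k -` W'"
  have oT: "open ?T" using kW(3)[of 0] by (simp add: continuous_open_preimage kW(1) fW(1))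
  let ?g = "\<lambda>y. pcoord M ?e (chart_inv ?e y) (\<sigma> (chart_inv ?e y))"
  let ?S' = "{q \<in> ?S. snd c0 q \<in> ?T}"
  have S': "q \<in> fst c0" "K q \<in> U" "F (K q) \<in> fst c" "snd c0 q \<in> W" "k (snd c0 q) \<in> W'" if "q \<in> ?S'" for q
    using that by simp_all
  have SS: "snd c0 ` ?S \<inter> ?T = snd c0 ` ?S'" by auto
  have sk: "smooth_on (snd c0 ` ?S') k"
    by (rule smooth_on_subset[OF smooth_on_open[OF kW(1,3)]]) auto
  have sg: "smooth_on (snd ?e ` (U \<inter> fst ?e)) ?g" using \<sigma> e(1) by (simp add: smooth_section_def)
  have "k ` (snd c0 ` ?S') \<subseteq> snd ?e ` (U \<inter> fst ?e)"
  proof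
    fix y assume "y \<in> k ` (snd c0 ` ?S')"
    then obtain q where q: "q \<in> ?S'" "y = k (snd c0 q)" by blast
    show "y \<in> snd ?e ` (U \<inter> fst ?e)"
      unfolding q(2) kk(2)[OF S'(1,4)[OF q(1)], symmetric] by (intro imageI IntI S'(2)[OF q(1)] kk(1)[OF S'(1,4)[OF q(1)]])
  qed
  then have 1: "smooth_on (snd c0 ` ?S') (\<lambda>x. fst (?g (k x)))"
    by (rule smooth_on_fst[OF smooth_on_compose[OF sg sk]])
  have "smooth_on (k ` (snd c0 ` ?S')) (\<lambda>y. frechet_derivative f (at y) b)" for b
    by (rule smooth_on_frechet_derivative[OF fW(1,3) _ smooth_on_const]) auto
  then have "smooth_on (snd c0 ` ?S') (\<lambda>x. frechet_derivative f (at (k x)) b)" for b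
    by (rule smooth_on_compose[OF _ sk]) simp
  then have 2: "smooth_on (snd c0 ` ?S') (\<lambda>x. \<Sum>b\<in>Basis. (fst (?g (k x)) \<bullet> b) *\<^sub>R frechet_derivative f (at (k x)) b)"
    by (intro smooth_on_sum finite_Basis smooth_on_bilinear[OF bounded_bilinear_scaleR]
        smooth_on_bilinear[OF bounded_bilinear_inner] 1 smooth_on_const)
  have "smooth_on (snd c0 ` ?S') (\<lambda>x. tcoord N c (F (K (chart_inv c0 x))) (tangent_map M N F (K (chart_inv c0 x)) (fst (\<sigma> (K (chart_inv c0 x))))))"
  proof (rule smooth_on_chart_image_cong[OF inj_chart[OF N0 c0] _ 2])
    fix q assume q: "q \<in> ?S'"
    note Sq = S'[OF q]
    note kq = kk[OF Sq(1,4)]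
    have Kq: "K q \<in> points M" by (rule Kpts[OF chart_point[OF c0 Sq(1)]])
    have inv: "chart_inv ?e (k (snd c0 q)) = K q" using chart_inv_eq[OF e(3) kq(1)] kq(2) by simp
    have \<sigma>q: "fst (\<sigma> (K q)) \<in> tangent_space M (K q)"
      using \<sigma> Sq(2) by (auto simp: smooth_section_def pontryagin_fibre_def)
    have "f differentiable (at (k (snd c0 q)))" using fW(3)[of 1] Sq(5) by simp
    from frechet_derivative_basis_sum[OF this, of "fst (?g (k (snd c0 q)))"]
    have "(\<Sum>b\<in>Basis. (fst (?g (k (snd c0 q))) \<bullet> b) *\<^sub>R frechet_derivative f (at (k (snd c0 q))) b) =
        frechet_derivative f (at (snd ?e (K q))) (coord_change (chart_at M (K q)) ?e (K q) (fst (\<sigma> (K q))))"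
      by (simp add: inv pcoord_def tcoord_def kq(2))
    also have "\<dots> = tcoord N c (F (K q)) (tangent_map M N F (K q) (fst (\<sigma> (K q))))"
      unfolding tcoord_def
      by (rule tangent_map_in_charts[OF M N F Kq e(1) kq(1) c Sq(3) represents_on_shift[OF Rf] \<sigma>q, symmetric])
        (simp add: kq(2) Sq(5))
    finally show "(\<Sum>b\<in>Basis. (fst (?g (k (snd c0 q))) \<bullet> b) *\<^sub>R frechet_derivative f (at (k (snd c0 q))) b) =
        tcoord N c (F (K q)) (tangent_map M N F (K q) (fst (\<sigma> (K q))))" .
  qed auto
  moreover have "x0 \<in> ?T" using kW(2) fW(2) kk(2)[OF q0(1)] q0(4) by simp
  ultimately show "\<exists>T. open T \<and> x0 \<in> T \<and> smooth_on (snd c0 ` ?S \<inter> T)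
      (\<lambda>x. tcoord N c (F (K (chart_inv c0 x))) (tangent_map M N F (K (chart_inv c0 x)) (fst (\<sigma> (K (chart_inv c0 x))))))"
    using oT SS by (intro exI[of _ ?T]) simp
qed

text \<open>In coordinates the pullback is the transpose of the derivative of the extension
  \<open>k\<close>, restricted to \<open>chart_space c0\<close>; \<open>covector_of\<close> writes
  it as a finite sum of smooth terms.\<close>

lemma smooth_on_cotangent_map_section:
  assumes M: "smooth_manifold M" and N0: "smooth_manifold N0"
    and K: "smooth_map N0 M K" and \<sigma>: "smooth_section M U \<sigma>" and c0: "c0 \<in> atlas N0"
  shows "smooth_on (snd c0 ` {q \<in> fst c0. K q \<in> U})
    (\<lambda>x. ccoord N0 c0 (chart_inv c0 x) (cotangent_map N0 M K (chart_inv c0 x) (snd (\<sigma> (K (chart_inv c0 x))))))"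
    (is "smooth_on (snd c0 ` ?S) _")
proof (rule smooth_on_local)
  note cs = smooth_manifold_imp_chart_system
  fix x0 assume "x0 \<in> snd c0 ` ?S"
  then obtain q0 where q0: "q0 \<in> fst c0" "K q0 \<in> U" "x0 = snd c0 q0"
    by (elim imageE CollectE conjE) (rule that)
  have q0N: "q0 \<in> points N0" by (rule chart_point[OF c0 q0(1)])
  have Kpts: "K q \<in> points M" if "q \<in> points N0" for q using K that unfolding smooth_map_on_def by blast
  let ?e = "chart_at M (K q0)" and ?V = "chart_space c0"
  note e = chart_at[OF cs[OF M] Kpts[OF q0N]]
  obtain W k where Rk: "represents_on (points N0) c0 ?e K q0 W k"
    by (rule smooth_map_on_represents[OF cs[OF N0] K c0 q0(1) e(1,2) q0N])
  have kW: "open W" "x0 \<in> W" "\<And>n. times_diff_on n W k" using Rk q0(3) by (simp_all add: represents_on_def)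
  have kk: "K q \<in> fst ?e" "snd ?e (K q) = k (snd c0 q)" if "q \<in> fst c0" "snd c0 q \<in> W" for q
    using Rk that chart_point[OF c0 that(1)] by (simp_all add: represents_on_def)
  let ?g = "\<lambda>y. pcoord M ?e (chart_inv ?e y) (\<sigma> (chart_inv ?e y))"
  let ?S' = "{q \<in> ?S. snd c0 q \<in> W}"
  have S': "q \<in> fst c0" "K q \<in> U" "snd c0 q \<in> W" if "q \<in> ?S'" for q
    using that by simp_all
  have SS: "snd c0 ` ?S \<inter> W = snd c0 ` ?S'" by auto
  have S'W: "snd c0 ` ?S' \<subseteq> W" by auto
  have sk: "smooth_on (snd c0 ` ?S') k"
    by (rule smooth_on_subset[OF smooth_on_open[OF kW(1,3)] S'W])
  have sg: "smooth_on (snd ?e ` (U \<inter> fst ?e)) ?g" using \<sigma> e(1) by (simp add: smooth_section_def)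
  have "k ` (snd c0 ` ?S') \<subseteq> snd ?e ` (U \<inter> fst ?e)"
  proof
    fix y assume "y \<in> k ` (snd c0 ` ?S')"
    then obtain q where q: "q \<in> ?S'" "y = k (snd c0 q)" by blast
    show "y \<in> snd ?e ` (U \<inter> fst ?e)"
      unfolding q(2) kk(2)[OF S'(1,3)[OF q(1)], symmetric] by (intro imageI IntI S'(2)[OF q(1)] kk(1)[OF S'(1,3)[OF q(1)]])
  qed
  then have 1: "smooth_on (snd c0 ` ?S') (\<lambda>x. snd (?g (k x)))"
    by (rule smooth_on_snd[OF smooth_on_compose[OF sg sk]])
  have 2: "smooth_on (snd c0 ` ?S') (\<lambda>x. frechet_derivative k (at x) b)" for b
    by (rule smooth_on_frechet_derivative[OF kW(1,3) S'W smooth_on_const])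
  have 3: "smooth_on (snd c0 ` ?S') (\<lambda>x. covector_of ?V (\<lambda>w. snd (?g (k x)) \<bullet> frechet_derivative k (at x) w))"
    unfolding covector_of_def
    by (intro smooth_on_sum finite_Basis smooth_on_bilinear[OF bounded_bilinear_scaleR]
        smooth_on_bilinear[OF bounded_bilinear_inner] 1 2 smooth_on_const)
  have "smooth_on (snd c0 ` ?S')
    (\<lambda>x. ccoord N0 c0 (chart_inv c0 x) (cotangent_map N0 M K (chart_inv c0 x) (snd (\<sigma> (K (chart_inv c0 x))))))"
  proof (rule smooth_on_chart_image_cong[OF inj_chart[OF N0 c0] _ 3])
    fix q assume q: "q \<in> ?S'"
    note Sq = S'[OF q]
    note kq = kk[OF Sq(1,3)]
    have qN: "q \<in> points N0" by (rule chart_point[OF c0 Sq(1)])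
    note Kq = Kpts[OF qN]
    have inv: "chart_inv ?e (k (snd c0 q)) = K q" using chart_inv_eq[OF e(3) kq(1)] kq(2) by simp
    let ?\<beta> = "snd (\<sigma> (K q))"
    have g: "snd (?g (k (snd c0 q))) = ccoord M ?e (K q) ?\<beta>" by (simp add: inv pcoord_def)
    have dk: "(k has_derivative frechet_derivative k (at (snd c0 q))) (at (snd c0 q))"
      by (rule smooth_times_diff_derivative[OF kW(3) Sq(3)])
    have lin: "linear (\<lambda>w. ccoord M ?e (K q) ?\<beta> \<bullet> frechet_derivative k (at (snd c0 q)) w)"
      using linear_compose[OF has_derivative_linear[OF dk] bounded_linear.linear[OF bounded_linear_inner_right]]
      by (simp add: o_def)
    \<comment> \<open>Both covectors lie in \<open>chart_space c0\<close>, so they may be tested on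
      its vectors, each of which is the coordinate vector of a tangent vector at
      \<open>q\<close>.\<close>
    have "ccoord N0 c0 q (cotangent_map N0 M K q ?\<beta>) =
      covector_of ?V (\<lambda>w. ccoord M ?e (K q) ?\<beta> \<bullet> frechet_derivative k (at (snd c0 q)) w)"
    proof (rule subspace_eqI_inner[OF subspace_chart_space ccoord_in[OF N0 c0 Sq(1)] covector_of_in[OF subspace_chart_space lin]])
      fix w assume w: "w \<in> ?V"
      let ?v = "coord_change c0 (chart_at N0 q) q w"
      have v: "?v \<in> tangent_space N0 q" by (rule tcoord_back_in[OF N0 c0 Sq(1) w])
      have wv: "coord_change (chart_at N0 q) c0 q ?v = w"
        using tcoord_back[OF N0 c0 Sq(1) w] by (simp add: tcoord_def)
      have "coord_change (chart_at M (K q)) ?e (K q) (tangent_map N0 M K q ?v) =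
          frechet_derivative k (at (snd c0 q)) (coord_change (chart_at N0 q) c0 q ?v)"
        by (rule tangent_map_in_charts[OF N0 M K qN c0 Sq(1) e(1) kq(1) represents_on_shift[OF Rk Sq(3)] v])
      then have dkw: "frechet_derivative k (at (snd c0 q)) w = tcoord M ?e (K q) (tangent_map N0 M K q ?v)"
        by (simp add: wv tcoord_def)
      have "ccoord N0 c0 q (cotangent_map N0 M K q ?\<beta>) \<bullet> w = cotangent_map N0 M K q ?\<beta> \<bullet> ?v"
        by (rule inner_ccoord[OF N0 c0 Sq(1) w])
      also have "\<dots> = ?\<beta> \<bullet> tangent_map N0 M K q ?v"
        unfolding cotangent_map_def
        by (rule inner_pullback_covector[OF subspace_tangent_space linear_tangent_map_on[OF cs[OF N0] cs[OF M] K qN] v])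
      also have "\<dots> = ccoord M ?e (K q) ?\<beta> \<bullet> tcoord M ?e (K q) (tangent_map N0 M K q ?v)"
        by (rule ccoord_tcoord[OF M e(1) kq(1) tangent_map_in[OF N0 M K qN v], symmetric])
      also have "\<dots> = covector_of ?V (\<lambda>w. ccoord M ?e (K q) ?\<beta> \<bullet> frechet_derivative k (at (snd c0 q)) w) \<bullet> w"
        unfolding inner_covector_of[OF subspace_chart_space lin w] dkw ..
      finally show "ccoord N0 c0 q (cotangent_map N0 M K q ?\<beta>) \<bullet> w =
          covector_of ?V (\<lambda>w. ccoord M ?e (K q) ?\<beta> \<bullet> frechet_derivative k (at (snd c0 q)) w) \<bullet> w" .
    qed
    then show "covector_of ?V (\<lambda>w. snd (?g (k (snd c0 q))) \<bullet> frechet_derivative k (at (snd c0 q)) w) =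
        ccoord N0 c0 q (cotangent_map N0 M K q ?\<beta>)"
      unfolding g by simp
  qed auto
  then show "\<exists>T. open T \<and> x0 \<in> T \<and> smooth_on (snd c0 ` ?S \<inter> T)
      (\<lambda>x. ccoord N0 c0 (chart_inv c0 x) (cotangent_map N0 M K (chart_inv c0 x) (snd (\<sigma> (K (chart_inv c0 x))))))"
    using kW(1,2) SS by (intro exI[of _ W]) simp
qed

subsection \<open>Subbundles spanned by local sections\<close>

text \<open>Expand \<open>x\<close> in a local frame at \<open>p\<close> and keep the coefficients
  constant.\<close>

lemma subbundle_section:
  assumes M: "smooth_manifold M" and E: "smooth_subbundle M E" and p: "p \<in> points M" and x: "x \<in> E p"
  obtains U \<tau> where "p \<in> U" "smooth_section M U \<tau>" "\<And>q. q \<in> U \<Longrightarrow> \<tau> q \<in> E q" "\<tau> p = x"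
proof -
  have "\<exists>U r (\<sigma> :: nat \<Rightarrow> 'a \<Rightarrow> 'b \<times> 'b).
        openin (manifold_topology M) U \<and> p \<in> U \<and>
        (\<forall>i<r. smooth_map_on M U (pontryagin_bundle M) (\<lambda>q. (q, \<sigma> i q))) \<and>
        (\<forall>q\<in>U. inj_on (\<lambda>i. \<sigma> i q) {..<r} \<and> independent ((\<lambda>i. \<sigma> i q) ` {..<r}) \<and>
               E q = span ((\<lambda>i. \<sigma> i q) ` {..<r}))"
    using E p unfolding smooth_subbundle_def by blast
  then obtain U r and \<sigma> :: "nat \<Rightarrow> 'a \<Rightarrow> 'b \<times> 'b" where U: "openin (manifold_topology M) U" "p \<in> U"
    and sm: "\<forall>i<r. smooth_map_on M U (pontryagin_bundle M) (\<lambda>q. (q, \<sigma> i q))"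
    and fr: "\<forall>q\<in>U. inj_on (\<lambda>i. \<sigma> i q) {..<r} \<and> independent ((\<lambda>i. \<sigma> i q) ` {..<r}) \<and>
               E q = span ((\<lambda>i. \<sigma> i q) ` {..<r})"
    by (elim exE conjE) (rule that)
  have sec: "smooth_section M U (\<sigma> i)" if "i \<in> {..<r}" for i
    using smooth_section_of_map[OF M U(1)] sm that by simp
  have inj: "inj_on (\<lambda>i. \<sigma> i p) {..<r}" and Ep: "E p = span ((\<lambda>i. \<sigma> i p) ` {..<r})" using fr U(2) by simp_all
  have "x \<in> range (\<lambda>c. \<Sum>v\<in>(\<lambda>i. \<sigma> i p) ` {..<r}. c v *\<^sub>R v)"
    using x unfolding Ep by (simp add: span_finite)
  then obtain c where "x = (\<Sum>v\<in>(\<lambda>i. \<sigma> i p) ` {..<r}. c v *\<^sub>R v)" by (elim imageE)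
  then have x': "x = (\<Sum>i<r. c (\<sigma> i p) *\<^sub>R \<sigma> i p)" by (simp add: sum.reindex[OF inj])
  show thesis
  proof (rule that[OF U(2) smooth_section_linear_combination[OF M _ U(1) sec]])
    show "finite {..<r}" by simp
    show "(\<Sum>i<r. c (\<sigma> i p) *\<^sub>R \<sigma> i p) = x" using x' by simp
    fix q assume "q \<in> U"
    then have Eq: "E q = span ((\<lambda>i. \<sigma> i q) ` {..<r})" using fr by simp
    show "(\<Sum>i<r. c (\<sigma> i p) *\<^sub>R \<sigma> i q) \<in> E q"
      unfolding Eq by (intro span_sum span_scale span_base) simp
  qed
qed

lemma independent_family_of_image:
  fixes L :: "'a::euclidean_space \<Rightarrow> 'b::euclidean_space"
  assumes L: "linear L" and I: "finite I" and inj: "inj_on (\<lambda>i. L (y i)) I" and ind: "independent ((\<lambda>i. L (y i)) ` I)"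
  shows "inj_on y I" and "independent (y ` I)"
proof -
  show injy: "inj_on y I" using inj by (auto simp: inj_on_def)
  show "independent (y ` I)"
    unfolding independent_explicit
  proof (intro conjI allI impI ballI)
    show "finite (y ` I)" using I by simp
    fix c v assume c: "(\<Sum>v\<in>y ` I. c v *\<^sub>R v) = 0" and v: "v \<in> y ` I"
    obtain i where i: "i \<in> I" "v = y i" using v by (elim imageE)
    have "(\<Sum>j\<in>I. c (y j) *\<^sub>R L (y j)) = L (\<Sum>j\<in>I. c (y j) *\<^sub>R y j)"
      by (simp add: linear_sum[OF L] linear_scale[OF L])
    also have "\<dots> = 0" using c by (simp add: sum.reindex[OF injy] linear_0[OF L])
    \<comment> \<open>\<open>the_inv_into\<close> turns coefficients indexed by \<open>I\<close>
      into a function on the image set, as \<open>independent_explicit\<close> demands.\<close>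
    finally have z: "(\<Sum>w\<in>(\<lambda>i. L (y i)) ` I. c (y (the_inv_into I (\<lambda>i. L (y i)) w)) *\<^sub>R w) = 0"
      using the_inv_into_f_f[OF inj] by (simp add: sum.reindex[OF inj])
    have "\<forall>c. (\<Sum>v\<in>(\<lambda>i. L (y i)) ` I. c v *\<^sub>R v) = 0 \<longrightarrow> (\<forall>v\<in>(\<lambda>i. L (y i)) ` I. c v = 0)"
      using ind unfolding independent_explicit by (rule conjunct2)
    from bspec[OF mp[OF spec[OF this, of "\<lambda>w. c (y (the_inv_into I (\<lambda>i. L (y i)) w))"] z] imageI[OF i(1)]]
    have "c (y (the_inv_into I (\<lambda>i. L (y i)) (L (y i)))) = 0" .
    then show "c v = 0" using the_inv_into_f_f[OF inj i(1)] i(2) by simp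
  qed
qed

lemma openin_finite_intersection:
  assumes "openin T A" "\<And>i. i < r \<Longrightarrow> openin T (V i)"
  shows "openin T {q \<in> A. \<forall>i<(r::nat). q \<in> V i}"
  using assms(2)
proof (induction r)
  case 0
  then show ?case using assms(1) by simp
next
  case (Suc r)
  have "{q \<in> A. \<forall>i<Suc r. q \<in> V i} = {q \<in> A. \<forall>i<r. q \<in> V i} \<inter> V r"
    by (auto simp: less_Suc_eq)
  then show ?case using openin_Int[of T "{q \<in> A. \<forall>i<r. q \<in> V i}" "V r"] Suc by simp
qed

text \<open>Sections through a basis of \<open>E p\<close> stay independent near \<open>p\<close>, and span because the dimension of \<open>E q\<close>
  is locally constant.\<close>

lemma smooth_subbundleI:
  fixes M :: "('a, 'e::euclidean_space) manifold"
  assumes M: "smooth_manifold M"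
    and sub: "\<And>q. q \<in> points M \<Longrightarrow> subspace (E q)"
    and fib: "\<And>q. q \<in> points M \<Longrightarrow> E q \<subseteq> pontryagin_fibre M q"
    and dim: "\<And>q. q \<in> points M \<Longrightarrow> dim (E q) = dim (tangent_space M q)"
    and sec: "\<And>p x. p \<in> points M \<Longrightarrow> x \<in> E p \<Longrightarrow>
      \<exists>U \<sigma>. p \<in> U \<and> smooth_section M U \<sigma> \<and> (\<forall>q\<in>U. \<sigma> q \<in> E q) \<and> \<sigma> p = x"
  shows "smooth_subbundle M E"
  unfolding smooth_subbundle_def
proof (intro conjI ballI sub fib)
  fix p assume p: "p \<in> points M"
  let ?c = "chart_at M p"
  note c = chart_at[OF smooth_manifold_imp_chart_system[OF M] p]
  obtain B where B: "B \<subseteq> E p" "independent B" "E p \<subseteq> span B" "card B = dim (E p)"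
    by (rule basis_exists)
  have finB: "finite B" using B(2) independent_imp_finite by blast
  define r where "r = card B"
  obtain b where b: "bij_betw b {..<r} B"
    using ex_bij_betw_nat_finite[OF finB] unfolding r_def atLeast0LessThan by blast
  \<comment> \<open>The neighbourhood and the section are packed into one pair, so that a single
    application of choice yields both.\<close>
  have "\<forall>i. \<exists>A. i < r \<longrightarrow> p \<in> fst A \<and> smooth_section M (fst A) (snd A) \<and> (\<forall>q\<in>fst A. snd A q \<in> E q) \<and> snd A p = b i"
  proof
    fix i
    show "\<exists>A. i < r \<longrightarrow> p \<in> fst A \<and> smooth_section M (fst A) (snd A) \<and> (\<forall>q\<in>fst A. snd A q \<in> E q) \<and> snd A p = b i"
    proof (cases "i < r")
      case True
      then have "b i \<in> E p" using b B(1) bij_betwE by blast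
      from sec[OF p this] obtain U \<sigma> where "p \<in> U \<and> smooth_section M U \<sigma> \<and> (\<forall>q\<in>U. \<sigma> q \<in> E q) \<and> \<sigma> p = b i"
        by (elim exE) (rule that)
      then show ?thesis by (intro exI[of _ "(U, \<sigma>)"]) simp
    qed simp
  qed
  from choice[OF this] obtain A where A: "\<forall>i. i < r \<longrightarrow> p \<in> fst (A i) \<and> smooth_section M (fst (A i)) (snd (A i)) \<and>
      (\<forall>q\<in>fst (A i). snd (A i) q \<in> E q) \<and> snd (A i) p = b i" ..
  define U\<sigma> where "U\<sigma> i = fst (A i)" for i
  define \<sigma> where "\<sigma> i = snd (A i)" for i
  have \<sigma>: "p \<in> U\<sigma> i" "smooth_section M (U\<sigma> i) (\<sigma> i)" "\<sigma> i p = b i" if "i < r" for i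
    using A that unfolding U\<sigma>_def \<sigma>_def by blast+
  have \<sigma>E: "\<sigma> i q \<in> E q" if "i < r" "q \<in> U\<sigma> i" for i q
    using A that unfolding U\<sigma>_def \<sigma>_def by blast
  let ?f = "\<lambda>i q. pcoord M ?c q (\<sigma> i q)"
  have injb: "inj_on b {..<r}" and imb: "b ` {..<r} = B" using b by (simp_all add: bij_betw_def)
  have EpS: "span B \<subseteq> pontryagin_fibre M p"
    using span_minimal[OF B(1) sub[OF p]] fib[OF p] by blast
  have injL: "inj_on (pcoord M ?c p) (span B)"
    by (rule inj_on_subset[OF inj_on_pcoord[OF M c(1,2)] EpS])
  have fb: "?f i p = pcoord M ?c p (b i)" if "i < r" for i using \<sigma>(3)[OF that] by simp
  have inj0: "inj_on (\<lambda>i. pcoord M ?c p (b i)) {..<r}"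
  proof -
    have "inj_on (pcoord M ?c p \<circ> b) {..<r}"
      by (rule comp_inj_on[OF injb]) (rule inj_on_subset[OF injL], simp add: imb span_superset)
    then show ?thesis by (simp add: o_def)
  qed
  have ind0: "independent ((\<lambda>i. pcoord M ?c p (b i)) ` {..<r})"
  proof -
    have "independent (pcoord M ?c p ` B)"
      by (rule linear_independent_injective_image[OF linear_pcoord[OF M c(1,2)] B(2) injL])
    then show ?thesis unfolding imb[symmetric] image_image .
  qed
  obtain \<delta> where \<delta>: "\<delta> > 0" "\<forall>z. (\<forall>i<r. norm (z i - pcoord M ?c p (b i)) < \<delta>) \<longrightarrow>
      inj_on z {..<r} \<and> independent (z ` {..<r})"
    using independent_family_perturb[OF inj0 ind0] by (elim exE conjE) (rule that)
  \<comment> \<open>On \<open>V i\<close> the section stays \<delta>-close to its value at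
    \<open>p\<close> in the fixed chart \<open>?c\<close>; only in such common coordinates can
    fibres over different points be compared.\<close>
  define V where "V i = {q \<in> U\<sigma> i \<inter> fst ?c. (\<lambda>x. ?f i (chart_inv ?c x)) (snd ?c q) \<in> ball (pcoord M ?c p (b i)) \<delta>}" for i
  have inv: "chart_inv ?c (snd ?c q) = q" if "q \<in> fst ?c" for q by (rule chart_inv_eq[OF c(3) that])
  have V: "openin (manifold_topology M) (V i)" if i: "i < r" for i
  proof -
    have "openin (manifold_topology M) (U\<sigma> i)"
      and "smooth_on (snd ?c ` (U\<sigma> i \<inter> fst ?c)) (\<lambda>x. ?f i (chart_inv ?c x))"
      using \<sigma>(2)[OF i] c(1) by (simp_all add: smooth_section_def)
    then show ?thesis unfolding V_def
      by (intro openin_chart_preimage[OF c(1)] smooth_on_continuous open_ball)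
  qed
  have Vq: "q \<in> U\<sigma> i" "q \<in> fst ?c" "norm (?f i q - pcoord M ?c p (b i)) < \<delta>" if "q \<in> V i" for i q
    using that inv[of q] by (simp_all add: V_def dist_norm norm_minus_commute)
  define U where "U = {q \<in> fst ?c. \<forall>i<r. q \<in> V i}"
  have oU: "openin (manifold_topology M) U"
    unfolding U_def by (rule openin_finite_intersection[OF openin_chart[OF c(1)] V])
  have pU: "p \<in> U"
    unfolding U_def V_def using c(2) \<sigma>(1,3) \<delta>(1) inv[OF c(2)] by simp
  have frame: "inj_on (\<lambda>i. \<sigma> i q) {..<r} \<and> independent ((\<lambda>i. \<sigma> i q) ` {..<r}) \<and> E q = span ((\<lambda>i. \<sigma> i q) ` {..<r})"
    if q: "q \<in> U" for q
  proof -
    have qc: "q \<in> fst ?c" and qV: "q \<in> V i" if "i < r" for i using q that by (simp_all add: U_def)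
    have qc: "q \<in> fst ?c" using q by (simp add: U_def)
    note qM = chart_point[OF c(1) qc]
    have "inj_on (\<lambda>i. ?f i q) {..<r} \<and> independent ((\<lambda>i. ?f i q) ` {..<r})"
      using \<delta>(2)[rule_format, of "\<lambda>i. ?f i q"] Vq(3)[OF qV] by blast
    then have 1: "inj_on (\<lambda>i. \<sigma> i q) {..<r}" and 2: "independent ((\<lambda>i. \<sigma> i q) ` {..<r})"
      using independent_family_of_image[OF linear_pcoord[OF M c(1) qc], of "{..<r}" "\<lambda>i. \<sigma> i q"] by simp_all
    have sE: "(\<lambda>i. \<sigma> i q) ` {..<r} \<subseteq> E q" using \<sigma>E Vq(1)[OF qV] by auto
    have "dim (E q) = r"
      using dim[OF qM] dim[OF p] dim_tangent_space[OF M c(1) qc] dim_tangent_space[OF M c(1,2)] B(4) by (simp add: r_def)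
    also have "r = card ((\<lambda>i. \<sigma> i q) ` {..<r})" by (simp add: card_image[OF 1])
    finally have "E q \<subseteq> span ((\<lambda>i. \<sigma> i q) ` {..<r})"
      using card_ge_dim_independent[OF sE 2] by simp
    moreover have "span ((\<lambda>i. \<sigma> i q) ` {..<r}) \<subseteq> E q" by (rule span_minimal[OF sE sub[OF qM]])
    ultimately show ?thesis using 1 2 by blast
  qed
  have sm: "smooth_map_on M U (pontryagin_bundle M) (\<lambda>q. (q, \<sigma> i q))" if i: "i < r" for i
  proof (rule smooth_section_imp_map[OF M])
    have UU: "U \<subseteq> U\<sigma> i" using Vq(1) i by (auto simp: U_def)
    show "smooth_section M U (\<sigma> i)"
      unfolding smooth_section_def
    proof (intro conjI oU ballI)
      show "\<sigma> i q \<in> pontryagin_fibre M q" if "q \<in> U" for q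
        using \<sigma>(2)[OF i] UU that by (auto simp: smooth_section_def)
      fix d assume d: "d \<in> atlas M"
      then have "smooth_on (snd d ` (U\<sigma> i \<inter> fst d)) (\<lambda>x. pcoord M d (chart_inv d x) (\<sigma> i (chart_inv d x)))"
        using \<sigma>(2)[OF i] by (simp add: smooth_section_def)
      then show "smooth_on (snd d ` (U \<inter> fst d)) (\<lambda>x. pcoord M d (chart_inv d x) (\<sigma> i (chart_inv d x)))"
        by (rule smooth_on_subset) (use UU in blast)
    qed
  qed
  show "\<exists>U r (\<sigma> :: nat \<Rightarrow> 'a \<Rightarrow> 'e \<times> 'e).
        openin (manifold_topology M) U \<and> p \<in> U \<and>
        (\<forall>i<r. smooth_map_on M U (pontryagin_bundle M) (\<lambda>q. (q, \<sigma> i q))) \<and>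
        (\<forall>q\<in>U. inj_on (\<lambda>i. \<sigma> i q) {..<r} \<and> independent ((\<lambda>i. \<sigma> i q) ` {..<r}) \<and>
               E q = span ((\<lambda>i. \<sigma> i q) ` {..<r}))"
    using oU pU sm frame by (intro exI[of _ U] exI[of _ r] exI[of _ \<sigma>]) simp
qed

text \<open>Being Lagrangian fixes the fibre dimension to that of the tangent space, so for a
  subbundle it remains to have smooth sections through every element.\<close>

lemma dirac_structureI:
  assumes M: "smooth_manifold M"
    and sub: "\<And>q. q \<in> points M \<Longrightarrow> subspace (E q)"
    and lag: "\<And>q. q \<in> points M \<Longrightarrow>
      E q = {x \<in> tangent_space M q \<times> tangent_space M q. \<forall>y\<in>E q. pairing x y = 0}"
    and sec: "\<And>p x. p \<in> points M \<Longrightarrow> x \<in> E p \<Longrightarrow>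
      \<exists>U \<sigma>. p \<in> U \<and> smooth_section M U \<sigma> \<and> (\<forall>q\<in>U. \<sigma> q \<in> E q) \<and> \<sigma> p = x"
  shows "dirac_structure M E"
  unfolding dirac_structure_def
proof
  have fib: "E q \<subseteq> tangent_space M q \<times> tangent_space M q" if "q \<in> points M" for q
    using lag[OF that] by blast
  show "smooth_subbundle M E"
  proof (rule smooth_subbundleI[OF M sub])
    fix q assume q: "q \<in> points M"
    show "E q \<subseteq> pontryagin_fibre M q" unfolding pontryagin_fibre_def by (rule fib[OF q])
    show "dim (E q) = dim (tangent_space M q)"
      by (rule dim_lagrangian[OF subspace_tangent_space sub[OF q] fib[OF q] lag[OF q]])
  qed (assumption | erule (1) sec)+
  show "\<forall>p\<in>points M. E p = pairing_orth M E p"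
    unfolding pairing_orth_def pontryagin_fibre_def using lag by (intro ballI)
qed

text \<open>The reflection \<open>(v, \<alpha>) \<mapsto> (- v, \<alpha>)\<close> is linear and
  changes the sign of the pairing, so it preserves Lagrangian fibres; local sections are reflected
  along with them.\<close>

lemma dirac_structure_opposite:
  fixes M :: "('a, 'e::euclidean_space) manifold"
  assumes M: "smooth_manifold M" and D: "dirac_structure M D"
  shows "dirac_structure M (opposite_dirac D)"
proof -
  have E: "smooth_subbundle M D" using D by (simp add: dirac_structure_def)
  have opp: "x \<in> opposite_dirac D q \<longleftrightarrow> (- fst x, snd x) \<in> D q" for q and x :: "'e \<times> 'e"
  proof
    assume "x \<in> opposite_dirac D q"
    then show "(- fst x, snd x) \<in> D q" unfolding opposite_dirac_def by auto
  next
    assume "(- fst x, snd x) \<in> D q"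
    then show "x \<in> opposite_dirac D q"
      unfolding opposite_dirac_def by (intro CollectI exI[of _ "- fst x"] exI[of _ "snd x"]) simp
  qed
  show ?thesis
  proof (rule dirac_structureI[OF M])
    fix q assume q: "q \<in> points M"
    have sD: "subspace (D q)" using E q by (simp add: smooth_subbundle_def)
    have lag: "x \<in> D q \<longleftrightarrow> x \<in> tangent_space M q \<times> tangent_space M q \<and> (\<forall>y\<in>D q. pairing x y = 0)" for x :: "'e \<times> 'e"
    proof -
      have "D q = pairing_orth M D q" using D q by (simp add: dirac_structure_def)
      then show ?thesis unfolding pairing_orth_def pontryagin_fibre_def by blast
    qed
    show "subspace (opposite_dirac D q)"
    proof (rule subspaceI)
      show "0 \<in> opposite_dirac D q" using subspace_0[OF sD] by (simp add: opp zero_prod_def)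
      show "x + y \<in> opposite_dirac D q" if "x \<in> opposite_dirac D q" "y \<in> opposite_dirac D q" for x y
        using subspace_add[OF sD that[unfolded opp]] by (simp add: opp)
      show "a *\<^sub>R x \<in> opposite_dirac D q" if "x \<in> opposite_dirac D q" for a x
        using subspace_scale[OF sD that[unfolded opp], of a] by (simp add: opp)
    qed
    show "opposite_dirac D q = {x \<in> tangent_space M q \<times> tangent_space M q. \<forall>y\<in>opposite_dirac D q. pairing x y = 0}"
    proof (rule set_eqI)
      fix x :: "'e \<times> 'e"
      have neg: "- fst x \<in> tangent_space M q \<longleftrightarrow> fst x \<in> tangent_space M q"
        using subspace_neg[OF subspace_tangent_space, of "fst x" M q] subspace_neg[OF subspace_tangent_space, of "- fst x" M q] by auto
      have pr: "pairing (- fst x, snd x) y = - pairing x (- fst y, snd y)" for y :: "'e \<times> 'e"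
        by (simp add: pairing_def split_beta)
      have "(\<forall>y\<in>D q. pairing (- fst x, snd x) y = 0) \<longleftrightarrow> (\<forall>y\<in>opposite_dirac D q. pairing x y = 0)"
      proof
        assume a: "\<forall>y\<in>D q. pairing (- fst x, snd x) y = 0"
        show "\<forall>y\<in>opposite_dirac D q. pairing x y = 0"
        proof
          fix y assume "y \<in> opposite_dirac D q"
          from bspec[OF a this[unfolded opp]] show "pairing x y = 0" by (simp add: pr)
        qed
      next
        assume a: "\<forall>y\<in>opposite_dirac D q. pairing x y = 0"
        show "\<forall>y\<in>D q. pairing (- fst x, snd x) y = 0"
        proof
          fix y assume "y \<in> D q"
          then have "(- fst y, snd y) \<in> opposite_dirac D q" by (simp add: opp)
          from bspec[OF a this] show "pairing (- fst x, snd x) y = 0" by (simp add: pr)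
        qed
      qed
      then show "x \<in> opposite_dirac D q \<longleftrightarrow>
          x \<in> {x \<in> tangent_space M q \<times> tangent_space M q. \<forall>y\<in>opposite_dirac D q. pairing x y = 0}"
        unfolding opp lag[of "(- fst x, snd x)"] by (simp add: mem_Times_iff neg)
    qed
  next
    fix p x assume p: "p \<in> points M" and x: "x \<in> opposite_dirac D p"
    obtain U \<tau> where \<tau>: "p \<in> U" "smooth_section M U \<tau>" "\<And>q. q \<in> U \<Longrightarrow> \<tau> q \<in> D q" "\<tau> p = (- fst x, snd x)"
      by (rule subbundle_section[OF M E p x[unfolded opp]]) (rule that)
    let ?\<sigma> = "\<lambda>q. (- fst (\<tau> q), snd (\<tau> q))"
    have "smooth_section M U ?\<sigma>"
      unfolding smooth_section_def
    proof (intro conjI ballI)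
      show "openin (manifold_topology M) U" using \<tau>(2) by (simp add: smooth_section_def)
      show "?\<sigma> q \<in> pontryagin_fibre M q" if "q \<in> U" for q
        using \<tau>(2) that subspace_neg[OF subspace_tangent_space[of M q], of "fst (\<tau> q)"]
        by (auto simp: smooth_section_def pontryagin_fibre_def mem_Times_iff)
      fix c assume c: "c \<in> atlas M"
      let ?g = "\<lambda>x. pcoord M c (chart_inv c x) (\<tau> (chart_inv c x))"
      have g: "smooth_on (snd c ` (U \<inter> fst c)) ?g" using \<tau>(2) c by (simp add: smooth_section_def)
      have "smooth_on (snd c ` (U \<inter> fst c)) (\<lambda>x. ((-1) *\<^sub>R fst (?g x), snd (?g x)))"
        by (intro smooth_on_Pair smooth_on_scaleR smooth_on_fst[OF g] smooth_on_snd[OF g])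
      then show "smooth_on (snd c ` (U \<inter> fst c)) (\<lambda>x. pcoord M c (chart_inv c x) (?\<sigma> (chart_inv c x)))"
      proof (rule smooth_on_chart_image_cong[OF inj_chart[OF M c] Int_lower2])
        fix q assume q: "q \<in> U \<inter> fst c"
        then show "((-1) *\<^sub>R fst (?g (snd c q)), snd (?g (snd c q))) = pcoord M c q (?\<sigma> q)"
          using chart_inv_eq[OF inj_chart[OF M c], of q]
          by (simp add: pcoord_def linear_neg[OF linear_tcoord[OF M c, of q]])
      qed
    qed
    moreover have "\<forall>q\<in>U. ?\<sigma> q \<in> opposite_dirac D q" using \<tau>(3) by (simp add: opp)
    moreover have "?\<sigma> p = x" by (simp add: \<tau>(4))
    ultimately show "\<exists>U \<sigma>. p \<in> U \<and> smooth_section M U \<sigma> \<and> (\<forall>q\<in>U. \<sigma> q \<in> opposite_dirac D q) \<and> \<sigma> p = x"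
      using \<tau>(1) by (intro exI[of _ U] exI[of _ ?\<sigma>]) simp
  qed
qed

section \<open>The induced Dirac structure on the units\<close>

context dirac_gpd
begin

text \<open>\<open>X\<close> is chosen through \<open>Ts w\<close>, so that at \<open>p\<close> it
  cancels the subtracted source projection and the formula returns \<open>Tt w = v\<close>; the
  covector returns to \<alpha> because \<open>t o \<epsilon>\<close> is the identity.\<close>

lemma induced_dirac_section:
  assumes dist: "smooth_distribution P (G0_units \<Gamma> D)" and p: "p \<in> points P" and x: "(v, \<alpha>) \<in> induced_dirac \<Gamma> D p"
  shows "\<exists>U \<rho>. p \<in> U \<and> smooth_section P U \<rho> \<and> (\<forall>q\<in>U. \<rho> q \<in> induced_dirac \<Gamma> D q) \<and> \<rho> p = (v, \<alpha>)"
proof -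
  note e = unit_arrow[OF p]
  obtain w where w: "(w, ctgt (u p) \<alpha>) \<in> D (u p)" "v = ttgt \<Gamma> (u p) w" and \<alpha>T: "\<alpha> \<in> tangent_space P p"
    using x unfolding induced_dirac_iff[OF p] by (elim exE conjE) (rule that)
  have "\<exists>U X. openin (manifold_topology P) U \<and> p \<in> U \<and> smooth_map_on P U (tangent_bundle P) (\<lambda>q. (q, X q)) \<and>
      (\<forall>q\<in>U. X q \<in> G0_units \<Gamma> D q) \<and> X p = tsrc \<Gamma> (u p) w"
    using dist p tsrc_in_G0_units[OF p w(1)] unfolding smooth_distribution_def by blast
  then obtain UX X where UX: "openin (manifold_topology P) UX" "p \<in> UX"
    and X: "smooth_map_on P UX (tangent_bundle P) (\<lambda>q. (q, X q))"
    and XG: "\<forall>q\<in>UX. X q \<in> G0_units \<Gamma> D q" and Xp: "X p = tsrc \<Gamma> (u p) w"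
    by (elim exE conjE) (rule that)
  have SD: "smooth_subbundle G D" using dirac_arrows by (simp add: dirac_structure_def)
  obtain U' \<tau> where \<tau>: "u p \<in> U'" "smooth_section G U' \<tau>" "\<And>g. g \<in> U' \<Longrightarrow> \<tau> g \<in> D g"
    "\<tau> (u p) = (w, ctgt (u p) \<alpha>)"
    by (rule subbundle_section[OF smooth_arrows SD e w(1)]) (rule that)
  define U where "U = UX \<inter> {q \<in> points P. u q \<in> U'}"
  have UP: "U \<subseteq> points P" unfolding U_def by blast
  have "continuous_map (manifold_topology P) (manifold_topology G) u"
    using smooth_unit unfolding smooth_map_on_def topspace_manifold_topology[symmetric] subtopology_topspace by blast
  moreover have "openin (manifold_topology G) U'" using \<tau>(2) by (simp add: smooth_section_def)
  ultimately have "openin (manifold_topology P) {q \<in> topspace (manifold_topology P). u q \<in> U'}"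
    by (rule openin_continuous_map_preimage)
  then have oU: "openin (manifold_topology P) U"
    unfolding U_def topspace_manifold_topology by (rule openin_Int[OF UX(1)])
  let ?w = "\<lambda>q. fst (\<tau> (u q))" and ?\<beta> = "\<lambda>q. snd (\<tau> (u q))"
  define \<rho> where "\<rho> q = (X q + ttgt \<Gamma> (u q) (?w q) - tsrc \<Gamma> (u q) (?w q), cotangent_map P G u q (?\<beta> q))" for q
  have \<rho>: "\<rho> q \<in> induced_dirac \<Gamma> D q" if q: "q \<in> U" for q
  proof -
    have "(?w q, ?\<beta> q) \<in> D (u q)" using \<tau>(3)[of "u q"] q by (simp add: U_def)
    moreover have "X q \<in> G0_units \<Gamma> D q" using XG q by (simp add: U_def)
    ultimately show ?thesis unfolding \<rho>_def using UP q by (intro induced_dirac_of_section) auto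
  qed
  have fib: "\<rho> q \<in> pontryagin_fibre P q" if q: "q \<in> U" for q
    using \<rho>[OF q] by (auto simp: induced_dirac_def)
  have sec: "smooth_section P U \<rho>"
    unfolding smooth_section_def
  proof (intro conjI oU ballI fib)
    fix c assume c: "c \<in> atlas P"
    note inj = inj_chart[OF smooth_objects c]
    let ?S = "U \<inter> fst c"
    have S: "?S \<subseteq> fst c" by blast
    \<comment> \<open>Along the units \<open>s (u q) = t (u q) = q\<close>, so the same chart
      \<open>c\<close> serves for the base point and for the values of the transported
      vectors.\<close>
    have sub: "snd c ` ?S \<subseteq> snd c ` {q \<in> fst c. u q \<in> U' \<and> t (u q) \<in> fst c}"
      "snd c ` ?S \<subseteq> snd c ` {q \<in> fst c. u q \<in> U' \<and> s (u q) \<in> fst c}"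
      "snd c ` ?S \<subseteq> snd c ` {q \<in> fst c. u q \<in> U'}" "snd c ` ?S \<subseteq> snd c ` (UX \<inter> fst c)"
      by (rule image_mono; auto simp: U_def tgt_unit src_unit)+
    have 1: "smooth_on (snd c ` ?S) (\<lambda>x. tcoord P c (chart_inv c x) (X (chart_inv c x)))"
      by (rule smooth_on_subset[OF smooth_vector_field_of_map(2)[OF smooth_objects UX(1) X c] sub(4)])
    have 2: "smooth_on (snd c ` ?S) (\<lambda>x. tcoord P c (t (u (chart_inv c x))) (ttgt \<Gamma> (u (chart_inv c x)) (?w (chart_inv c x))))"
      unfolding ttgt_def
      by (rule smooth_on_subset[OF smooth_on_tangent_map_section[OF smooth_arrows smooth_objects smooth_objects
          smooth_tgt smooth_unit \<tau>(2) c c] sub(1)])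
    have 3: "smooth_on (snd c ` ?S) (\<lambda>x. tcoord P c (s (u (chart_inv c x))) (tsrc \<Gamma> (u (chart_inv c x)) (?w (chart_inv c x))))"
      unfolding tsrc_def
      by (rule smooth_on_subset[OF smooth_on_tangent_map_section[OF smooth_arrows smooth_objects smooth_objects
          smooth_src smooth_unit \<tau>(2) c c] sub(2)])
    have 4: "smooth_on (snd c ` ?S) (\<lambda>x. ccoord P c (chart_inv c x) (cotangent_map P G u (chart_inv c x) (?\<beta> (chart_inv c x))))"
      by (rule smooth_on_subset[OF smooth_on_cotangent_map_section[OF smooth_arrows smooth_objects smooth_unit \<tau>(2) c] sub(3)])
    show "smooth_on (snd c ` ?S) (\<lambda>x. pcoord P c (chart_inv c x) (\<rho> (chart_inv c x)))"
    proof (rule smooth_on_chart_image_cong[OF inj S smooth_on_Pair[OF smooth_on_diff[OF smooth_on_add[OF 1 2] 3] 4]])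
      fix q assume q: "q \<in> ?S"
      then have qc: "q \<in> fst c" and qP: "q \<in> points P" using UP by auto
      note lt = linear_tcoord[OF smooth_objects c qc]
      show "(tcoord P c (chart_inv c (snd c q)) (X (chart_inv c (snd c q))) +
          tcoord P c (t (u (chart_inv c (snd c q)))) (ttgt \<Gamma> (u (chart_inv c (snd c q))) (?w (chart_inv c (snd c q)))) -
          tcoord P c (s (u (chart_inv c (snd c q)))) (tsrc \<Gamma> (u (chart_inv c (snd c q))) (?w (chart_inv c (snd c q)))),
          ccoord P c (chart_inv c (snd c q)) (cotangent_map P G u (chart_inv c (snd c q)) (?\<beta> (chart_inv c (snd c q))))) =
        pcoord P c q (\<rho> q)"
        by (simp add: chart_inv_eq[OF inj qc] tgt_unit[OF qP] src_unit[OF qP] pcoord_def \<rho>_def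
            linear_add[OF lt] linear_diff[OF lt])
    qed
  qed
  have "cotangent_map P G u p (ctgt (u p) \<alpha>) = \<alpha>"
    unfolding cotangent_map_def[of P]
  proof (rule pullback_covector_unique[OF subspace_tangent_space linear_tangent_map_on[OF csP csG smooth_unit p] \<alpha>T])
    fix y assume y: "y \<in> tangent_space P p"
    show "\<alpha> \<bullet> y = ctgt (u p) \<alpha> \<bullet> tangent_map P G u p y"
      using inner_ctgt[OF e tunit_in[OF p y], of \<alpha>] ttgt_tunit[OF p y] by (simp add: tunit_def)
  qed
  then have "\<rho> p = (v, \<alpha>)" by (simp add: \<rho>_def \<tau>(4) Xp w(2))
  moreover have "p \<in> U" using UX(2) \<tau>(1) p by (simp add: U_def)
  ultimately show ?thesis using sec \<rho> by (intro exI[of _ U] exI[of _ \<rho>]) simp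
qed

lemma induced_dirac_structure:
  assumes "smooth_distribution P (G0_units \<Gamma> D)"
  shows "dirac_structure P (induced_dirac \<Gamma> D)"
proof (rule dirac_structureI[OF smooth_objects induced_dirac_lagrangian])
  fix p x assume "p \<in> points P" "x \<in> induced_dirac \<Gamma> D p"
  then show "\<exists>U \<sigma>. p \<in> U \<and> smooth_section P U \<sigma> \<and> (\<forall>q\<in>U. \<sigma> q \<in> induced_dirac \<Gamma> D q) \<and> \<sigma> p = x"
    using induced_dirac_section[OF assms, of p "fst x" "snd x"] by simp
qed

lemma forward_dirac_tgt:
  assumes dist: "smooth_distribution P (G0_units \<Gamma> D)"
    and surj: "\<forall>g\<in>points G. ttgt \<Gamma> g ` G0 \<Gamma> D g = G0_units \<Gamma> D (t g)"
  shows "forward_dirac_map G D P (induced_dirac \<Gamma> D) t"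
  unfolding forward_dirac_map_def
proof (intro conjI ballI impI dirac_arrows induced_dirac_structure[OF dist] smooth_tgt)
  fix p g x assume g: "g \<in> points G" and p: "t g = p" and x: "x \<in> induced_dirac \<Gamma> D p"
  obtain v \<alpha> where x': "x = (v, \<alpha>)" by (cases x)
  obtain y where "(y, ctgt g \<alpha>) \<in> D g" "ttgt \<Gamma> g y = v"
    by (rule tgt_forward[OF surj g]) (use x x' p in auto)
  then show "case x of (v, \<alpha>) \<Rightarrow> \<exists>(y, \<beta>)\<in>D g. tangent_map G P t g y = v \<and> \<beta> = ctgt g \<alpha>"
    unfolding x' ttgt_def by (intro case_prodI bexI[of _ "(y, ctgt g \<alpha>)"]) auto
qed

lemma forward_dirac_src:
  assumes dist: "smooth_distribution P (G0_units \<Gamma> D)"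
    and surj: "\<forall>g\<in>points G. ttgt \<Gamma> g ` G0 \<Gamma> D g = G0_units \<Gamma> D (t g)"
  shows "forward_dirac_map G D P (opposite_dirac (induced_dirac \<Gamma> D)) s"
  unfolding forward_dirac_map_def
proof (intro conjI ballI impI dirac_arrows dirac_structure_opposite[OF smooth_objects induced_dirac_structure[OF dist]] smooth_src)
  fix p g x assume g: "g \<in> points G" and p: "s g = p" and x: "x \<in> opposite_dirac (induced_dirac \<Gamma> D) p"
  obtain v \<alpha> where x': "x = (- v, \<alpha>)" "(v, \<alpha>) \<in> induced_dirac \<Gamma> D (s g)"
    using x unfolding opposite_dirac_def p by blast
  obtain y where "(y, csrc g \<alpha>) \<in> D g" "tsrc \<Gamma> g y = - v"
    by (rule src_forward[OF surj g x'(2)])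
  then show "case x of (v, \<alpha>) \<Rightarrow> \<exists>(y, \<beta>)\<in>D g. tangent_map G P s g y = v \<and> \<beta> = csrc g \<alpha>"
    unfolding x'(1) tsrc_def by (intro case_prodI bexI[of _ "(y, csrc g \<alpha>)"]) auto
qed

end

theorem theorem3p17:
  fixes \<Gamma> :: "('g, 'e::euclidean_space, 'p, 'f::euclidean_space) groupoid"
    and D :: "'g \<Rightarrow> ('e \<times> 'e) set"
  assumes "dirac_groupoid \<Gamma> D"
    and "smooth_distribution (objects \<Gamma>) (G0_units \<Gamma> D)"
  shows "dirac_structure (objects \<Gamma>) (induced_dirac \<Gamma> D) \<and>
    ((\<forall>g\<in>points (arrows \<Gamma>). ttgt \<Gamma> g ` G0 \<Gamma> D g = G0_units \<Gamma> D (tgt \<Gamma> g)) \<longrightarrow>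
       forward_dirac_map (arrows \<Gamma>) D (objects \<Gamma>) (induced_dirac \<Gamma> D) (tgt \<Gamma>) \<and>
       forward_dirac_map (arrows \<Gamma>) D (objects \<Gamma>) (opposite_dirac (induced_dirac \<Gamma> D)) (src \<Gamma>))"
proof -
  interpret dirac_gpd \<Gamma> D
    by unfold_locales (use assms(1) in \<open>simp_all add: dirac_groupoid_def\<close>)
  show ?thesis
    using induced_dirac_structure[OF assms(2)] forward_dirac_tgt[OF assms(2)] forward_dirac_src[OF assms(2)]
    by blast
qed

end
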